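(* Let $m\in\mathbb{N}\setminus\{1\}$, let $\varphi$ be a smoothly increasing function and let $\omega$ be a radial weight. Then the following statements are valid for every function $f$ meromorphic in $\mathbb{D}$ (where $f^m$ denotes the $m$-th power of $f$): (i) $f^m\in\mathcal{N}\Rightarrow f\in\mathcal{N}$; (ii) $f^m\in\mathcal{N}_0\Rightarrow f\in\mathcal{N}_0$; (iii) $f^m\in\mathcal{N}^\varphi\Rightarrow f\in\mathcal{N}^\varphi$; (iv) $f^m\in\mathcal{N}^\varphi_0\Rightarrow f\in\mathcal{N}^\varphi_0$; (v) $f^m\in\mathcal{D}^\#_1\Rightarrow f\in\mathcal{D}^\#_1$; (vi) $f^m\in\mathcal{D}^\#_{\omega^\star}\Rightarrow f\in\mathcal{D}^\#_{\omega^\star}$; (vii) $f^m\in\mathrm{UBC}\Rightarrow f\in\mathrm{UBC}$.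
   Context: $\mathbb{D}=\{z\in\mathbb{C}:|z|<1\}$, $\mathbb{N}=\{1,2,\ldots\}$, $\mathcal{M}(\mathbb{D})$ is the set of meromorphic functions in $\mathbb{D}$, and $dA(z)=r\,dr\,d\theta/\pi$ for $z=re^{i\theta}$. For $f\in\mathcal{M}(\mathbb{D})$, $f^{\#}=\frac{|f'|}{1+|f|^2}$ is the spherical derivative, extended continuously to the poles of $f$. Normal functions: $\mathcal{N}$ is the set of $f\in\mathcal{M}(\mathbb{D})$ with $\sup_{z\in\mathbb{D}}f^\#(z)(1-|z|^2)<\infty$, and $\mathcal{N}_0$ (strongly normal functions) is the set of $f\in\mathcal{M}(\mathbb{D})$ with $f^\#(z)(1-|z|^2)\to0$ as $|z|\to1^-$. An increasing function $\varphi:[0,1)\to(0,\infty)$ is smoothly increasing if $\varphi(r)(1-r)\to\infty$ as $r\to1^-$, and $$\frac{\varphi(|a+z/\varphi(|a|)|)}{\varphi(|a|)}\to1,\quad |a|\to1^-,$$ uniformly for $z$ in compact subsets of $\mathbb{C}$. For such $\varphi$, $\mathcal{N}^\varphi$ is the set of $f\in\mathcal{M}(\mathbb{D})$ with $\sup_{z\in\mathbb{D}}\frac{f^\#(z)}{\varphi(|z|)}<\infty$, and $\mathcal{N}^\varphi_0$ is the set of $f\in\mathcal{M}(\mathbb{D})$ with $\frac{f^\#(z)}{\varphi(|z|)}\to0$ as $|z|\to1^-$. A radial weight is a nonnegative function $\omega\in L^1(0,1)$ extended to $\mathbb{D}$ by $\omega(z)=\omega(|z|)$. For such $\omega$, $$\omega^\star(z)=\int_{|z|}^1\omega(s)\log\frac{s}{|z|}\,s\,ds,\quad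 z\in\mathbb{D}\setminus\{0\}.$$ $\mathcal{D}^\#_{\omega^\star}$ is the set of $f\in\mathcal{M}(\mathbb{D})$ with $\int_{\mathbb{D}}f^\#(z)^2\omega^\star(z)\,dA(z)<\infty$, and $\mathcal{D}^\#_1$ is the set of $f\in\mathcal{M}(\mathbb{D})$ with $\int_{\mathbb{D}}f^\#(z)^2(1-|z|^2)\,dA(z)<\infty$. $\mathrm{UBC}$ is the set of $f\in\mathcal{M}(\mathbb{D})$ with $$\sup_{a\in\mathbb{D}}\int_{\mathbb{D}}f^\#(z)^2\log\frac{1}{|\varphi_a(z)|}\,dA(z)<\infty,\qquad \varphi_a(z)=\frac{a-z}{1-\overline{a}z}.$$ *)

theory Defs
  imports "HOL-Complex_Analysis.Complex_Analysis"
begin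

abbreviation unit_disc :: "complex set" where
  "unit_disc \<equiv> ball 0 1"

text \<open>
  Meromorphic functions on the disc. The library predicate used here says that the function takes
  its limit value at every point that is not a pole (so removable singularities are removed), and
  the value 0, standing for \<open>\<infinity>\<close>, at every pole.
\<close>
definition mero_disc :: "(complex \<Rightarrow> complex) set" where
  "mero_disc = {f. f nicely_meromorphic_on unit_disc}"

text \<open>The pole case is the continuous extension of the formula valid off the poles.\<close>
definition spherical_deriv :: "(complex \<Rightarrow> complex) \<Rightarrow> complex \<Rightarrow> real" where
  "spherical_deriv f z =
     (if is_pole f z
      then Lim (at z) (\<lambda>w. cmod (deriv f w) / (1 + (cmod (f w))\<^sup>2))
      else cmod (deriv f z) / (1 + (cmod (f z))\<^sup>2))"

text \<open>The filter expressing \<open>|z| \<rightarrow> 1-\<close>.\<close>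
definition to_circle :: "complex filter" where
  "to_circle = filtercomap cmod (at_left 1)"

definition area_measure :: "complex measure" where
  "area_measure = scale_measure (ennreal (1 / pi)) lborel"

definition normal_functions :: "(complex \<Rightarrow> complex) set" where
  "normal_functions =
     {f \<in> mero_disc. bdd_above ((\<lambda>z. spherical_deriv f z * (1 - (cmod z)\<^sup>2)) ` unit_disc)}"

definition strongly_normal_functions :: "(complex \<Rightarrow> complex) set" where
  "strongly_normal_functions =
     {f \<in> mero_disc. ((\<lambda>z. spherical_deriv f z * (1 - (cmod z)\<^sup>2)) \<longlongrightarrow> 0) to_circle}"

text \<open>
  Only the values of \<open>\<phi>\<close> on \<open>[0,1)\<close> matter: for \<open>z\<close> in a compact set, the second condition forces
  \<open>|a + z / \<phi>(|a|)| < 1\<close> once \<open>|a|\<close> is close enough to 1.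
\<close>
definition smoothly_increasing :: "(real \<Rightarrow> real) \<Rightarrow> bool" where
  "smoothly_increasing \<phi> \<longleftrightarrow>
     (\<forall>r\<in>{0..<1}. 0 < \<phi> r) \<and> mono_on {0..<1} \<phi> \<and>
     filterlim (\<lambda>r. \<phi> r * (1 - r)) at_top (at_left 1) \<and>
     (\<forall>K :: complex set. compact K \<longrightarrow>
        uniform_limit K
          (\<lambda>a z. \<phi> (cmod (a + z / complex_of_real (\<phi> (cmod a)))) / \<phi> (cmod a))
          (\<lambda>z. 1) to_circle)"

definition phi_normal_functions :: "(real \<Rightarrow> real) \<Rightarrow> (complex \<Rightarrow> complex) set" where
  "phi_normal_functions \<phi> =
     {f \<in> mero_disc. bdd_above ((\<lambda>z. spherical_deriv f z / \<phi> (cmod z)) ` unit_disc)}"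

definition strongly_phi_normal_functions :: "(real \<Rightarrow> real) \<Rightarrow> (complex \<Rightarrow> complex) set" where
  "strongly_phi_normal_functions \<phi> =
     {f \<in> mero_disc. ((\<lambda>z. spherical_deriv f z / \<phi> (cmod z)) \<longlongrightarrow> 0) to_circle}"

text \<open>A radial weight is given by its profile on \<open>(0,1)\<close>; its value at \<open>z\<close> is \<open>\<omega> (cmod z)\<close>.\<close>
definition radial_weight :: "(real \<Rightarrow> real) \<Rightarrow> bool" where
  "radial_weight \<omega> \<longleftrightarrow>
     (\<forall>r\<in>{0<..<1}. 0 \<le> \<omega> r) \<and> set_integrable lebesgue {0<..<1} \<omega>"

text \<open>
  Meaningful for \<open>0 < |z| < 1\<close>. The totalised value at the origin (here 0) is immaterial, since
  the function is only integrated against area measure. The same remark applies to the value of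
  \<open>ln (1 / |\<phi>\<^sub>a(z)|)\<close> at \<open>z = a\<close> in the definition of \<open>UBC\<close> below.
\<close>
definition weight_star :: "(real \<Rightarrow> real) \<Rightarrow> complex \<Rightarrow> real" where
  "weight_star \<omega> z = (LINT s:{cmod z<..<1}|lebesgue. \<omega> s * ln (s / cmod z) * s)"

definition dirichlet_star :: "(real \<Rightarrow> real) \<Rightarrow> (complex \<Rightarrow> complex) set" where
  "dirichlet_star \<omega> =
     {f \<in> mero_disc.
        (\<integral>\<^sup>+z\<in>unit_disc. ennreal ((spherical_deriv f z)\<^sup>2 * weight_star \<omega> z) \<partial>area_measure) < \<infinity>}"

definition dirichlet_one :: "(complex \<Rightarrow> complex) set" where
  "dirichlet_one =
     {f \<in> mero_disc.
        (\<integral>\<^sup>+z\<in>unit_disc. ennreal ((spherical_deriv f z)\<^sup>2 * (1 - (cmod z)\<^sup>2)) \<partial>area_measure) < \<infinity>}"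

definition disc_aut :: "complex \<Rightarrow> complex \<Rightarrow> complex" where
  "disc_aut a z = (a - z) / (1 - cnj a * z)"

definition UBC :: "(complex \<Rightarrow> complex) set" where
  "UBC =
     {f \<in> mero_disc.
        (SUP a\<in>unit_disc.
           \<integral>\<^sup>+z\<in>unit_disc. ennreal ((spherical_deriv f z)\<^sup>2 * ln (1 / cmod (disc_aut a z)))
             \<partial>area_measure) < \<infinity>}"

end

theory Submission
  imports Defs
begin

text \<open>
  For the pointwise classes (i)-(iv): if \<open>(f\<^sup>m)\<^sup>#\<close> is at most \<open>M\<close> on a disc of radius \<open>\<rho>\<close> with \<open>M \<rho>\<close>
  small, then \<open>f\<^sup>m\<close> moves little on the sphere over that disc, so \<open>f\<close> or \<open>1/f\<close> is bounded there, and
  \<open>f\<^sup>#\<close> at the centre is at most a multiple of \<open>(M \<rho>)\<^bsup>1/m\<^esup> / \<rho>\<close>: where \<open>f\<^sup>m\<close> is not small this is the chain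
  rule, otherwise \<open>f\<close> itself is small on the disc and Cauchy's estimate applies.

  For the integral classes (v)-(vii): the function \<open>h = m ln (1 + |f|\<^sup>2) - ln (1 + |f\<^sup>m|\<^sup>2)\<close> is bounded,
  is invariant under \<open>f \<mapsto> 1/f\<close> and hence smooth even at the poles, and has Laplacian
  \<open>4 (m (f\<^sup>#)\<^sup>2 - ((f\<^sup>m)\<^sup>#)\<^sup>2)\<close>. Green's formula against a weight that is the positive part of a superharmonic
  function with bounded Laplacian mass therefore bounds the weighted integral of \<open>(f\<^sup>#)\<^sup>2\<close> by that of
  \<open>((f\<^sup>m)\<^sup>#)\<^sup>2\<close> plus a constant. The weights \<open>1 - |z|\<^sup>2\<close>, \<open>ln (1 / |\<phi>\<^sub>a|)\<close> and \<open>ln (s / |z|)\<close> are limits of such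
  weights, with constants independent of \<open>a\<close> and \<open>s\<close>, and \<open>\<omega>\<^sup>\<star>\<close> is a superposition of the last ones.
\<close>

subsection \<open>Directional derivatives\<close>

text \<open>For (v)-(vii) nothing is known about \<open>f\<close> near the circle. This is why the
  weights are positive parts: each \<open>L\<close> is at most \<open>0\<close> off a compact subset
  of the disc, so Green's formula has no boundary term, and the constant depends on \<open>m\<close>
  and on the Laplacian mass of \<open>L\<close> alone. The factor \<open>m\<close> in
  \<open>h\<close> is forced: it gives \<open>(1 + |f|^2)^m\<close> and \<open>1 + |f|^(2m)\<close>
  the same growth at infinity, and their quotient lies between \<open>1\<close> and
  \<open>2^m\<close>. Only Laplacians enter, and a Laplacian is the sum of the second derivatives
  along \<open>1\<close> and \<open>\<i>\<close>. Green's formula therefore splits into two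
  statements about one fixed direction, each of which reduces to the fact that a directional
  derivative of a compactly supported function has integral \<open>0\<close>. At a pole the stored
  value is \<open>0\<close>, so \<open>f\<close> itself is discontinuous there; local computations
  are carried out on a holomorphic function \<open>k\<close> equal to \<open>f\<close> or to
  \<open>1/f\<close>.\<close>

definition has_dir_deriv :: "complex \<Rightarrow> (complex \<Rightarrow> real) \<Rightarrow> real \<Rightarrow> complex \<Rightarrow> bool" where
  "has_dir_deriv e u d z \<longleftrightarrow> ((\<lambda>t. u (z + of_real t * e)) has_real_derivative d) (at 0)"

text \<open>The derivatives are arguments, so that those along \<open>1\<close> and
  \<open>\<i>\<close> can be added to a Laplacian with an explicit formula. Continuity is demanded
  on \<open>S\<close> as a subset of the plane and not only along lines; the integrals over the
  plane rely on it.\<close>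

definition C2_along :: "complex set \<Rightarrow> complex \<Rightarrow> (complex \<Rightarrow> real) \<Rightarrow> (complex \<Rightarrow> real) \<Rightarrow> (complex \<Rightarrow> real) \<Rightarrow> bool" where
  "C2_along S e u u1 u2 \<longleftrightarrow> continuous_on S u \<and> continuous_on S u1 \<and> continuous_on S u2 \<and>
     (\<forall>z\<in>S. has_dir_deriv e u (u1 z) z \<and> has_dir_deriv e u1 (u2 z) z)"

text \<open>A canonical name for the derivative: local formulas from different charts live on
  different neighbourhoods and are glued into one function through it.\<close>

definition dir_deriv :: "complex \<Rightarrow> (complex \<Rightarrow> real) \<Rightarrow> complex \<Rightarrow> real" where
  "dir_deriv e u z = deriv (\<lambda>t. u (z + of_real t * e)) 0"

lemma has_dir_deriv_line:
  assumes "has_dir_deriv e u d (a + of_real t * e)"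
  shows "((\<lambda>t. u (a + of_real t * e)) has_real_derivative d) (at t)"
proof -
  have "(\<lambda>x. u (a + of_real t * e + of_real x * e)) = (\<lambda>x. u (a + of_real (x + t) * e))"
    by (simp add: algebra_simps)
  then show ?thesis
    using assms DERIV_shift[of "\<lambda>t. u (a + of_real t * e)" d 0 t] by (simp add: has_dir_deriv_def)
qed

lemma has_dir_deriv_imp_eq: "has_dir_deriv e u d z \<Longrightarrow> dir_deriv e u z = d"
  unfolding has_dir_deriv_def dir_deriv_def by (rule DERIV_imp_deriv)

lemma eventually_line_in_open:
  fixes z e :: complex
  assumes "open N" "z \<in> N"
  shows "eventually (\<lambda>t::real. z + of_real t * e \<in> N) (nhds 0)"
proof -
  have "open ((\<lambda>t::real. z + of_real t * e) -` N)"
    by (intro open_vimage assms(1) continuous_intros)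
  then show ?thesis using assms(2) by (auto simp: eventually_nhds)
qed

lemma has_dir_deriv_cong:
  assumes "open N" "z \<in> N" "\<And>w. w \<in> N \<Longrightarrow> u w = v w"
  shows "has_dir_deriv e u d z \<longleftrightarrow> has_dir_deriv e v d z"
  unfolding has_dir_deriv_def
  by (rule DERIV_cong_ev) (use eventually_line_in_open[OF assms(1,2), of e] assms(3) in \<open>auto elim: eventually_mono\<close>)

lemma C2_along_dir_deriv:
  assumes "C2_along N e u u1 u2" "open N" "z \<in> N"
  shows "dir_deriv e u z = u1 z" "dir_deriv e (dir_deriv e u) z = u2 z"
proof -
  have *: "dir_deriv e u w = u1 w" if "w \<in> N" for w
    using assms(1) that by (auto simp: C2_along_def intro: has_dir_deriv_imp_eq)
  show "dir_deriv e u z = u1 z" using * assms by auto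
  have "has_dir_deriv e u1 (u2 z) z" using assms by (auto simp: C2_along_def)
  then have "has_dir_deriv e (dir_deriv e u) (u2 z) z"
    using has_dir_deriv_cong[OF assms(2,3), of "dir_deriv e u" u1] * by auto
  then show "dir_deriv e (dir_deriv e u) z = u2 z" by (rule has_dir_deriv_imp_eq)
qed

lemma C2_along_local:
  assumes "\<And>z. z \<in> S \<Longrightarrow> \<exists>N u1 u2. open N \<and> z \<in> N \<and> C2_along N e u u1 u2"
  shows "C2_along S e u (dir_deriv e u) (dir_deriv e (dir_deriv e u))"
proof -
  have "isCont u z \<and> isCont (dir_deriv e u) z \<and> isCont (dir_deriv e (dir_deriv e u)) z \<and>
     has_dir_deriv e u (dir_deriv e u z) z \<and> has_dir_deriv e (dir_deriv e u) (dir_deriv e (dir_deriv e u) z) z"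
    if z: "z \<in> S" for z
  proof -
    obtain N u1 u2 where N: "open N" "z \<in> N" "C2_along N e u u1 u2" using assms z by blast
    note eq = C2_along_dir_deriv[OF N(3,1)]
    have "continuous_on N (dir_deriv e u)" "continuous_on N (dir_deriv e (dir_deriv e u))" "continuous_on N u"
      using N(3) eq by (auto simp: C2_along_def cong: continuous_on_cong)
    moreover have "has_dir_deriv e u (u1 z) z" "has_dir_deriv e u1 (u2 z) z"
      using N by (auto simp: C2_along_def)
    moreover have "has_dir_deriv e (dir_deriv e u) (u2 z) z"
      using has_dir_deriv_cong[OF N(1,2), of "dir_deriv e u" u1] eq calculation by auto
    ultimately show ?thesis using eq[OF N(2)] N(1,2) continuous_on_eq_continuous_at by metis
  qed
  then show ?thesis unfolding C2_along_def by (auto intro: continuous_at_imp_continuous_on)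
qed

lemma C2_along_cong:
  assumes "C2_along S e u u1 u2" "open S" "\<And>z. z \<in> S \<Longrightarrow> v z = u z"
  shows "C2_along S e v u1 u2"
  using assms(1) has_dir_deriv_cong[OF assms(2) _ assms(3)] assms(3)
  unfolding C2_along_def by (auto cong: continuous_on_cong)

lemma C2_along_subset: "C2_along S e u u1 u2 \<Longrightarrow> T \<subseteq> S \<Longrightarrow> C2_along T e u u1 u2"
  unfolding C2_along_def by (auto intro: continuous_on_subset)

lemma C2_along_linear:
  assumes "C2_along S e u u1 u2" "C2_along S e v v1 v2"
  shows "C2_along S e (\<lambda>z. a * u z + b * v z + c) (\<lambda>z. a * u1 z + b * v1 z) (\<lambda>z. a * u2 z + b * v2 z)"
  using assms unfolding C2_along_def has_dir_deriv_def
  by (auto intro!: continuous_intros derivative_eq_intros)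

lemma C2_along_const: "C2_along S e (\<lambda>z. c) (\<lambda>z. 0) (\<lambda>z. 0)"
  unfolding C2_along_def has_dir_deriv_def by (auto intro!: continuous_intros)

lemma C2_along_compose:
  fixes \<psi> :: "real \<Rightarrow> real"
  assumes u: "C2_along S e u u1 u2" and T: "\<And>z. z \<in> S \<Longrightarrow> u z \<in> T"
    and \<psi>: "\<And>x. x \<in> T \<Longrightarrow> (\<psi> has_real_derivative \<psi>1 x) (at x)"
           "\<And>x. x \<in> T \<Longrightarrow> (\<psi>1 has_real_derivative \<psi>2 x) (at x)" "continuous_on T \<psi>2"
  shows "C2_along S e (\<lambda>z. \<psi> (u z)) (\<lambda>z. \<psi>1 (u z) * u1 z) (\<lambda>z. \<psi>2 (u z) * (u1 z)\<^sup>2 + \<psi>1 (u z) * u2 z)"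
proof -
  have c: "continuous_on T \<psi>" "continuous_on T \<psi>1"
    using \<psi>(1,2) by (meson DERIV_continuous continuous_at_imp_continuous_on)+
  have cu: "continuous_on S (\<lambda>z. \<psi> (u z))" "continuous_on S (\<lambda>z. \<psi>1 (u z))" "continuous_on S (\<lambda>z. \<psi>2 (u z))"
    using u T by (auto intro!: continuous_on_compose2[OF c(1)] continuous_on_compose2[OF c(2)]
        continuous_on_compose2[OF \<psi>(3)] simp: C2_along_def)
  have "has_dir_deriv e (\<lambda>z. \<psi> (u z)) (\<psi>1 (u z) * u1 z) z"
       "has_dir_deriv e (\<lambda>z. \<psi>1 (u z) * u1 z) (\<psi>2 (u z) * (u1 z)\<^sup>2 + \<psi>1 (u z) * u2 z) z" if z: "z \<in> S" for z
  proof -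
    have d: "((\<lambda>t. u (z + of_real t * e)) has_real_derivative u1 z) (at 0)"
       "((\<lambda>t. u1 (z + of_real t * e)) has_real_derivative u2 z) (at 0)"
      using u z by (auto simp: C2_along_def has_dir_deriv_def)
    have p: "(\<psi> has_real_derivative \<psi>1 (u z)) (at (u (z + of_real 0 * e)))"
       "(\<psi>1 has_real_derivative \<psi>2 (u z)) (at (u (z + of_real 0 * e)))" using \<psi>(1,2) T[OF z] by auto
    note 1 = DERIV_chain2[OF p(1) d(1)] and 2 = DERIV_chain2[OF p(2) d(1)]
    show "has_dir_deriv e (\<lambda>z. \<psi> (u z)) (\<psi>1 (u z) * u1 z) z"
      using 1 by (simp add: has_dir_deriv_def)
    show "has_dir_deriv e (\<lambda>z. \<psi>1 (u z) * u1 z) (\<psi>2 (u z) * (u1 z)\<^sup>2 + \<psi>1 (u z) * u2 z) z"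
      using DERIV_mult[OF 2 d(2)] by (simp add: has_dir_deriv_def power2_eq_square algebra_simps)
  qed
  then show ?thesis using u cu unfolding C2_along_def by (auto intro!: continuous_intros)
qed

section \<open>Laplacians of \<open>|k|^2\<close> and \<open>ln (|k|^2 + \<epsilon>)\<close> for
  holomorphic \<open>k\<close>\<close>

lemma DERIV_sum_products:
  fixes a b c d :: "real \<Rightarrow> real"
  assumes "(a has_real_derivative a') (at t)" "(b has_real_derivative b') (at t)"
    "(c has_real_derivative c') (at t)" "(d has_real_derivative d') (at t)"
  shows "((\<lambda>t. a t * c t + b t * d t) has_real_derivative a' * c t + a t * c' + b' * d t + b t * d') (at t)"
  using DERIV_add[OF DERIV_mult[OF assms(1,3)] DERIV_mult[OF assms(2,4)]] by (simp add: algebra_simps)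

lemma DERIV_inverse_one_plus:
  fixes q :: "real \<Rightarrow> real"
  assumes "(q has_real_derivative d) (at t)" "1 + q t \<noteq> 0"
  shows "((\<lambda>t. 1 / (1 + q t)) has_real_derivative - d / (1 + q t)\<^sup>2) (at t)"
  using assms by (auto intro!: derivative_eq_intros simp: power2_eq_square)

text \<open>Along the line \<open>k\<close> has the derivative \<open>deriv k z * e\<close>, and
  \<open>|k|^2\<close> is \<open>Re^2 + Im^2\<close>. The term with the second derivative of
  \<open>k\<close> carries \<open>e^2\<close>; it cancels in the sum over \<open>e = 1\<close> and
  \<open>e = \<i>\<close>, which leaves the Laplacian \<open>4 |k'|^2\<close>.\<close>

lemma C2_along_norm_square:
  assumes k: "k holomorphic_on S" and S: "open S"
  shows "C2_along S e (\<lambda>z. (cmod (k z))\<^sup>2)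
    (\<lambda>z. 2 * Re (cnj (k z) * (deriv k z * e)))
    (\<lambda>z. 2 * (cmod (deriv k z * e))\<^sup>2 + 2 * Re (cnj (k z) * (deriv (deriv k) z * e\<^sup>2)))"
proof -
  have k': "deriv k holomorphic_on S" "deriv (deriv k) holomorphic_on S"
    using k S by (auto intro!: holomorphic_deriv)
  have c: "continuous_on S k" "continuous_on S (deriv k)" "continuous_on S (deriv (deriv k))"
    using k k' by (auto intro: holomorphic_on_imp_continuous_on)
  have line: "((\<lambda>t. g (z + of_real t * e)) has_vector_derivative deriv g z * e) (at 0)"
    if g: "g holomorphic_on S" and z: "z \<in> S" for g z
  proof -
    have "((\<lambda>w. g w) has_field_derivative deriv g z) (at (z + of_real 0 * e))"
      using holomorphic_derivI[OF g S z] by simp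
    moreover have "((\<lambda>t. z + of_real t * e) has_vector_derivative e) (at (0::real))"
      by (auto intro!: derivative_eq_intros simp: has_vector_derivative_def scaleR_conv_of_real)
    ultimately show ?thesis
      using field_vector_diff_chain_at[of "\<lambda>t. z + of_real t * e" e 0 g "deriv g z"]
      by (simp add: o_def mult.commute)
  qed
  have "has_dir_deriv e (\<lambda>z. (cmod (k z))\<^sup>2) (2 * Re (cnj (k z) * (deriv k z * e))) z \<and>
     has_dir_deriv e (\<lambda>z. 2 * Re (cnj (k z) * (deriv k z * e)))
      (2 * (cmod (deriv k z * e))\<^sup>2 + 2 * Re (cnj (k z) * (deriv (deriv k) z * e\<^sup>2))) z" if z: "z \<in> S" for z
  proof -
    note 0 = line[OF k z] and 1 = line[OF k'(1) z]
    define K where "K = (\<lambda>t. k (z + of_real t * e))"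
    define K' where "K' = (\<lambda>t. deriv k (z + of_real t * e) * e)"
    have 1: "(K' has_vector_derivative deriv (deriv k) z * e * e) (at 0)"
      unfolding K'_def by (rule has_vector_derivative_mult_left[OF 1])
    have kRe: "((\<lambda>t. Re (K t)) has_real_derivative Re (K' 0)) (at 0)"
      "((\<lambda>t. Im (K t)) has_real_derivative Im (K' 0)) (at 0)"
      "((\<lambda>t. Re (K' t)) has_real_derivative Re (deriv (deriv k) z * e * e)) (at 0)"
      "((\<lambda>t. Im (K' t)) has_real_derivative Im (deriv (deriv k) z * e * e)) (at 0)"
      using 0 1 unfolding has_vector_derivative_complex_iff K_def[symmetric] by (auto simp: K'_def)
    have q: "((\<lambda>t. (cmod (K t))\<^sup>2) has_real_derivative 2 * Re (cnj (K 0) * K' 0)) (at 0)"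
      using DERIV_sum_products[OF kRe(1,2) kRe(1,2)] unfolding cmod_power2
      by (simp add: power2_eq_square algebra_simps)
    have "((\<lambda>t. Re (cnj (K t) * K' t)) has_real_derivative
        (cmod (K' 0))\<^sup>2 + Re (cnj (K 0) * (deriv (deriv k) z * e * e))) (at 0)"
      using DERIV_sum_products[OF kRe] unfolding cmod_power2
      by (simp add: power2_eq_square algebra_simps)
    from DERIV_cmult[OF this, of 2] q show ?thesis
      unfolding has_dir_deriv_def K_def K'_def by (simp add: power2_eq_square algebra_simps)
  qed
  then show ?thesis using c unfolding C2_along_def by (auto intro!: continuous_intros)
qed

text \<open>The parameter serves three purposes: \<epsilon> = 1 yields the squared spherical
  derivative as a Laplacian, \<epsilon> = 0 says that \<open>ln |k|\<close> is harmonic where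
  \<open>k\<close> has no zero, and small \<epsilon> > 0 regularises the singularity of
  \<open>ln |z - a|\<close>.\<close>

lemma C2_along_ln_norm_square:
  assumes k: "k holomorphic_on S" and S: "open S" and pos: "\<And>z. z \<in> S \<Longrightarrow> (cmod (k z))\<^sup>2 + \<epsilon> > 0"
  obtains u1 u2 where "\<And>e. C2_along S e (\<lambda>z. ln ((cmod (k z))\<^sup>2 + \<epsilon>)) (u1 e) (u2 e)"
    "\<And>z. z \<in> S \<Longrightarrow> u2 1 z + u2 \<i> z = 4 * \<epsilon> * (cmod (deriv k z))\<^sup>2 / ((cmod (k z))\<^sup>2 + \<epsilon>)\<^sup>2"
proof -
  define q1 where "q1 = (\<lambda>e z. 2 * Re (cnj (k z) * (deriv k z * e)))"
  define q2 where "q2 = (\<lambda>e z. 2 * (cmod (deriv k z * e))\<^sup>2 + 2 * Re (cnj (k z) * (deriv (deriv k) z * e\<^sup>2)))"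
  let ?q = "\<lambda>z. (cmod (k z))\<^sup>2"
  have q: "C2_along S e ?q (q1 e) (q2 e)" for e
    unfolding q1_def q2_def by (rule C2_along_norm_square[OF k S])
  have "C2_along S e (\<lambda>z. ln (?q z + \<epsilon>)) (\<lambda>z. inverse (?q z + \<epsilon>) * q1 e z)
     (\<lambda>z. - inverse ((?q z + \<epsilon>)\<^sup>2) * (q1 e z)\<^sup>2 + inverse (?q z + \<epsilon>) * q2 e z)" for e
  proof (rule C2_along_compose[OF q, where T = "{-\<epsilon><..}"])
    fix x assume "x \<in> {-\<epsilon><..}"
    then have x: "x + \<epsilon> > 0" by simp
    show "((\<lambda>x. ln (x + \<epsilon>)) has_real_derivative inverse (x + \<epsilon>)) (at x)"
      using x by (auto intro!: derivative_eq_intros simp: field_simps)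
    show "((\<lambda>x. inverse (x + \<epsilon>)) has_real_derivative - inverse ((x + \<epsilon>)\<^sup>2)) (at x)"
      using x by (auto intro!: derivative_eq_intros simp: power2_eq_square)
  next
    have "(x + \<epsilon>)\<^sup>2 \<noteq> 0" if "x \<in> {-\<epsilon><..}" for x using that by simp
    then show "continuous_on {-\<epsilon><..} (\<lambda>x. - inverse ((x + \<epsilon>)\<^sup>2))" by (intro continuous_intros) auto
  qed (use pos in force)
  moreover have "(- inverse ((?q z + \<epsilon>)\<^sup>2) * (q1 1 z)\<^sup>2 + inverse (?q z + \<epsilon>) * q2 1 z)
     + (- inverse ((?q z + \<epsilon>)\<^sup>2) * (q1 \<i> z)\<^sup>2 + inverse (?q z + \<epsilon>) * q2 \<i> z)
     = 4 * \<epsilon> * (cmod (deriv k z))\<^sup>2 / (?q z + \<epsilon>)\<^sup>2" if z: "z \<in> S" for z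
  proof -
    \<comment> \<open>With \<open>w = cnj (k z) * deriv k z\<close> the two first derivatives are
      \<open>2 * Re w\<close> and \<open>- 2 * Im w\<close>.\<close>
    have a: "(q1 1 z)\<^sup>2 + (q1 \<i> z)\<^sup>2 = 4 * ?q z * (cmod (deriv k z))\<^sup>2"
      unfolding q1_def cmod_power2 by (simp add: power2_eq_square algebra_simps)
    have b: "q2 1 z + q2 \<i> z = 4 * (cmod (deriv k z))\<^sup>2"
      unfolding q2_def by (simp add: norm_mult)
    define Q where "Q = ?q z + \<epsilon>"
    have Q: "Q \<noteq> 0" using pos[OF z] by (simp add: Q_def)
    have "(- inverse (Q\<^sup>2) * (q1 1 z)\<^sup>2 + inverse Q * q2 1 z) + (- inverse (Q\<^sup>2) * (q1 \<i> z)\<^sup>2 + inverse Q * q2 \<i> z)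
      = - inverse (Q\<^sup>2) * ((q1 1 z)\<^sup>2 + (q1 \<i> z)\<^sup>2) + inverse Q * (q2 1 z + q2 \<i> z)" by (simp add: algebra_simps)
    also have "\<dots> = 4 * (Q - ?q z) * (cmod (deriv k z))\<^sup>2 / Q\<^sup>2"
      unfolding a b using Q by (simp add: field_simps power2_eq_square)
    finally show ?thesis by (simp add: Q_def)
  qed
  ultimately show ?thesis using that[of "\<lambda>e z. inverse (?q z + \<epsilon>) * q1 e z"
     "\<lambda>e z. - inverse ((?q z + \<epsilon>)\<^sup>2) * (q1 e z)\<^sup>2 + inverse (?q z + \<epsilon>) * q2 e z"] by blast
qed

subsection \<open>Green's formula\<close>

lemma integral_lborel_translation:
  fixes f :: "complex \<Rightarrow> real"
  assumes "f \<in> borel_measurable borel"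
  shows "(\<integral>z. f (z + c) \<partial>lborel) = (\<integral>z. f z \<partial>lborel)"
proof -
  have "(\<integral>z. f z \<partial>lborel) = (\<integral>z. f z \<partial>(distr lborel borel ((+) c)))"
    by (simp add: lborel_distr_plus)
  also have "\<dots> = (\<integral>z. f (c + z) \<partial>lborel)"
    by (rule integral_distr) (use assms in auto)
  finally show ?thesis by (simp add: add.commute)
qed

lemma integrable_continuous_compact_support:
  fixes f :: "complex \<Rightarrow> real"
  assumes "compact K" "K \<subseteq> S" "continuous_on S f" "\<And>z. z \<in> S - K \<Longrightarrow> f z = 0"
  shows "set_integrable lborel S f"
proof -
  have "integrable lborel (\<lambda>z. indicator K z *\<^sub>R f z)"
    by (rule borel_integrable_compact) (use assms continuous_on_subset in auto)
  moreover have "(\<lambda>z. indicator K z *\<^sub>R f z) = (\<lambda>z. indicator S z *\<^sub>R f z)"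
    using assms(2,4) by (auto simp: indicator_def fun_eq_iff)
  ultimately show ?thesis by (simp add: set_integrable_def)
qed

text \<open>By translation invariance every difference quotient of \<open>P\<close> along
  \<open>e\<close> has integral \<open>0\<close>. The mean value theorem bounds the quotients by the
  supremum of \<open>|Q|\<close>, and step parameters of at most \<open>1\<close> keep their
  supports in one ball, so dominated convergence carries the value \<open>0\<close> over to
  \<open>Q\<close>.\<close>

lemma integral_dir_deriv_eq_0:
  assumes P: "continuous_on UNIV P" and Q: "continuous_on UNIV Q" and K: "compact K"
    and deriv: "\<And>z. has_dir_deriv e P (Q z) z"
    and 0: "\<And>z. z \<notin> K \<Longrightarrow> P z = 0" "\<And>z. z \<notin> K \<Longrightarrow> Q z = 0"
  shows "(\<integral>z. Q z \<partial>lborel) = 0"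
proof -
  obtain r where r: "K \<subseteq> cball 0 r" using compact_imp_bounded[OF K] by (auto simp: bounded_iff subset_iff)
  have iP: "integrable lborel P"
    using integrable_continuous_compact_support[OF K _ P] 0 by (simp add: set_integrable_def)
  have meas: "P \<in> borel_measurable borel" "Q \<in> borel_measurable borel"
    using P Q by (auto intro: borel_measurable_continuous_onI)
  obtain B where B: "\<And>z. \<bar>Q z\<bar> \<le> B"
  proof -
    have "compact (Q ` K)" using K Q by (meson compact_continuous_image continuous_on_subset subset_UNIV)
    then obtain B where "\<And>z. z \<in> K \<Longrightarrow> \<bar>Q z\<bar> \<le> B"
      by (metis bounded_real compact_imp_bounded imageI)
    then have "\<bar>Q z\<bar> \<le> max 0 B" for z using 0(2)[of z] by (cases "z \<in> K") fastforce+
    then show ?thesis using that by blast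
  qed
  define h where "h = (\<lambda>n::nat. inverse (real (Suc n)))"
  have h: "h n > 0" "h n \<le> 1" for n by (auto simp: h_def inverse_le_1_iff)
  define s where "s = (\<lambda>n z. (P (z + of_real (h n) * e) - P z) / h n)"
  have s_int: "(\<integral>z. s n z \<partial>lborel) = 0" for n
  proof -
    have "integrable lborel (\<lambda>z. P (z + of_real (h n) * e))"
      using iP integrable_distr[of "(+) (of_real (h n) * e)" lborel borel P]
      by (simp add: lborel_distr_plus add.commute)
    then show ?thesis using iP integral_lborel_translation[OF meas(1)] by (simp add: s_def)
  qed
  have s_lim: "(\<lambda>n. s n z) \<longlonglongrightarrow> Q z" for z
  proof -
    have "((\<lambda>t. (P (z + of_real t * e) - P z) / t) \<longlongrightarrow> Q z) (at 0)"
      using deriv[of z] by (simp add: has_dir_deriv_def has_field_derivative_iff)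
    moreover have "filterlim h (at 0) sequentially"
      unfolding filterlim_at using h(1) LIMSEQ_inverse_real_of_nat by (auto simp: h_def)
    ultimately show ?thesis unfolding s_def using filterlim_compose by blast
  qed
  have s_bound: "norm (s n z) \<le> B * indicator (cball 0 (r + cmod e)) z" for n z
  proof (cases "z \<in> cball 0 (r + cmod e)")
    case True
    have "((\<lambda>t. P (z + of_real t * e)) has_real_derivative Q (z + of_real t * e)) (at t)" for t
      using has_dir_deriv_line deriv by blast
    from MVT2[OF h(1)[of n] this] obtain \<xi> where
      "P (z + of_real (h n) * e) - P z = h n * Q (z + of_real \<xi> * e)" by auto
    then have "s n z = Q (z + of_real \<xi> * e)" using h(1)[of n] by (simp add: s_def)
    then show ?thesis using B True by simp
  next
    case False
    have "cmod (of_real (h n) * e) \<le> cmod e" using h[of n] by (simp add: norm_mult mult_left_le_one_le)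
    then have "cmod z - cmod e \<le> cmod (z + of_real (h n) * e)" using norm_diff_ineq[of z "of_real (h n) * e"] by linarith
    then have "z \<notin> K" "z + of_real (h n) * e \<notin> K" using False r norm_ge_zero[of e]
      by (auto simp: subset_iff simp del: norm_ge_zero)
    then show ?thesis using False 0(1) by (simp add: s_def)
  qed
  have "(\<lambda>n. \<integral>z. s n z \<partial>lborel) \<longlonglongrightarrow> (\<integral>z. Q z \<partial>lborel)"
  proof (rule integral_dominated_convergence[where w = "\<lambda>z. B * indicator (cball 0 (r + cmod e)) z"])
    show "integrable lborel (\<lambda>z. B * indicator (cball 0 (r + cmod e)) z)"
      by (intro integrable_mult_right integrable_real_indicator emeasure_lborel_cball_finite) simp
    show "s n \<in> borel_measurable lborel" for n unfolding s_def using meas by measurable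
    show "Q \<in> borel_measurable lborel" using meas by simp
    show "AE z in lborel. (\<lambda>n. s n z) \<longlonglongrightarrow> Q z" using s_lim by (intro AE_I2)
    show "AE z in lborel. norm (s n z) \<le> B * indicator (cball 0 (r + cmod e)) z" for n
      using s_bound by (intro AE_I2)
  qed
  then show ?thesis unfolding s_int by (simp add: LIMSEQ_const_iff)
qed

text \<open>The difference \<open>w * u2 - u * w2\<close> is the derivative along \<open>e\<close>
  of \<open>w * u1 - u * w1\<close>. Both are extended by \<open>0\<close> to the plane, and
  \<open>integral_dir_deriv_eq_0\<close> applies.\<close>

lemma green_along:
  assumes S: "open S" and K: "compact K" "K \<subseteq> S"
    and u: "C2_along S e u u1 u2" and w: "C2_along S e w w1 w2"
    and 0: "\<And>z. z \<in> S - K \<Longrightarrow> w z = 0"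
  shows "(LINT z:S|lborel. w z * u2 z) = (LINT z:S|lborel. u z * w2 z)"
    and "set_integrable lborel S (\<lambda>z. w z * u2 z)" "set_integrable lborel S (\<lambda>z. u z * w2 z)"
proof -
  have SK: "open (S - K)" using S K by (simp add: compact_imp_closed open_Diff)
  \<comment> \<open>\<open>w\<close> vanishes on the open set \<open>S - K\<close>, hence so do its
    derivatives.\<close>
  have "C2_along (S - K) e w (\<lambda>z. 0) (\<lambda>z. 0)"
    by (rule C2_along_cong[OF C2_along_const[of _ _ 0] SK 0])
  from C2_along_dir_deriv[OF this SK] C2_along_dir_deriv[OF C2_along_subset[OF w, of "S - K"] SK]
  have 1: "w1 z = 0" "w2 z = 0" if "z \<in> S - K" for z using that by auto
  define P where "P = (\<lambda>z. if z \<in> S then w z * u1 z - u z * w1 z else 0)"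
  define Q where "Q = (\<lambda>z. if z \<in> S then w z * u2 z - u z * w2 z else 0)"
  have out: "P z = 0" "Q z = 0" if "z \<notin> K" for z using that 0 1 by (auto simp: P_def Q_def)
  have op: "open (- K)" using K by (simp add: compact_imp_closed open_Compl)
  have cont: "continuous_on UNIV f" if "continuous_on S f" "\<And>z. z \<notin> K \<Longrightarrow> f z = 0" for f :: "complex \<Rightarrow> real"
  proof -
    have "continuous_on (- K) f \<longleftrightarrow> continuous_on (- K) (\<lambda>z. 0 :: real)"
      using that(2) by (intro continuous_on_cong) auto
    then have "continuous_on (- K) f" by simp
    then have "continuous_on (S \<union> - K) f" using continuous_on_open_Un[OF S op that(1)] by blast
    moreover have "S \<union> - K = UNIV" using K by auto
    ultimately show ?thesis by simp
  qed
  note cuw = u[unfolded C2_along_def] w[unfolded C2_along_def]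
  have "continuous_on S P" "continuous_on S Q"
    unfolding P_def Q_def using cuw by (auto intro!: continuous_intros cong: continuous_on_cong)
  then have PQ: "continuous_on UNIV P" "continuous_on UNIV Q" using cont out by blast+
  have "has_dir_deriv e P (Q z) z" for z
  proof (cases "z \<in> S")
    case True
    have "has_dir_deriv e (\<lambda>z. w z * u1 z - u z * w1 z) (Q z) z"
      using cuw True unfolding has_dir_deriv_def Q_def
      by (auto intro!: derivative_eq_intros simp: algebra_simps)
    then show ?thesis using has_dir_deriv_cong[OF S True, of P] by (simp add: P_def)
  next
    case False
    then have z: "z \<in> - K" using K by auto
    have "has_dir_deriv e (\<lambda>z. 0) (Q z) z"
      using out z by (auto simp: has_dir_deriv_def)
    then show ?thesis using has_dir_deriv_cong[OF op z, of P] out by simp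
  qed
  from integral_dir_deriv_eq_0[OF PQ K(1) this out] have Q0: "(\<integral>z. Q z \<partial>lborel) = 0" .
  show i: "set_integrable lborel S (\<lambda>z. w z * u2 z)" "set_integrable lborel S (\<lambda>z. u z * w2 z)"
    using cuw 0 1 by (auto intro!: integrable_continuous_compact_support[OF K] continuous_intros)
  have "(\<integral>z. Q z \<partial>lborel) = (LINT z:S|lborel. w z * u2 z - u z * w2 z)"
    unfolding set_lebesgue_integral_def Q_def by (rule Bochner_Integration.integral_cong) auto
  then show "(LINT z:S|lborel. w z * u2 z) = (LINT z:S|lborel. u z * w2 z)"
    using Q0 i by (simp add: set_integral_diff)
qed

subsection \<open>Charts of the Riemann sphere\<close>

text \<open>The second equation concerns the bare quotient, since the spherical derivative at a pole
  is defined as the limit of that quotient.\<close>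

lemma spherical_deriv_inverse_nonzero:
  assumes K: "K holomorphic_on N" "open N" "w \<in> N" and nz: "K w \<noteq> 0"
    and F: "\<And>v. v \<in> N \<Longrightarrow> F v = inverse (K v)"
  shows "spherical_deriv F w = cmod (deriv K w) / (1 + (cmod (K w))\<^sup>2)"
    and "cmod (deriv F w) / (1 + (cmod (F w))\<^sup>2) = cmod (deriv K w) / (1 + (cmod (K w))\<^sup>2)"
proof -
  have dK: "(K has_field_derivative deriv K w) (at w)"
    using holomorphic_derivI[OF K] by simp
  have ev: "eventually (\<lambda>v. F v = inverse (K v)) (nhds w)"
    using K(2,3) F by (auto simp: eventually_nhds)
  have "((\<lambda>v. inverse (K v)) has_field_derivative - (inverse (K w) * deriv K w * inverse (K w))) (at w)"
    by (rule DERIV_inverse'[OF dK nz])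
  then have dF: "(F has_field_derivative - (inverse (K w) * deriv K w * inverse (K w))) (at w)"
    using DERIV_cong_ev[OF refl ev refl] by simp
  have "isCont F w" using dF DERIV_isCont by blast
  then have np: "\<not> is_pole F w"
    unfolding is_pole_def isCont_def using not_tendsto_and_filterlim_at_infinity[of "at w" F] by auto
  have "deriv F w = - (inverse (K w) * deriv K w * inverse (K w))"
    using dF by (rule DERIV_imp_deriv)
  then have "cmod (deriv F w) = cmod (deriv K w) / (cmod (K w))\<^sup>2"
    by (simp add: norm_mult norm_inverse norm_divide power2_eq_square field_simps)
  note dF' = this
  have F': "cmod (F w) = inverse (cmod (K w))" using F K(3) by (simp add: norm_inverse)
  show "cmod (deriv F w) / (1 + (cmod (F w))\<^sup>2) = cmod (deriv K w) / (1 + (cmod (K w))\<^sup>2)"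
  proof -
    have *: "x / y\<^sup>2 / (1 + (inverse y)\<^sup>2) = x / (1 + y\<^sup>2)" if "y > 0" for x y :: real
      using that by (simp add: divide_simps add_pos_nonneg)
    show ?thesis unfolding dF' F' by (rule *) (use nz in simp)
  qed
  then show "spherical_deriv F w = cmod (deriv K w) / (1 + (cmod (K w))\<^sup>2)"
    using np by (simp add: spherical_deriv_def)
qed

lemma spherical_deriv_inverse_zero:
  assumes K: "K holomorphic_on N" "open N" "w \<in> N" and z: "K w = 0"
    and nz: "\<And>v. v \<in> N - {w} \<Longrightarrow> K v \<noteq> 0"
    and F: "\<And>v. v \<in> N \<Longrightarrow> F v = inverse (K v)"
  shows "spherical_deriv F w = cmod (deriv K w) / (1 + (cmod (K w))\<^sup>2)"
proof -
  have ev: "eventually (\<lambda>v. v \<in> N - {w}) (at w)"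
    using K by (auto simp: eventually_at_topological)
  have cont: "isCont K w" "isCont (deriv K) w"
    using K holomorphic_deriv[OF K(1,2)]
    by (meson continuous_on_eq_continuous_at holomorphic_on_imp_continuous_on)+
  have "filterlim K (at 0) (at w)"
    using cont(1) z ev nz by (auto simp: filterlim_at isCont_def elim: eventually_mono)
  then have "filterlim (\<lambda>v. inverse (K v)) at_infinity (at w)"
    by (rule filterlim_compose[OF filterlim_inverse_at_infinity])
  moreover have "eventually (\<lambda>v. inverse (K v) = F v) (at w)"
    using ev F by (auto elim: eventually_mono)
  ultimately have pole: "is_pole F w"
    unfolding is_pole_def using filterlim_cong by force
  have "((\<lambda>v. cmod (deriv K v) / (1 + (cmod (K v))\<^sup>2)) \<longlongrightarrow> cmod (deriv K w) / (1 + (cmod (K w))\<^sup>2)) (at w)"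
    using cont unfolding isCont_def by (intro tendsto_intros) (auto simp: add_nonneg_eq_0_iff)
  moreover have "eventually (\<lambda>v. cmod (deriv K v) / (1 + (cmod (K v))\<^sup>2) = cmod (deriv F v) / (1 + (cmod (F v))\<^sup>2)) (at w)"
    using ev
  proof eventually_elim
    case (elim v)
    then show ?case using spherical_deriv_inverse_nonzero(2)[OF K(1,2), of v F] nz F by auto
  qed
  ultimately have "((\<lambda>v. cmod (deriv F v) / (1 + (cmod (F v))\<^sup>2)) \<longlongrightarrow> cmod (deriv K w) / (1 + (cmod (K w))\<^sup>2)) (at w)"
    by (rule Lim_transform_eventually)
  then have "Lim (at w) (\<lambda>v. cmod (deriv F v) / (1 + (cmod (F v))\<^sup>2)) = cmod (deriv K w) / (1 + (cmod (K w))\<^sup>2)"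
    by (intro tendsto_Lim) auto
  then show ?thesis using pole by (simp add: spherical_deriv_def)
qed

text \<open>
  In the second alternative the equation also holds at the poles of \<open>f\<close>, where both sides are \<open>0\<close>.
\<close>
definition spherical_chart :: "(complex \<Rightarrow> complex) \<Rightarrow> complex set \<Rightarrow> (complex \<Rightarrow> complex) \<Rightarrow> bool" where
  "spherical_chart f N k \<longleftrightarrow> open N \<and> N \<subseteq> unit_disc \<and> k holomorphic_on N \<and>
    ((\<forall>w\<in>N. f w = k w \<and> \<not> is_pole f w) \<or> (\<forall>w\<in>N. f w = inverse (k w) \<and> (is_pole f w \<longleftrightarrow> k w = 0))) \<and>
    (\<forall>n\<ge>1. \<forall>w\<in>N. spherical_deriv (\<lambda>v. f v ^ n) w =
       cmod (deriv (\<lambda>v. k v ^ n) w) / (1 + (cmod (k w ^ n))\<^sup>2))"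

lemma spherical_chartD:
  assumes "spherical_chart f N k"
  shows "open N" "N \<subseteq> unit_disc" "k holomorphic_on N"
    "(\<forall>w\<in>N. f w = k w \<and> \<not> is_pole f w) \<or> (\<forall>w\<in>N. f w = inverse (k w) \<and> (is_pole f w \<longleftrightarrow> k w = 0))"
    "\<And>n w. n \<ge> 1 \<Longrightarrow> w \<in> N \<Longrightarrow>
       spherical_deriv (\<lambda>v. f v ^ n) w = cmod (deriv (\<lambda>v. k v ^ n) w) / (1 + (cmod (k w ^ n))\<^sup>2)"
  using assms by (auto simp: spherical_chart_def)

lemma mero_disc_chart:
  assumes f: "f \<in> mero_disc" and z: "z \<in> unit_disc"
  obtains N k where "spherical_chart f N k" "z \<in> N"
proof -
  have f: "f nicely_meromorphic_on unit_disc" using f by (simp add: mero_disc_def)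
  show ?thesis
  proof (cases "is_pole f z")
    case False
    then have "f analytic_on {z}" using f z nicely_meromorphic_on_imp_analytic_at by blast
    then obtain \<epsilon> where \<epsilon>: "\<epsilon> > 0" "f holomorphic_on ball z \<epsilon>" by (auto simp: analytic_on_def)
    define N where "N = ball z \<epsilon> \<inter> unit_disc"
    have N: "open N" "z \<in> N" "N \<subseteq> unit_disc" "f holomorphic_on N"
      using \<epsilon> z holomorphic_on_subset by (auto simp: N_def)
    have np: "\<not> is_pole (\<lambda>v. f v ^ n) w" if "w \<in> N" for w n
      using not_is_pole_holomorphic[OF N(1) that, of "\<lambda>v. f v ^ n"] N(4) by (auto intro: holomorphic_intros)
    have "spherical_chart f N f"
      unfolding spherical_chart_def
    proof (intro conjI allI impI ballI N(1,3,4))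
      show "(\<forall>w\<in>N. f w = f w \<and> \<not> is_pole f w) \<or> (\<forall>w\<in>N. f w = inverse (f w) \<and> is_pole f w = (f w = 0))"
        using np[of _ 1] by simp
    qed (use np in \<open>auto simp: spherical_deriv_def\<close>)
    then show ?thesis using that N(2) by blast
  next
    case True
    define k where "k = (\<lambda>w. inverse (f w))"
    have "f z = 0 \<or> f \<midarrow>z\<rightarrow> f z" using f z by (auto simp: nicely_meromorphic_on_def)
    then have fz: "f z = 0"
      using True not_tendsto_and_filterlim_at_infinity[of "at z" f] by (auto simp: is_pole_def)
    have km: "k nicely_meromorphic_on unit_disc"
      unfolding k_def using f by (rule nicely_meromorphic_on_inverse)
    have k0: "k \<midarrow>z\<rightarrow> 0" using is_pole_tendsto[OF True] by (simp add: k_def o_def)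
    then have "\<not> is_pole k z"
      using not_tendsto_and_filterlim_at_infinity[of "at z" k] by (auto simp: is_pole_def)
    then have "k analytic_on {z}" using km z nicely_meromorphic_on_imp_analytic_at by blast
    then obtain \<epsilon> where \<epsilon>: "\<epsilon> > 0" "k holomorphic_on ball z \<epsilon>" by (auto simp: analytic_on_def)
    have "eventually (\<lambda>w. f w \<noteq> 0) (at z)" using True by (simp add: non_zero_neighbour_pole)
    then obtain T where T: "open T" "z \<in> T" "\<And>w. w \<in> T \<Longrightarrow> w \<noteq> z \<Longrightarrow> f w \<noteq> 0"
      unfolding eventually_at_topological by auto
    \<comment> \<open>The intersection with \<open>T\<close> leaves \<open>z\<close> as the only
      zero of \<open>k\<close>, so that every other point of \<open>N\<close> falls under
      \<open>spherical_deriv_inverse_nonzero\<close>.\<close>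
    define N where "N = ball z \<epsilon> \<inter> unit_disc \<inter> T"
    have N: "open N" "z \<in> N" "N \<subseteq> unit_disc" "k holomorphic_on N"
      using \<epsilon> z T holomorphic_on_subset by (auto simp: N_def)
    have nz: "k w \<noteq> 0" if "w \<in> N - {z}" for w using that T by (auto simp: N_def k_def)
    have kz: "k z = 0" by (simp add: k_def fz)
    have hol: "(\<lambda>v. k v ^ n) holomorphic_on N" for n using N by (intro holomorphic_intros)
    have fk: "f w ^ n = inverse (k w ^ n)" for w n by (simp add: k_def power_inverse)
    have "\<not> is_pole f w" if "w \<in> N - {z}" for w
    proof -
      have "(\<lambda>v. inverse (k v)) holomorphic_on N - {z}"
        using N nz by (intro holomorphic_intros) (auto intro: holomorphic_on_subset)
      then have "f holomorphic_on N - {z}" by (simp add: k_def)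
      then show ?thesis using not_is_pole_holomorphic[of "N - {z}" w f] N(1) that by (auto simp: open_Diff)
    qed
    then have pole: "is_pole f w \<longleftrightarrow> k w = 0" if "w \<in> N" for w
      using nz kz True that by (cases "w = z") auto
    have "spherical_chart f N k"
      unfolding spherical_chart_def
    proof (intro conjI allI impI ballI N(1,3,4))
      show "(\<forall>w\<in>N. f w = k w \<and> \<not> is_pole f w) \<or> (\<forall>w\<in>N. f w = inverse (k w) \<and> (is_pole f w \<longleftrightarrow> k w = 0))"
        using fk[of _ 1] pole by simp
    next
      fix n :: nat and w assume n: "n \<ge> 1" and w: "w \<in> N"
      show "spherical_deriv (\<lambda>v. f v ^ n) w = cmod (deriv (\<lambda>v. k v ^ n) w) / (1 + (cmod (k w ^ n))\<^sup>2)"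
      proof (cases "w = z")
        case True
        then show ?thesis
          using spherical_deriv_inverse_zero[OF hol N(1) w, of n] kz nz fk n by auto
      next
        case False
        then show ?thesis
          using spherical_deriv_inverse_nonzero(1)[OF hol N(1) w, of n] nz fk w by auto
      qed
    qed
    then show ?thesis using that N(2) by blast
  qed
qed

subsection \<open>The spherical derivative of a root\<close>

text \<open>At a pole the value is a \<open>Lim\<close>, whose sign becomes visible through the
  chart formula.\<close>

lemma spherical_deriv_nonneg:
  assumes "f \<in> mero_disc" "z \<in> unit_disc" "n \<ge> 1"
  shows "spherical_deriv (\<lambda>v. f v ^ n) z \<ge> 0"
proof -
  obtain N k where N: "spherical_chart f N k" "z \<in> N" using mero_disc_chart[OF assms(1,2)] .
  show ?thesis using spherical_chartD(5)[OF N(1) assms(3) N(2)] by simp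
qed

section \<open>Invariance of the spherical derivative under inversion\<close>

lemma spherical_deriv_eventually_0:
  assumes "eventually (\<lambda>v. F v = 0) (nhds z)"
  shows "spherical_deriv F z = 0"
proof -
  have "is_pole F z \<longleftrightarrow> is_pole (\<lambda>_. 0 :: complex) z"
    using assms by (intro is_pole_cong) (auto simp: eventually_at_filter elim: eventually_mono)
  moreover have "deriv F z = deriv (\<lambda>_. 0) z"
    using assms by (intro deriv_cong_ev) auto
  ultimately show ?thesis by (simp add: spherical_deriv_def)
qed

lemma mero_disc_inverse: "f \<in> mero_disc \<Longrightarrow> (\<lambda>z. inverse (f z)) \<in> mero_disc"
  by (simp add: mero_disc_def nicely_meromorphic_on_inverse)

lemma spherical_deriv_inverse_power:
  assumes f: "f \<in> mero_disc" and z: "z \<in> unit_disc" and n: "n \<ge> 1"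
  shows "spherical_deriv (\<lambda>v. inverse (f v) ^ n) z = spherical_deriv (\<lambda>v. f v ^ n) z"
proof -
  obtain N k where ch: "spherical_chart f N k" and zN: "z \<in> N" using mero_disc_chart[OF f z] .
  note fk = spherical_chartD(4)[OF ch] and sd = spherical_chartD(5)[OF ch]
  have N: "open N" "z \<in> N" "k holomorphic_on N" using spherical_chartD[OF ch] zN by auto
  have hol: "(\<lambda>v. k v ^ n) holomorphic_on N" using N by (intro holomorphic_intros)
  show ?thesis
    using fk
  proof
    assume fk: "\<forall>w\<in>N. f w = inverse (k w) \<and> (is_pole f w \<longleftrightarrow> k w = 0)"
    then have eq: "inverse (f v) ^ n = k v ^ n" if "v \<in> N" for v using that by simp
    have np: "\<not> is_pole (\<lambda>v. inverse (f v) ^ n) z"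
      by (rule not_is_pole_holomorphic[OF N(1,2)]) (use hol eq in \<open>simp cong: holomorphic_cong\<close>)
    moreover have "deriv (\<lambda>v. inverse (f v) ^ n) z = deriv (\<lambda>v. k v ^ n) z"
      using eq N by (intro deriv_cong_ev) (auto simp: eventually_nhds)
    ultimately show ?thesis using eq[OF N(2)] sd[OF n N(2)] by (simp add: spherical_deriv_def)
  next
    assume fk: "\<forall>w\<in>N. f w = k w \<and> \<not> is_pole f w"
    have eq: "inverse (f v) ^ n = inverse (k v ^ n)" if "v \<in> N" for v using that fk by (simp add: power_inverse)
    consider "k z \<noteq> 0" | "k z = 0" "eventually (\<lambda>v. k v \<noteq> 0) (at z)" | "k z = 0" "frequently (\<lambda>v. k v = 0) (at z)"
      by (auto simp: frequently_def)
    then show ?thesis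
    proof cases
      case 1
      then show ?thesis
        using spherical_deriv_inverse_nonzero(1)[OF hol N(1,2), of "\<lambda>v. inverse (f v) ^ n"] eq sd[OF n N(2)] by simp
    next
      case 2
      then obtain T where T: "open T" "z \<in> T" "\<And>w. w \<in> T \<Longrightarrow> w \<noteq> z \<Longrightarrow> k w \<noteq> 0"
        unfolding eventually_at_topological by auto
      have "(\<lambda>v. k v ^ n) holomorphic_on N \<inter> T" using hol holomorphic_on_subset by blast
      then show ?thesis
        using spherical_deriv_inverse_zero[of "\<lambda>v. k v ^ n" "N \<inter> T" z "\<lambda>v. inverse (f v) ^ n"] N T 2 n eq sd[OF n N(2)]
        by (simp add: open_Int)
    next
      case 3
      \<comment> \<open>Zeros of \<open>k\<close> accumulate at \<open>z\<close>, so
        \<open>f\<close> vanishes identically near \<open>z\<close>. Because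
        \<open>inverse 0 = 0\<close>, its reciprocal does as well, and both spherical derivatives
        are \<open>0\<close>.\<close>
      have "k analytic_on {z}" using N by (auto simp: analytic_at)
      then have "eventually (\<lambda>v. k v = 0) (at z)"
        using 3(2) isolated_singularity_at_analytic not_essential_analytic
          not_essential_frequently_0_imp_eventually_0 by blast
      then have "eventually (\<lambda>v. k v = 0) (nhds z)" using 3(1) by (auto simp: eventually_nhds_conv_at)
      moreover have "eventually (\<lambda>v. v \<in> N) (nhds z)" using N by (auto simp: eventually_nhds)
      ultimately have "eventually (\<lambda>v. f v = 0) (nhds z)"
        by eventually_elim (use fk in auto)
      then have "eventually (\<lambda>v. inverse (f v) ^ n = 0) (nhds z)" "eventually (\<lambda>v. f v ^ n = 0) (nhds z)"
        using n by (auto elim: eventually_mono)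
      then show ?thesis by (simp add: spherical_deriv_eventually_0)
    qed
  qed
qed

text \<open>
  The function below is \<open>1 / (1 + |f|\<^sup>2\<^sup>n)\<close>, continued across the poles; it is one half plus half
  the height coordinate of \<open>f\<^sup>n\<close> on the Riemann sphere.
\<close>
lemma sphere_height_dir_deriv:
  assumes f: "f \<in> mero_disc" and z: "z \<in> unit_disc" and n: "n \<ge> 1"
  obtains d where "has_dir_deriv e (\<lambda>v. if is_pole f v then 0 else 1 / (1 + (cmod (f v ^ n))\<^sup>2)) d z"
    "\<bar>d\<bar> \<le> cmod e * spherical_deriv (\<lambda>v. f v ^ n) z"
proof -
  let ?P = "\<lambda>v. if is_pole f v then 0 else 1 / (1 + (cmod (f v ^ n))\<^sup>2)"
  obtain N k where ch: "spherical_chart f N k" and zN: "z \<in> N" using mero_disc_chart[OF f z] .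
  note fk = spherical_chartD(4)[OF ch] and sd = spherical_chartD(5)[OF ch]
  have N: "open N" "z \<in> N" "k holomorphic_on N" using spherical_chartD[OF ch] zN by auto
  let ?K = "\<lambda>v. k v ^ n"
  have hol: "?K holomorphic_on N" using N by (intro holomorphic_intros)
  have p: "1 + (cmod (?K v))\<^sup>2 > 0" for v by (simp add: add_pos_nonneg)
  let ?q = "2 * Re (cnj (?K z) * (deriv ?K z * e))"
  let ?d = "- ?q / (1 + (cmod (?K z))\<^sup>2)\<^sup>2"
  have "has_dir_deriv e (\<lambda>v. (cmod (?K v))\<^sup>2) ?q z"
    using C2_along_norm_square[OF hol N(1)] N(2) by (auto simp: C2_along_def)
  then have "((\<lambda>t. (cmod (?K (z + of_real t * e)))\<^sup>2) has_real_derivative ?q) (at 0)"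
    by (simp add: has_dir_deriv_def)
  from DERIV_inverse_one_plus[OF this] p[of z]
  have "((\<lambda>t. 1 / (1 + (cmod (?K (z + of_real t * e)))\<^sup>2)) has_real_derivative ?d) (at 0)"
    by simp
  then have 1: "has_dir_deriv e (\<lambda>v. 1 / (1 + (cmod (?K v))\<^sup>2)) ?d z"
    by (simp add: has_dir_deriv_def)
  then have 2: "has_dir_deriv e (\<lambda>v. 1 - 1 / (1 + (cmod (?K v))\<^sup>2)) (- ?d) z"
    using DERIV_diff[OF DERIV_const[of 1] 1[unfolded has_dir_deriv_def]] unfolding has_dir_deriv_def diff_0 by blast
  have "\<bar>?q\<bar> \<le> 2 * cmod (cnj (?K z) * (deriv ?K z * e))"
    using abs_Re_le_cmod[of "cnj (?K z) * (deriv ?K z * e)"] by (simp only: abs_mult abs_numeral mult_le_cancel_left_pos zero_less_numeral)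
  also have "\<dots> = (2 * cmod (?K z)) * (cmod (deriv ?K z) * cmod e)" by (simp add: norm_mult norm_power)
  \<comment> \<open>The inequality \<open>2 x \<le> 1 + x^2\<close> removes one of the two factors
    \<open>1 + |K|^2\<close> in the denominator; what remains is the spherical derivative.\<close>
  also have "\<dots> \<le> (1 + (cmod (?K z))\<^sup>2) * (cmod (deriv ?K z) * cmod e)"
    using sum_squares_bound[of 1 "cmod (?K z)"] by (intro mult_right_mono) auto
  finally have "\<bar>?d\<bar> \<le> (1 + (cmod (?K z))\<^sup>2) * (cmod (deriv ?K z) * cmod e) / (1 + (cmod (?K z))\<^sup>2)\<^sup>2"
    unfolding abs_divide abs_minus_cancel abs_power2 by (rule divide_right_mono) auto
  also have "\<dots> = cmod e * spherical_deriv (\<lambda>v. f v ^ n) z"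
    using p[of z] unfolding sd[OF n N(2)] by (simp add: power2_eq_square)
  finally have d: "\<bar>?d\<bar> \<le> cmod e * spherical_deriv (\<lambda>v. f v ^ n) z" .
  from fk show ?thesis
  proof
    assume "\<forall>w\<in>N. f w = k w \<and> \<not> is_pole f w"
    then have "has_dir_deriv e ?P ?d z"
      using 1 has_dir_deriv_cong[OF N(1,2), of ?P "\<lambda>v. 1 / (1 + (cmod (?K v))\<^sup>2)"] by auto
    then show ?thesis using that d by blast
  next
    assume fk: "\<forall>w\<in>N. f w = inverse (k w) \<and> (is_pole f w \<longleftrightarrow> k w = 0)"
    \<comment> \<open>At a pole both sides are \<open>0\<close>: the left by definition, the right
      because \<open>k w = 0\<close> and \<open>n\<close> is positive.\<close>
    have "?P w = 1 - 1 / (1 + (cmod (?K w))\<^sup>2)" if "w \<in> N" for w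
    proof -
      define x where "x = (cmod (?K w))\<^sup>2"
      have "1 / (1 + inverse x) = 1 - 1 / (1 + x)" if "x > 0"
        using that by (simp add: divide_simps)
      moreover have "x > 0" if "k w \<noteq> 0" using that by (simp add: x_def)
      moreover have "(cmod (f w ^ n))\<^sup>2 = inverse x"
        using fk \<open>w \<in> N\<close> by (simp add: x_def norm_power norm_inverse power_inverse)
      moreover have "x = 0" if "k w = 0" using that n by (simp add: x_def)
      ultimately show ?thesis using fk \<open>w \<in> N\<close> unfolding x_def[symmetric] by (cases "k w = 0") auto
    qed
    then have "has_dir_deriv e ?P (- ?d) z"
      using 2 has_dir_deriv_cong[OF N(1,2), of ?P "\<lambda>v. 1 - 1 / (1 + (cmod (?K v))\<^sup>2)"] by auto
    moreover have "\<bar>- ?d\<bar> \<le> cmod e * spherical_deriv (\<lambda>v. f v ^ n) z" using d unfolding abs_minus_cancel .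
    ultimately show ?thesis by (rule that)
  qed
qed

text \<open>At the centre the height \<open>1 / (1 + |f^n|^2)\<close> is at least
  \<open>1/2\<close>. Along a radius it drops by at most \<open>M * \<rho> \<le> 3/10\<close>, so it
  stays at least \<open>1/5\<close>; this excludes poles and gives
  \<open>1 + |f^n|^2 \<le> 5\<close>.\<close>

lemma power_bounded_on_ball:
  assumes f: "f \<in> mero_disc" and n: "n \<ge> 1" and ball: "ball a \<rho> \<subseteq> unit_disc"
    and M: "\<And>z. z \<in> ball a \<rho> \<Longrightarrow> spherical_deriv (\<lambda>v. f v ^ n) z \<le> M" and M\<rho>: "M * \<rho> \<le> 3 / 10"
    and a: "\<not> is_pole f a" "cmod (f a) \<le> 1" and z: "z \<in> ball a \<rho>"
  shows "\<not> is_pole f z" "(cmod (f z ^ n))\<^sup>2 \<le> 4"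
proof -
  let ?P = "\<lambda>v. if is_pole f v then 0 else 1 / (1 + (cmod (f v ^ n))\<^sup>2)"
  have "\<rho> > 0" using z zero_le_dist[of a z] by (simp del: zero_le_dist)
  then have a_in: "a \<in> ball a \<rho>" by simp
  have M0: "M \<ge> 0" using M[OF a_in] spherical_deriv_nonneg[OF f subsetD[OF ball a_in] n] by linarith
  have "cmod (f a ^ n) \<le> 1" using a by (simp add: norm_power power_le_one)
  then have "(cmod (f a ^ n))\<^sup>2 \<le> 1" by (simp add: power_le_one)
  then have Pa: "?P a \<ge> 1 / 2" using a by (simp add: le_divide_eq add_pos_nonneg)
  have Pz: "?P z \<ge> 1 / 5"
  proof (cases "z = a")
    case True
    show ?thesis using Pa unfolding True by linarith
  next
    case False
    define l where "l = cmod (z - a)"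
    define e where "e = (z - a) / of_real l"
    have l: "l > 0" "l < \<rho>" using False z by (auto simp: l_def dist_norm norm_minus_commute)
    have e: "cmod e = 1" using l by (simp add: e_def norm_divide l_def)
    have zae: "z = a + of_real l * e" using l by (simp add: e_def)
    have "\<exists>d. 0 \<le> t \<and> t \<le> l \<longrightarrow> has_dir_deriv e ?P d (a + of_real t * e) \<and> \<bar>d\<bar> \<le> M" for t
    proof (cases "0 \<le> t \<and> t \<le> l")
      case True
      then have t: "0 \<le> t" "t \<le> l" by auto
      have w: "a + of_real t * e \<in> ball a \<rho>" using t l e by (simp add: dist_norm norm_mult)
      obtain d where "has_dir_deriv e ?P d (a + of_real t * e)" "\<bar>d\<bar> \<le> cmod e * spherical_deriv (\<lambda>v. f v ^ n) (a + of_real t * e)"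
        using sphere_height_dir_deriv[OF f _ n] w ball by blast
      with M[OF w] e show ?thesis by (intro exI[of _ d]) simp
    qed blast
    then have "\<forall>t. \<exists>d. 0 \<le> t \<and> t \<le> l \<longrightarrow> has_dir_deriv e ?P d (a + of_real t * e) \<and> \<bar>d\<bar> \<le> M" by blast
    from choice[OF this] obtain D where
      D': "\<forall>t. 0 \<le> t \<and> t \<le> l \<longrightarrow> has_dir_deriv e ?P (D t) (a + of_real t * e) \<and> \<bar>D t\<bar> \<le> M" ..
    then have D: "has_dir_deriv e ?P (D t) (a + of_real t * e) \<and> \<bar>D t\<bar> \<le> M" if "0 \<le> t" "t \<le> l" for t
      using that by blast
    have "((\<lambda>t. ?P (a + of_real t * e)) has_real_derivative D t) (at t)" if t: "0 \<le> t" "t \<le> l" for t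
      using has_dir_deriv_line[OF conjunct1[OF D[OF t]]] .
    from MVT2[OF l(1) this] obtain t where t: "0 < t" "t < l" "?P (a + of_real l * e) - ?P (a + of_real 0 * e) = l * D t"
      unfolding diff_0_right by blast
    then have Pt: "?P z - ?P a = l * D t"
      unfolding zae[symmetric] by (simp only: of_real_0 mult_zero_left add_0_right)
    have "l * \<bar>D t\<bar> \<le> \<rho> * M" using D[of t] t l M0 by (intro mult_mono) auto
    then have "l * D t \<ge> - 3 / 10" using M\<rho> l abs_ge_minus_self[of "l * D t"] by (simp add: abs_mult mult.commute)
    then show ?thesis using Pa Pt by linarith
  qed
  show "\<not> is_pole f z" using Pz by auto
  moreover have "1 + (cmod (f z ^ n))\<^sup>2 > 0" by (simp add: add_pos_nonneg)
  ultimately show "(cmod (f z ^ n))\<^sup>2 \<le> 4" using Pz by (simp add: divide_simps)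
qed

text \<open>The bound \<open>|f^n|^2 \<le> 4\<close> makes \<open>|(f^n)'|\<close> at most
  \<open>5 * M\<close>, so \<open>f^n\<close> differs from its value at \<open>a\<close> by at most
  \<open>5 * M * \<rho> \<le> \<eta>^n\<close>. If \<open>|f a| < \<eta>\<close>, this yields
  \<open>|f| \<le> 2 * \<eta>\<close> on the ball, and Cauchy's estimate on half the radius gives
  \<open>2 * \<eta> / (\<rho> / 2)\<close>. If \<open>|f a| \<ge> \<eta>\<close>, division of the
  chain rule by \<open>\<eta>^(n-1)\<close> gives \<open>\<eta> / \<rho>\<close>.\<close>

lemma spherical_deriv_le_of_bounded:
  assumes f: "f \<in> mero_disc" and n: "n \<ge> 1" and ball: "ball a \<rho> \<subseteq> unit_disc" and \<rho>: "\<rho> > 0"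
    and M: "\<And>z. z \<in> ball a \<rho> \<Longrightarrow> spherical_deriv (\<lambda>v. f v ^ n) z \<le> M" and M\<rho>: "M * \<rho> \<le> 3 / 10"
    and \<eta>: "\<eta> > 0" "5 * M * \<rho> \<le> \<eta> ^ n"
    and a: "\<not> is_pole f a" "cmod (f a) \<le> 1"
  shows "spherical_deriv f a \<le> 4 * \<eta> / \<rho>"
proof -
  have bnd: "\<not> is_pole f z" "(cmod (f z ^ n))\<^sup>2 \<le> 4" if "z \<in> ball a \<rho>" for z
    using power_bounded_on_ball[OF f n ball _ M\<rho> a that] M by blast+
  have a_in: "a \<in> ball a \<rho>" using \<rho> by simp
  have M0: "M \<ge> 0" using M[OF a_in] spherical_deriv_nonneg[OF f subsetD[OF ball a_in] n] by linarith
  have hol: "f holomorphic_on ball a \<rho>"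
  proof (rule analytic_imp_holomorphic, rule nicely_meromorphic_without_singularities)
    show "f nicely_meromorphic_on ball a \<rho>"
      using f ball nicely_meromorphic_on_subset by (auto simp: mero_disc_def)
  qed (use bnd in auto)
  have hol_n: "(\<lambda>v. f v ^ n) holomorphic_on ball a \<rho>" using hol by (intro holomorphic_intros)
  have der: "cmod (deriv (\<lambda>v. f v ^ n) z) \<le> 5 * M" if z: "z \<in> ball a \<rho>" for z
  proof -
    have "\<not> is_pole (\<lambda>v. f v ^ n) z" using not_is_pole_holomorphic[OF _ z hol_n] by simp
    then have "cmod (deriv (\<lambda>v. f v ^ n) z) / (1 + (cmod (f z ^ n))\<^sup>2) \<le> M"
      using M[OF z] by (simp add: spherical_deriv_def)
    moreover have p: "1 + (cmod (f z ^ n))\<^sup>2 > 0" by (simp add: add_pos_nonneg)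
    ultimately have "cmod (deriv (\<lambda>v. f v ^ n) z) \<le> M * (1 + (cmod (f z ^ n))\<^sup>2)" by (simp add: pos_divide_le_eq)
    also have "\<dots> \<le> M * 5" using bnd(2)[OF z] M0 by (intro mult_left_mono) auto
    finally show ?thesis by simp
  qed
  have "cmod (deriv f a) \<le> 4 * \<eta> / \<rho>"
  proof (cases "cmod (f a) < \<eta>")
    case True
    have f_le: "cmod (f z) \<le> 2 * \<eta>" if z: "z \<in> ball a \<rho>" for z
    proof -
      have "cmod (f z ^ n - f a ^ n) \<le> 5 * M * cmod (z - a)"
      proof (rule field_differentiable_bound[OF convex_ball _ der z a_in])
        show "((\<lambda>v. f v ^ n) has_field_derivative deriv (\<lambda>v. f v ^ n) w) (at w within ball a \<rho>)"
          if "w \<in> ball a \<rho>" for w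
          using holomorphic_derivI[OF hol_n _ that] by (simp add: has_field_derivative_at_within)
      qed
      also have "\<dots> \<le> 5 * M * \<rho>" using z M0 by (intro mult_left_mono) (auto simp: dist_norm norm_minus_commute)
      finally have "cmod (f z ^ n - f a ^ n) \<le> \<eta> ^ n" using \<eta> by linarith
      moreover have "cmod (f a ^ n) \<le> \<eta> ^ n" using True by (simp add: norm_power power_mono)
      ultimately have "cmod (f z ^ n) \<le> 2 * \<eta> ^ n" using norm_triangle_sub[of "f z ^ n" "f a ^ n"] by linarith
      also have "2 * \<eta> ^ n \<le> 2 ^ n * \<eta> ^ n"
        using n \<eta> power_increasing[of 1 n "2::real"] by (intro mult_right_mono) auto
      finally have "cmod (f z) ^ n \<le> (2 * \<eta>) ^ n" by (simp add: norm_power power_mult_distrib)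
      then show ?thesis using power_mono_iff[of "cmod (f z)" "2 * \<eta>" n] n \<eta> by simp
    qed
    have sub: "cball a (\<rho> / 2) \<subseteq> ball a \<rho>" using \<rho> by auto
    have "cmod ((deriv ^^ 1) f a) \<le> fact 1 * (2 * \<eta>) / (\<rho> / 2) ^ 1"
    proof (rule Cauchy_inequality)
      show "f holomorphic_on ball a (\<rho> / 2)" using hol sub by (meson ball_subset_cball holomorphic_on_subset order_trans)
      show "continuous_on (cball a (\<rho> / 2)) f" using hol sub by (meson holomorphic_on_imp_continuous_on holomorphic_on_subset)
      show "cmod (f x) \<le> 2 * \<eta>" if "cmod (a - x) = \<rho> / 2" for x
        using that \<rho> by (intro f_le) (auto simp: dist_norm)
    qed (use \<rho> in auto)
    then show ?thesis by simp
  next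
    case False
    have "deriv (\<lambda>v. f v ^ n) a = of_nat n * f a ^ (n - 1) * deriv f a"
      using holomorphic_derivI[OF hol _ a_in] by (intro DERIV_imp_deriv) (auto intro!: derivative_eq_intros)
    then have "real n * cmod (f a) ^ (n - 1) * cmod (deriv f a) \<le> 5 * M"
      using der[OF a_in] by (simp add: norm_mult norm_power)
    moreover have "\<eta> ^ (n - 1) * cmod (deriv f a) \<le> (real n * cmod (f a) ^ (n - 1)) * cmod (deriv f a)"
    proof (intro mult_right_mono)
      have "\<eta> ^ (n - 1) \<le> cmod (f a) ^ (n - 1)" using False \<eta> by (intro power_mono) auto
      also have "\<dots> \<le> real n * cmod (f a) ^ (n - 1)" using n mult_right_mono[of 1 "real n" "cmod (f a) ^ (n - 1)"] by simp
      finally show "\<eta> ^ (n - 1) \<le> real n * cmod (f a) ^ (n - 1)" .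
    qed auto
    ultimately have "\<eta> ^ (n - 1) * cmod (deriv f a) \<le> 5 * M" by linarith
    then have "\<eta> ^ (n - 1) * cmod (deriv f a) * \<rho> \<le> \<eta> * \<eta> ^ (n - 1)"
    proof -
      assume "\<eta> ^ (n - 1) * cmod (deriv f a) \<le> 5 * M"
      then have "\<eta> ^ (n - 1) * cmod (deriv f a) * \<rho> \<le> 5 * M * \<rho>"
        using \<rho> by (intro mult_right_mono) auto
      also have "\<dots> \<le> \<eta> * \<eta> ^ (n - 1)" using \<eta>(2) n power_eq_if[of \<eta> n] by simp
      finally show ?thesis .
    qed
    then have "\<eta> ^ (n - 1) * (cmod (deriv f a) * \<rho>) \<le> \<eta> ^ (n - 1) * \<eta>" by (simp add: mult_ac)
    then have "cmod (deriv f a) * \<rho> \<le> \<eta>" using \<eta>(1) by (simp add: mult_le_cancel_left_pos)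
    then have "cmod (deriv f a) \<le> \<eta> / \<rho>" using \<rho> by (simp add: pos_le_divide_eq)
    also have "\<dots> \<le> 4 * \<eta> / \<rho>" using \<rho> \<eta>(1) by (simp add: divide_right_mono)
    finally show ?thesis .
  qed
  moreover have "spherical_deriv f a \<le> cmod (deriv f a)"
    using a(1) by (simp add: spherical_deriv_def divide_le_eq mult_le_cancel_left1 add_pos_nonneg)
  ultimately show ?thesis by linarith
qed

text \<open>The hypothesis on \<open>f^n\<close> and the conclusion are unchanged when
  \<open>f\<close> is replaced by \<open>1/f\<close>, and one of these two functions has no pole and
  modulus at most \<open>1\<close> at \<open>a\<close>.\<close>

lemma spherical_deriv_le:
  assumes f: "f \<in> mero_disc" and n: "n \<ge> 1" and ball: "ball a \<rho> \<subseteq> unit_disc" and \<rho>: "\<rho> > 0"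
    and M: "\<And>z. z \<in> ball a \<rho> \<Longrightarrow> spherical_deriv (\<lambda>v. f v ^ n) z \<le> M" and M\<rho>: "M * \<rho> \<le> 3 / 10"
    and \<eta>: "\<eta> > 0" "5 * M * \<rho> \<le> \<eta> ^ n"
  shows "spherical_deriv f a \<le> 4 * \<eta> / \<rho>"
proof (cases "\<not> is_pole f a \<and> cmod (f a) \<le> 1")
  case True
  then show ?thesis using spherical_deriv_le_of_bounded[OF assms] by blast
next
  case False
  let ?g = "\<lambda>z. inverse (f z)"
  have a: "a \<in> unit_disc" using ball \<rho> centre_in_ball by blast
  note g = mero_disc_inverse[OF f]
  have "\<not> is_pole ?g a \<and> cmod (?g a) \<le> 1"
  proof (cases "is_pole f a")
    case True
    have "\<not> ?g \<midarrow>a\<rightarrow> 0 \<or> \<not> is_pole ?g a"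
      using not_tendsto_and_filterlim_at_infinity[of "at a" ?g] by (auto simp: is_pole_def)
    moreover have "f a = 0"
    proof -
      have "f a = 0 \<or> f \<midarrow>a\<rightarrow> f a"
        using f a by (auto simp: mero_disc_def nicely_meromorphic_on_def)
      then show ?thesis using True not_tendsto_and_filterlim_at_infinity[of "at a" f "f a"]
        by (auto simp: is_pole_def)
    qed
    ultimately show ?thesis using is_pole_tendsto[OF True] by (simp add: o_def)
  next
    case False
    with \<open>\<not> (\<not> is_pole f a \<and> cmod (f a) \<le> 1)\<close> have gt: "cmod (f a) > 1" by simp
    have "f \<midarrow>a\<rightarrow> f a" using f a False by (auto simp: mero_disc_def nicely_meromorphic_on_def)
    then have "?g \<midarrow>a\<rightarrow> inverse (f a)" using gt by (intro tendsto_inverse) auto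
    then have "\<not> is_pole ?g a"
      using not_tendsto_and_filterlim_at_infinity[of "at a" ?g] by (auto simp: is_pole_def)
    then show ?thesis using gt by (simp add: norm_inverse inverse_le_1_iff)
  qed
  moreover have "spherical_deriv (\<lambda>v. ?g v ^ n) z \<le> M" if "z \<in> ball a \<rho>" for z
    using M[OF that] spherical_deriv_inverse_power[OF f _ n, of z] ball that by auto
  ultimately have "spherical_deriv ?g a \<le> 4 * \<eta> / \<rho>"
    using spherical_deriv_le_of_bounded[OF g n ball \<rho> _ M\<rho> \<eta>] by blast
  then show ?thesis using spherical_deriv_inverse_power[OF f a, of 1] by simp
qed

subsection \<open>Normal functions\<close>

lemma eventually_to_circle:
  "eventually P to_circle \<longleftrightarrow> (\<exists>r<1. \<forall>z. r < cmod z \<and> cmod z < 1 \<longrightarrow> P z)"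
  unfolding to_circle_def eventually_filtercomap
proof safe
  fix Q assume "eventually Q (at_left (1::real))" and Q: "\<forall>x. Q (cmod x) \<longrightarrow> P x"
  then obtain b where "b < 1" "\<forall>y>b. y < 1 \<longrightarrow> Q y" using eventually_at_left[of 0 1 Q] by auto
  then show "\<exists>r<1. \<forall>z. r < cmod z \<and> cmod z < 1 \<longrightarrow> P z" using Q by blast
next
  fix r :: real assume r: "r < 1" "\<forall>z. r < cmod z \<and> cmod z < 1 \<longrightarrow> P z"
  have "eventually (\<lambda>x. r < x \<and> x < 1) (at_left 1)" using r(1) eventually_at_left[of r 1] by blast
  then show "\<exists>Q. eventually Q (at_left 1) \<and> (\<forall>x. Q (cmod x) \<longrightarrow> P x)" using r(2) by blast
qed

text \<open>
  Both \<open>1 / (1 - |z|\<^sup>2)\<close> and \<open>\<phi>(|z|)\<close> for smoothly increasing \<open>\<phi>\<close> grow by at most a bounded factor at the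
  scale of their own inverse.
\<close>
definition slowly_varying :: "real \<Rightarrow> real \<Rightarrow> (complex \<Rightarrow> real) \<Rightarrow> bool" where
  "slowly_varying c B \<psi> \<longleftrightarrow> 0 < c \<and> 0 < B \<and> (\<forall>z\<in>unit_disc. 0 < \<psi> z) \<and>
     (\<forall>a\<in>unit_disc. ball a (c / \<psi> a) \<subseteq> unit_disc \<and> (\<forall>z\<in>ball a (c / \<psi> a). \<psi> z \<le> B * \<psi> a))"

lemma slowly_varyingD:
  assumes "slowly_varying c B \<psi>"
  shows "0 < c" "0 < B" "\<And>z. z \<in> unit_disc \<Longrightarrow> 0 < \<psi> z"
    "\<And>a. a \<in> unit_disc \<Longrightarrow> ball a (c / \<psi> a) \<subseteq> unit_disc"
    "\<And>a z. a \<in> unit_disc \<Longrightarrow> z \<in> ball a (c / \<psi> a) \<Longrightarrow> \<psi> z \<le> B * \<psi> a"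
  using assms by (auto simp: slowly_varying_def)

text \<open>The local estimate at the radius \<open>c' / \<psi> a\<close>: on this ball the weight
  is at most \<open>B * \<psi> a\<close>, so \<open>M * \<rho>\<close> becomes
  \<open>K * B * c'\<close>, a number independent of \<open>a\<close>.\<close>

lemma spherical_deriv_le_weight:
  assumes f: "f \<in> mero_disc" and n: "n \<ge> 1" and \<psi>: "slowly_varying c B \<psi>" and c': "0 < c'" "c' \<le> c"
    and K: "0 \<le> K" "\<And>z. z \<in> ball a (c' / \<psi> a) \<Longrightarrow> spherical_deriv (\<lambda>v. f v ^ n) z \<le> K * \<psi> z"
    and small: "K * B * c' \<le> 3 / 10" and \<eta>: "\<eta> > 0" "5 * (K * B * c') \<le> \<eta> ^ n"
    and a: "a \<in> unit_disc"
  shows "spherical_deriv f a \<le> 4 * \<eta> / c' * \<psi> a"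
proof -
  note \<psi>D = slowly_varyingD[OF \<psi>]
  have \<psi>a: "\<psi> a > 0" using \<psi>D(3) a by blast
  have sub: "ball a (c' / \<psi> a) \<subseteq> ball a (c / \<psi> a)" using c' \<psi>a by (intro subset_ball divide_right_mono) auto
  have "spherical_deriv f a \<le> 4 * \<eta> / (c' / \<psi> a)"
  proof (rule spherical_deriv_le[OF f n])
    show "ball a (c' / \<psi> a) \<subseteq> unit_disc" using sub \<psi>D(4)[OF a] by (rule order_trans)
    show "0 < c' / \<psi> a" using c' \<psi>a by simp
    show "spherical_deriv (\<lambda>v. f v ^ n) z \<le> K * (B * \<psi> a)" if z: "z \<in> ball a (c' / \<psi> a)" for z
      using K(2)[OF z] mult_left_mono[OF \<psi>D(5)[OF a subsetD[OF sub z]] K(1)] by linarith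
    have eq: "K * (B * \<psi> a) * (c' / \<psi> a) = K * B * c'" using \<psi>a by simp
    show "K * (B * \<psi> a) * (c' / \<psi> a) \<le> 3 / 10" using small by (simp only: eq)
    show "5 * (K * (B * \<psi> a)) * (c' / \<psi> a) \<le> \<eta> ^ n" using \<eta>(2) \<psi>a by simp
  qed fact
  then show ?thesis by simp
qed

lemma bdd_above_root:
  assumes f: "f \<in> mero_disc" and n: "n \<ge> 1" and \<psi>: "slowly_varying c B \<psi>"
    and bdd: "bdd_above ((\<lambda>z. spherical_deriv (\<lambda>v. f v ^ n) z / \<psi> z) ` unit_disc)"
  shows "bdd_above ((\<lambda>z. spherical_deriv f z / \<psi> z) ` unit_disc)"
proof -
  note \<psi>D = slowly_varyingD[OF \<psi>]
  obtain K0 where K0: "\<And>z. z \<in> unit_disc \<Longrightarrow> spherical_deriv (\<lambda>v. f v ^ n) z / \<psi> z \<le> K0"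
    using bdd unfolding bdd_above_def by blast
  define K where "K = max 1 K0"
  have K: "spherical_deriv (\<lambda>v. f v ^ n) z \<le> K * \<psi> z" if "z \<in> unit_disc" for z
  proof -
    have "spherical_deriv (\<lambda>v. f v ^ n) z / \<psi> z \<le> K" using K0[OF that] by (simp add: K_def)
    then show ?thesis using \<psi>D(3)[OF that] by (simp add: pos_divide_le_eq)
  qed
  have K1: "K > 0" by (simp add: K_def)
  \<comment> \<open>Here \<open>K\<close> is given and cannot be made small, so the radius is shrunk
    until \<open>K * B * c' \<le> 3/10\<close>; then \<open>5 * 3/10 < 2 \<le> 2^n\<close> allows
    \<open>\<eta> = 2\<close>.\<close>
  define c' where "c' = min c (3 / 10 / (K * B))"
  have c': "0 < c'" "c' \<le> c" using \<psi>D(1,2) K1 by (auto simp: c'_def)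
  have "K * B * c' \<le> K * B * (3 / 10 / (K * B))"
    using \<psi>D(2) K1 by (intro mult_left_mono) (auto simp: c'_def)
  then have small: "K * B * c' \<le> 3 / 10" using \<psi>D(2) K1 by simp
  have "5 * (K * B * c') \<le> 2 ^ n" using small power_increasing[of 1 n "2::real"] n by simp
  then have "spherical_deriv f a \<le> 4 * 2 / c' * \<psi> a" if a: "a \<in> unit_disc" for a
  proof (intro spherical_deriv_le_weight[OF f n \<psi> c' _ _ small _ _ a])
    fix z assume "z \<in> ball a (c' / \<psi> a)"
    moreover have "c' / \<psi> a \<le> c / \<psi> a" using c' \<psi>D(3)[OF a] by (intro divide_right_mono) auto
    ultimately have "z \<in> ball a (c / \<psi> a)" using subset_ball by blast
    then show "spherical_deriv (\<lambda>v. f v ^ n) z \<le> K * \<psi> z" using K \<psi>D(4)[OF a] by blast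
  qed (use K1 in auto)
  then have "spherical_deriv f a / \<psi> a \<le> 4 * 2 / c'" if a: "a \<in> unit_disc" for a
    using that \<psi>D(3)[OF a] by (simp add: pos_divide_le_eq)
  then show ?thesis by (rule bdd_aboveI2)
qed

text \<open>Unlike in \<open>bdd_above_root\<close>, the radius stays tied to \<open>c\<close> and
  \<open>K\<close> is made small. The assumption \<open>near\<close> ensures that the smallness of
  the ratio for \<open>f^n\<close>, known for \<open>r < |z|\<close>, holds on the whole ball around
  \<open>a\<close>.\<close>

lemma tendsto_0_root:
  assumes f: "f \<in> mero_disc" and n: "n \<ge> 1" and \<psi>: "slowly_varying c B \<psi>"
    and near: "\<And>r. r < 1 \<Longrightarrow> eventually (\<lambda>a. \<forall>z\<in>ball a (c / \<psi> a). r < cmod z) to_circle"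
    and lim: "((\<lambda>z. spherical_deriv (\<lambda>v. f v ^ n) z / \<psi> z) \<longlongrightarrow> 0) to_circle"
  shows "((\<lambda>z. spherical_deriv f z / \<psi> z) \<longlongrightarrow> 0) to_circle"
proof (rule tendstoI)
  note \<psi>D = slowly_varyingD[OF \<psi>]
  fix \<epsilon> :: real assume \<epsilon>: "\<epsilon> > 0"
  \<comment> \<open>The final bound \<open>4 * \<eta> / c\<close> is then
    \<open>\<epsilon> / 2\<close>, and \<open>K\<close> below is the largest constant with
    \<open>K * B * c \<le> 3/10\<close> and \<open>5 * (K * B * c) \<le> \<eta>^n\<close>.\<close>
  define \<eta> where "\<eta> = \<epsilon> * c / 8"
  have \<eta>: "\<eta> > 0" using \<epsilon> \<psi>D(1) by (simp add: \<eta>_def)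
  define K where "K = min (3 / 10) (\<eta> ^ n / 5) / (B * c)"
  have K: "K > 0" using \<eta> \<psi>D(1,2) by (simp add: K_def)
  have KBc: "K * B * c = min (3 / 10) (\<eta> ^ n / 5)" using \<psi>D(1,2) by (simp add: K_def)
  have small: "K * B * c \<le> 3 / 10" "5 * (K * B * c) \<le> \<eta> ^ n" unfolding KBc by auto
  have "eventually (\<lambda>z. dist (spherical_deriv (\<lambda>v. f v ^ n) z / \<psi> z) 0 < K) to_circle"
    using lim K by (rule tendstoD)
  then obtain r where r: "r < 1" and
      rK: "\<And>z. r < cmod z \<Longrightarrow> cmod z < 1 \<Longrightarrow> \<bar>spherical_deriv (\<lambda>v. f v ^ n) z / \<psi> z\<bar> < K"
    unfolding eventually_to_circle by auto
  have circ: "eventually (\<lambda>a. a \<in> unit_disc) to_circle"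
    unfolding eventually_to_circle by (intro exI[of _ 0]) auto
  show "eventually (\<lambda>a. dist (spherical_deriv f a / \<psi> a) 0 < \<epsilon>) to_circle"
    using near[OF r] circ
  proof eventually_elim
    case (elim a)
    note a = elim(2)
    have "spherical_deriv (\<lambda>v. f v ^ n) z \<le> K * \<psi> z" if z: "z \<in> ball a (c / \<psi> a)" for z
    proof -
      have zD: "z \<in> unit_disc" using z \<psi>D(4)[OF a] by blast
      then have "spherical_deriv (\<lambda>v. f v ^ n) z / \<psi> z < K" using rK[of z] elim(1) z abs_ge_self[of "spherical_deriv (\<lambda>v. f v ^ n) z / \<psi> z"] by force
      then show ?thesis using \<psi>D(3)[OF zD] by (simp add: pos_divide_less_eq less_imp_le)
    qed
    then have "spherical_deriv f a \<le> 4 * \<eta> / c * \<psi> a"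
      using spherical_deriv_le_weight[OF f n \<psi> \<psi>D(1) order_refl less_imp_le[OF K] _ small(1) \<eta> small(2) a] by blast
    then have "spherical_deriv f a / \<psi> a \<le> \<epsilon> / 2"
      using \<psi>D(1) \<psi>D(3)[OF a] by (simp add: pos_divide_le_eq \<eta>_def)
    moreover have "0 \<le> spherical_deriv f a / \<psi> a"
      using spherical_deriv_nonneg[OF f a, of 1] \<psi>D(3)[OF a] by simp
    ultimately show ?case using \<epsilon> unfolding dist_real_def by linarith
  qed
qed

text \<open>The radius \<open>(1 - |a|^2) / 4\<close> is at most \<open>(1 - |a|) / 2\<close>, so
  points of the ball keep at least half of the distance \<open>1 - |a|\<close> to the circle. Hence
  \<open>1 - |z|^2 \<ge> 1 - |z| \<ge> (1 - |a|) / 2 \<ge> (1 - |a|^2) / 4\<close>, which is the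
  factor \<open>4\<close>.\<close>

lemma disc_weight:
  shows "slowly_varying (1 / 4) 4 (\<lambda>z. 1 / (1 - (cmod z)\<^sup>2))"
    and "r < 1 \<Longrightarrow> eventually (\<lambda>a. \<forall>z\<in>ball a (1 / 4 / (1 / (1 - (cmod a)\<^sup>2))). r < cmod z) to_circle"
proof -
  have *: "1 - x\<^sup>2 > 0" "1 - x\<^sup>2 \<le> 2 * (1 - x)" "1 - x \<le> 1 - x\<^sup>2" if "0 \<le> x" "x < 1" for x :: real
  proof -
    have "1 - x\<^sup>2 = (1 - x) * (1 + x)" by (simp add: power2_eq_square algebra_simps)
    moreover have "(1 - x) * 1 \<le> (1 - x) * (1 + x)" "(1 - x) * (1 + x) \<le> (1 - x) * 2"
      using that by (intro mult_left_mono; simp)+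
    ultimately show "1 - x\<^sup>2 > 0" "1 - x\<^sup>2 \<le> 2 * (1 - x)" "1 - x \<le> 1 - x\<^sup>2" using that by auto
  qed
  have near: "\<bar>cmod z - cmod a\<bar> < (1 - cmod a) / 2"
    if "cmod a < 1" "z \<in> ball a (1 / 4 / (1 / (1 - (cmod a)\<^sup>2)))" for a z
  proof -
    have "cmod (a - z) < (1 - (cmod a)\<^sup>2) / 4" using that by (simp add: dist_norm)
    then show ?thesis using *(2)[OF norm_ge_zero that(1)] norm_triangle_ineq3[of a z] that(1) by (simp add: abs_minus_commute)
  qed
  show "slowly_varying (1 / 4) 4 (\<lambda>z. 1 / (1 - (cmod z)\<^sup>2))"
    unfolding slowly_varying_def
  proof (intro conjI ballI subsetI)
    fix a z :: complex assume "a \<in> unit_disc" and z: "z \<in> ball a (1 / 4 / (1 / (1 - (cmod a)\<^sup>2)))"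
    then have a: "cmod a < 1" by simp
    have n: "\<bar>cmod z - cmod a\<bar> < (1 - cmod a) / 2" by (rule near[OF a z])
    have n1: "cmod z - cmod a < (1 - cmod a) / 2" by (rule le_less_trans[OF abs_ge_self n])
    moreover have "(1 - cmod a) / 2 < 1 - cmod a" using a by simp
    ultimately have z1: "cmod z < 1" by linarith
    then show "z \<in> unit_disc" by simp
    have "1 - (cmod a)\<^sup>2 \<le> 4 * (1 - (cmod z)\<^sup>2)"
      using n1 *(2)[OF norm_ge_zero a] *(3)[OF norm_ge_zero z1] by argo
    then show "1 / (1 - (cmod z)\<^sup>2) \<le> 4 * (1 / (1 - (cmod a)\<^sup>2))"
      using *(1)[of "cmod a"] *(1)[of "cmod z"] a z1 by (simp add: divide_simps mult.commute)
  qed (use *(1) in auto)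
  assume r: "r < 1"
  show "eventually (\<lambda>a. \<forall>z\<in>ball a (1 / 4 / (1 / (1 - (cmod a)\<^sup>2))). r < cmod z) to_circle"
    unfolding eventually_to_circle
  \<comment> \<open>Points of the ball satisfy
    \<open>|z| > |a| - (1 - |a|) / 2 = (3 |a| - 1) / 2\<close>, which exceeds \<open>r\<close> once
    \<open>|a| > (2 * r + 1) / 3\<close>.\<close>
  proof (intro exI[of _ "(2 * r + 1) / 3"] conjI allI impI ballI)
    fix a z assume a: "(2 * r + 1) / 3 < cmod a \<and> cmod a < 1"
      and z: "z \<in> ball a (1 / 4 / (1 / (1 - (cmod a)\<^sup>2)))"
    have "- (cmod z - cmod a) < (1 - cmod a) / 2"
      using le_less_trans[OF abs_ge_minus_self near[OF conjunct2[OF a] z]] .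
    then show "r < cmod z" using a by argo
  qed (use r in auto)
qed

text \<open>For \<open>|a|\<close> near \<open>1\<close> the smoothness condition on the closed unit
  disc gives the factor \<open>2\<close>, and \<open>\<phi> r * (1 - r) > 1\<close> together with
  \<open>c \<le> 1\<close> keeps the ball inside the disc. For the remaining centres monotonicity of
  \<open>\<phi>\<close> is enough.\<close>

lemma smoothly_increasing_weight:
  assumes \<phi>: "smoothly_increasing \<phi>"
  obtains c B where "slowly_varying c B (\<lambda>z. \<phi> (cmod z))"
    "\<forall>r<1. eventually (\<lambda>a. \<forall>z\<in>ball a (c / \<phi> (cmod a)). r < cmod z) to_circle"
proof -
  have pos: "\<phi> r > 0" if "0 \<le> r" "r < 1" for r using \<phi> that by (auto simp: smoothly_increasing_def)
  have mono: "\<phi> r \<le> \<phi> s" if "0 \<le> r" "r \<le> s" "s < 1" for r s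
    using \<phi> that by (auto simp: smoothly_increasing_def monotone_on_def)
  have lim: "filterlim (\<lambda>r. \<phi> r * (1 - r)) at_top (at_left 1)" using \<phi> by (simp add: smoothly_increasing_def)
  have large: "\<exists>b<1. \<forall>r. b < r \<and> 0 \<le> r \<and> r < 1 \<longrightarrow> C < \<phi> r * (1 - r)" for C
  proof -
    have "eventually (\<lambda>r. C < \<phi> r * (1 - r)) (at_left 1)" using lim by (simp add: filterlim_at_top_dense)
    then obtain b where "b < 1" "\<forall>y>b. y < 1 \<longrightarrow> C < \<phi> y * (1 - y)"
      unfolding eventually_at_left[OF zero_less_one] by blast
    then show ?thesis by blast
  qed
  have "uniform_limit (cball 0 1) (\<lambda>a z. \<phi> (cmod (a + z / complex_of_real (\<phi> (cmod a)))) / \<phi> (cmod a)) (\<lambda>z. 1) to_circle"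
    using \<phi> by (auto simp: smoothly_increasing_def)
  then have "eventually (\<lambda>a. \<forall>z\<in>cball 0 1. dist (\<phi> (cmod (a + z / complex_of_real (\<phi> (cmod a)))) / \<phi> (cmod a)) 1 < 1) to_circle"
    by (rule uniform_limitD) simp
  then obtain r1 where r1: "r1 < 1" and
    r1': "\<And>a z. r1 < cmod a \<Longrightarrow> cmod a < 1 \<Longrightarrow> z \<in> cball 0 1 \<Longrightarrow>
      dist (\<phi> (cmod (a + z / complex_of_real (\<phi> (cmod a)))) / \<phi> (cmod a)) 1 < 1"
    unfolding eventually_to_circle by blast
  obtain r2 where r2: "r2 < 1" "\<And>r. r2 < r \<Longrightarrow> 0 \<le> r \<Longrightarrow> r < 1 \<Longrightarrow> 1 < \<phi> r * (1 - r)"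
    using large[of 1] by blast
  define r0 where "r0 = max 0 (max r1 r2)"
  have r0: "0 \<le> r0" "r0 < 1" "r1 \<le> r0" "r2 \<le> r0" using r1 r2 by (auto simp: r0_def)
  define s where "s = (1 + r0) / 2"
  have s: "0 \<le> s" "s < 1" "r0 < s" using r0 by (auto simp: s_def)
  \<comment> \<open>The second entry makes the radius at most \<open>(1 - r0) / 2\<close>, so for
    \<open>|a| \<le> r0\<close> the ball stays in \<open>|z| \<le> s\<close>, where
    \<open>\<phi>\<close> is at most \<open>\<phi> s\<close>.\<close>
  define c where "c = min 1 (\<phi> 0 * (1 - r0) / 2)"
  define B where "B = max 2 (\<phi> s / \<phi> 0)"
  have c: "0 < c" "c \<le> 1" using pos[of 0] r0 by (auto simp: c_def)
  have B: "B > 0" "B \<ge> 2" by (auto simp: B_def)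
  have main: "cmod z < 1 \<and> \<phi> (cmod z) \<le> B * \<phi> (cmod a)"
    if a: "cmod a < 1" and z: "z \<in> ball a (c / \<phi> (cmod a))" for a z
  proof (cases "r0 < cmod a")
    case True
    have pa: "\<phi> (cmod a) > 0" using pos a by simp
    have "cmod (a - z) < c / \<phi> (cmod a)" using z by (simp add: dist_norm)
    then have d: "cmod (z - a) * \<phi> (cmod a) < c" using pa by (simp add: pos_less_divide_eq norm_minus_commute)
    have "1 < \<phi> (cmod a) * (1 - cmod a)" using r2(2)[of "cmod a"] True r0 a by simp
    then have "cmod (z - a) * \<phi> (cmod a) < (1 - cmod a) * \<phi> (cmod a)" using d c by (simp add: mult.commute)
    then have "cmod (z - a) < 1 - cmod a" using pa by simp
    then have z1: "cmod z < 1" using norm_triangle_sub[of z a] by simp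
    have "(z - a) * of_real (\<phi> (cmod a)) \<in> cball 0 1" using d c pa by (simp add: norm_mult)
    from r1'[OF _ a this] True r0 pa
    have "dist (\<phi> (cmod z) / \<phi> (cmod a)) 1 < 1" by simp
    then have "\<phi> (cmod z) / \<phi> (cmod a) \<le> 2" by (simp add: dist_real_def abs_less_iff)
    then have "\<phi> (cmod z) \<le> 2 * \<phi> (cmod a)" using pa by (simp add: pos_divide_le_eq)
    also have "\<dots> \<le> B * \<phi> (cmod a)" using B pa by (intro mult_right_mono) auto
    finally show ?thesis using z1 by simp
  next
    case False
    have p0: "\<phi> 0 > 0" using pos by simp
    have pa: "\<phi> 0 \<le> \<phi> (cmod a)" using mono[of 0 "cmod a"] a by simp
    have "cmod (a - z) < c / \<phi> (cmod a)" using z by (simp add: dist_norm)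
    also have "\<dots> \<le> c / \<phi> 0" using c p0 pa by (intro divide_left_mono) auto
    also have "\<dots> \<le> (\<phi> 0 * (1 - r0) / 2) / \<phi> 0" using p0 by (intro divide_right_mono) (auto simp: c_def)
    also have "\<dots> = (1 - r0) / 2" using p0 by simp
    finally have zs: "cmod z \<le> s"
      using False norm_triangle_sub[of z a] by (simp add: s_def norm_minus_commute field_simps)
    have "\<phi> (cmod z) \<le> \<phi> s" using mono[OF _ zs] s by simp
    also have "\<dots> = \<phi> s / \<phi> 0 * \<phi> 0" using p0 by simp
    also have "\<dots> \<le> B * \<phi> (cmod a)" using B pa p0 by (intro mult_mono) (auto simp: B_def)
    finally show ?thesis using zs s by simp
  qed
  show ?thesis
  proof
    show "slowly_varying c B (\<lambda>z. \<phi> (cmod z))"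
      unfolding slowly_varying_def using c B pos main by (auto simp: subset_iff simp del: mem_ball)
  next
    show "\<forall>r<1. eventually (\<lambda>a. \<forall>z\<in>ball a (c / \<phi> (cmod a)). r < cmod z) to_circle"
    proof (intro allI impI)
      fix r :: real assume r: "r < 1"
      obtain b where b: "b < 1" "\<And>x. b < x \<Longrightarrow> 0 \<le> x \<Longrightarrow> x < 1 \<Longrightarrow> 1 < \<phi> x * (1 - x)"
        using large[of 1] by blast
      show "eventually (\<lambda>a. \<forall>z\<in>ball a (c / \<phi> (cmod a)). r < cmod z) to_circle"
        unfolding eventually_to_circle
      \<comment> \<open>The radius is at most \<open>1 - |a|\<close>, so
        \<open>|z| > 2 |a| - 1 > r\<close>.\<close>
      proof (intro exI[of _ "max b ((1 + r) / 2)"] conjI allI impI ballI)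
        fix a z assume a: "max b ((1 + r) / 2) < cmod a \<and> cmod a < 1" and z: "z \<in> ball a (c / \<phi> (cmod a))"
        have pa: "\<phi> (cmod a) > 0" using pos a by simp
        have "cmod (a - z) < c / \<phi> (cmod a)" using z by (simp add: dist_norm)
        also have "\<dots> \<le> 1 / \<phi> (cmod a)" using c pa by (intro divide_right_mono) auto
        also have "\<dots> \<le> 1 - cmod a" using b(2)[of "cmod a"] a pa by (simp add: pos_divide_le_eq mult.commute)
        finally show "r < cmod z" using a norm_triangle_sub[of a z] by (simp add: field_simps)
      qed (use b r in auto)
    qed
  qed
qed

section \<open>Conclusions for the pointwise classes\<close>

lemma normal_functions_root:
  assumes f: "f \<in> mero_disc" and n: "n \<ge> 1"
  shows "(\<lambda>z. f z ^ n) \<in> normal_functions \<Longrightarrow> f \<in> normal_functions"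
    and "(\<lambda>z. f z ^ n) \<in> strongly_normal_functions \<Longrightarrow> f \<in> strongly_normal_functions"
  using bdd_above_root[OF f n disc_weight(1)] tendsto_0_root[OF f n disc_weight] f
  by (auto simp: normal_functions_def strongly_normal_functions_def)

lemma phi_normal_functions_root:
  assumes f: "f \<in> mero_disc" and n: "n \<ge> 1" and \<phi>: "smoothly_increasing \<phi>"
  shows "(\<lambda>z. f z ^ n) \<in> phi_normal_functions \<phi> \<Longrightarrow> f \<in> phi_normal_functions \<phi>"
    and "(\<lambda>z. f z ^ n) \<in> strongly_phi_normal_functions \<phi> \<Longrightarrow> f \<in> strongly_phi_normal_functions \<phi>"
proof -
  obtain c B where cB: "slowly_varying c B (\<lambda>z. \<phi> (cmod z))"
    and near: "\<forall>r<1. eventually (\<lambda>a. \<forall>z\<in>ball a (c / \<phi> (cmod a)). r < cmod z) to_circle"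
    using smoothly_increasing_weight[OF \<phi>] .
  show "(\<lambda>z. f z ^ n) \<in> phi_normal_functions \<phi> \<Longrightarrow> f \<in> phi_normal_functions \<phi>"
    using bdd_above_root[OF f n cB] f by (simp add: phi_normal_functions_def)
  show "(\<lambda>z. f z ^ n) \<in> strongly_phi_normal_functions \<phi> \<Longrightarrow> f \<in> strongly_phi_normal_functions \<phi>"
    using tendsto_0_root[OF f n cB] near f by (simp add: strongly_phi_normal_functions_def)
qed

subsection \<open>The superharmonic weight inequality\<close>

lemma continuous_on_spherical_deriv:
  assumes f: "f \<in> mero_disc" and n: "n \<ge> 1"
  shows "continuous_on unit_disc (spherical_deriv (\<lambda>v. f v ^ n))"
proof (rule continuous_at_imp_continuous_on, rule ballI)
  fix z assume z: "z \<in> unit_disc"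
  obtain N k where ch: "spherical_chart f N k" and zN: "z \<in> N" using mero_disc_chart[OF f z] .
  note N = spherical_chartD[OF ch]
  have hol: "(\<lambda>v. k v ^ n) holomorphic_on N" using N(3) by (intro holomorphic_intros)
  then have c: "continuous_on N (\<lambda>v. k v ^ n)" "continuous_on N (deriv (\<lambda>v. k v ^ n))"
    using N(1) by (auto intro!: holomorphic_on_imp_continuous_on holomorphic_deriv)
  have "1 + (cmod (k w ^ n))\<^sup>2 \<noteq> 0" for w by (metis add_nonneg_eq_0_iff zero_le_one zero_le_power2 zero_neq_one)
  then have "continuous_on N (\<lambda>w. cmod (deriv (\<lambda>v. k v ^ n) w) / (1 + (cmod (k w ^ n))\<^sup>2))"
    using c by (auto intro!: continuous_on_divide continuous_on_add continuous_on_norm continuous_on_const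
        continuous_on_power[OF continuous_on_norm])
  then have "continuous_on N (spherical_deriv (\<lambda>v. f v ^ n))"
    using N(5)[OF n] by (simp cong: continuous_on_cong)
  then show "isCont (spherical_deriv (\<lambda>v. f v ^ n)) z"
    using N(1) zN continuous_on_eq_continuous_at by blast
qed

text \<open>The functions \<open>ln (1 + |f|^2)\<close> and \<open>ln (1 + |f^n|^2)\<close> are
  potentials of the pullbacks of the spherical metric by \<open>f\<close> and \<open>f^n\<close>.
  With the factor \<open>n\<close> their singularities at the poles of \<open>f\<close>
  cancel.\<close>

definition power_defect :: "nat \<Rightarrow> complex \<Rightarrow> real" where
  "power_defect n w = real n * ln (1 + (cmod w)\<^sup>2) - ln (1 + (cmod (w ^ n))\<^sup>2)"

text \<open>In \<open>ln (1 + 1/y) = ln (1 + y) - ln y\<close>, taken at \<open>y = x\<close> and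
  \<open>y = x^n\<close>, the extra terms \<open>n ln x\<close> and \<open>ln (x^n)\<close> cancel.
  The convention \<open>inverse 0 = 0\<close> fits: for \<open>n \<ge> 1\<close> the value at
  \<open>0\<close> is \<open>0\<close>, which is also the limit at infinity.\<close>

lemma power_defect_inverse: "power_defect n (inverse w) = power_defect n w"
proof (cases "w = 0")
  case False
  define x where "x = (cmod w)\<^sup>2"
  have x: "x > 0" using False by (simp add: x_def)
  have "ln (1 + inverse y) = ln (1 + y) - ln y" if "y > 0" for y :: real
  proof -
    have "1 + inverse y = (1 + y) / y" using that by (simp add: field_simps)
    then show ?thesis using that by (simp add: ln_div)
  qed
  note e = this[OF x] this[OF zero_less_power[OF x, of n]]
  have "(cmod (w ^ n))\<^sup>2 = x ^ n" "(cmod (inverse w))\<^sup>2 = inverse x" "(cmod (inverse w ^ n))\<^sup>2 = inverse (x ^ n)"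
    by (simp_all add: x_def norm_power norm_inverse power_inverse power_mult[symmetric] mult.commute)
  then show ?thesis
    unfolding power_defect_def by (simp only: x_def[symmetric] e ln_realpow) (simp add: algebra_simps)
qed simp

text \<open>With \<open>x = |w|^2\<close> this is the logarithm of
  \<open>1 + x^n \<le> (1 + x)^n \<le> 2^n (1 + x^n)\<close>.\<close>

lemma power_defect_bounds:
  assumes n: "n \<ge> 1"
  shows "0 \<le> power_defect n w" "power_defect n w \<le> real n * ln 2"
proof -
  define x where "x = (cmod w)\<^sup>2"
  have x: "x \<ge> 0" by (simp add: x_def)
  have xn: "(cmod (w ^ n))\<^sup>2 = x ^ n" by (simp add: x_def norm_power power_mult[symmetric] mult.commute)
  \<comment> \<open>For exponent \<open>0\<close> the inequality would read
    \<open>2 \<le> 1\<close>; the second disjunct starts the induction there.\<close>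
  have "1 + x ^ n \<le> (1 + x) ^ n \<or> n = 0"
  proof (induction n)
    case (Suc n)
    then show ?case
    proof
      assume IH: "1 + x ^ n \<le> (1 + x) ^ n"
      have "1 + x ^ Suc n \<le> (1 + x) * (1 + x ^ n)" using x by (simp add: algebra_simps)
      also have "\<dots> \<le> (1 + x) * (1 + x) ^ n" using IH x by (intro mult_left_mono) auto
      finally show ?thesis by simp
    qed simp
  qed simp
  moreover have "(1 + x) ^ n \<le> 2 ^ n * (1 + x ^ n)"
  proof (cases "x \<le> 1")
    case True
    then have "(1 + x) ^ n \<le> 2 ^ n * 1" using x power_mono[of "1 + x" 2 n] by simp
    also have "\<dots> \<le> 2 ^ n * (1 + x ^ n)" using x by (intro mult_left_mono) auto
    finally show ?thesis .
  next
    case False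
    then have "(1 + x) ^ n \<le> (2 * x) ^ n" using x by (intro power_mono) auto
    also have "\<dots> = 2 ^ n * x ^ n" by (simp add: power_mult_distrib)
    also have "\<dots> \<le> 2 ^ n * (1 + x ^ n)" by (intro mult_left_mono) auto
    finally show ?thesis .
  qed
  moreover have "0 < 1 + x ^ n" "0 < 1 + x" using x by (auto simp: add_pos_nonneg)
  ultimately show "0 \<le> power_defect n w" "power_defect n w \<le> real n * ln 2"
    unfolding power_defect_def xn x_def[symmetric]
    using ln_le_cancel_iff[of "1 + x ^ n" "(1 + x) ^ n"] ln_le_cancel_iff[of "(1 + x) ^ n" "2 ^ n * (1 + x ^ n)"]
      n by (auto simp: ln_realpow ln_mult)
qed

text \<open>
  Since \<open>power_defect\<close> is invariant under inversion, it is twice continuously differentiable across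
  the poles of \<open>f\<close> as well.
\<close>
lemma laplacian_power_defect:
  assumes f: "f \<in> mero_disc" and n: "n \<ge> 1"
  obtains u1 u2 where "\<And>e. C2_along unit_disc e (\<lambda>z. power_defect n (f z)) (u1 e) (u2 e)"
    "\<And>z. z \<in> unit_disc \<Longrightarrow> u2 1 z + u2 \<i> z =
       4 * (real n * (spherical_deriv f z)\<^sup>2 - (spherical_deriv (\<lambda>v. f v ^ n) z)\<^sup>2)"
proof -
  let ?h = "\<lambda>z. power_defect n (f z)"
  have local: "\<exists>N v1 v2. open N \<and> z \<in> N \<and> (\<forall>e. C2_along N e ?h (v1 e) (v2 e)) \<and>
      v2 1 z + v2 \<i> z = 4 * (real n * (spherical_deriv f z)\<^sup>2 - (spherical_deriv (\<lambda>v. f v ^ n) z)\<^sup>2)"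
    if z: "z \<in> unit_disc" for z
  proof -
    obtain N k where ch: "spherical_chart f N k" and zN: "z \<in> N" using mero_disc_chart[OF f z] .
    note N = spherical_chartD[OF ch]
    have hol: "(\<lambda>v. k v ^ n) holomorphic_on N" using N(3) by (intro holomorphic_intros)
    have pos: "(cmod w)\<^sup>2 + 1 > 0" for w by (simp add: add_nonneg_pos)
    obtain a1 a2 where a: "\<And>e. C2_along N e (\<lambda>z. ln ((cmod (k z))\<^sup>2 + 1)) (a1 e) (a2 e)"
      "\<And>z. z \<in> N \<Longrightarrow> a2 1 z + a2 \<i> z = 4 * 1 * (cmod (deriv k z))\<^sup>2 / ((cmod (k z))\<^sup>2 + 1)\<^sup>2"
      using C2_along_ln_norm_square[OF N(3,1) pos] by blast
    obtain b1 b2 where b: "\<And>e. C2_along N e (\<lambda>z. ln ((cmod (k z ^ n))\<^sup>2 + 1)) (b1 e) (b2 e)"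
      "\<And>z. z \<in> N \<Longrightarrow> b2 1 z + b2 \<i> z = 4 * 1 * (cmod (deriv (\<lambda>v. k v ^ n) z))\<^sup>2 / ((cmod (k z ^ n))\<^sup>2 + 1)\<^sup>2"
      using C2_along_ln_norm_square[OF hol N(1) pos] by blast
    have heq: "?h w = real n * ln ((cmod (k w))\<^sup>2 + 1) + (- 1) * ln ((cmod (k w ^ n))\<^sup>2 + 1) + 0" if "w \<in> N" for w
    proof -
      have "?h w = power_defect n (k w)" using N(4) that power_defect_inverse by auto
      then show ?thesis by (simp add: power_defect_def add.commute)
    qed
    have "C2_along N e ?h (\<lambda>z. real n * a1 e z + (- 1) * b1 e z) (\<lambda>z. real n * a2 e z + (- 1) * b2 e z)" for e
      by (rule C2_along_cong[OF C2_along_linear[OF a(1) b(1)] N(1) heq])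
    moreover have "(real n * a2 1 z + (- 1) * b2 1 z) + (real n * a2 \<i> z + (- 1) * b2 \<i> z) =
        4 * (real n * (spherical_deriv f z)\<^sup>2 - (spherical_deriv (\<lambda>v. f v ^ n) z)\<^sup>2)"
    proof -
      have "(real n * a2 1 z + (- 1) * b2 1 z) + (real n * a2 \<i> z + (- 1) * b2 \<i> z) =
        real n * (a2 1 z + a2 \<i> z) - (b2 1 z + b2 \<i> z)" by (simp add: algebra_simps)
      also have "\<dots> = 4 * (real n * (spherical_deriv f z)\<^sup>2 - (spherical_deriv (\<lambda>v. f v ^ n) z)\<^sup>2)"
        using N(5)[of 1 z] unfolding a(2)[OF zN] b(2)[OF zN] N(5)[OF n zN]
        by (simp add: zN power_divide add.commute algebra_simps)
      finally show ?thesis .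
    qed
    ultimately show ?thesis using N(1) zN
      by (intro exI[of _ N] exI[of _ "\<lambda>e z. real n * a1 e z + (- 1) * b1 e z"]
        exI[of _ "\<lambda>e z. real n * a2 e z + (- 1) * b2 e z"]) simp
  qed
  show ?thesis
  proof (rule that)
    show "C2_along unit_disc e ?h (dir_deriv e ?h) (dir_deriv e (dir_deriv e ?h))" for e
      by (rule C2_along_local) (use local in blast)
    fix z assume z: "z \<in> unit_disc"
    obtain N v1 v2 where v: "open N" "z \<in> N" "\<And>e. C2_along N e ?h (v1 e) (v2 e)"
      "v2 1 z + v2 \<i> z = 4 * (real n * (spherical_deriv f z)\<^sup>2 - (spherical_deriv (\<lambda>v. f v ^ n) z)\<^sup>2)"
      using local[OF z] by blast
    show "dir_deriv 1 (dir_deriv 1 ?h) z + dir_deriv \<i> (dir_deriv \<i> ?h) z =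
       4 * (real n * (spherical_deriv f z)\<^sup>2 - (spherical_deriv (\<lambda>v. f v ^ n) z)\<^sup>2)"
      using C2_along_dir_deriv(2)[OF v(3,1,2)] v(4) by simp
  qed
qed

text \<open>For \<open>x > 0\<close> the derivative is \<open>x^2 / (x^2 + \<delta>^2)\<close>,
  which increases from \<open>0\<close> towards \<open>1\<close> and vanishes to second order at
  \<open>0\<close>. Cutting off at \<open>0\<close> thus leaves a convex function of class C^2, and
  it approximates the positive part from below.\<close>

definition smooth_pos_part :: "real \<Rightarrow> real \<Rightarrow> real" where
  "smooth_pos_part \<delta> x = max 0 x - \<delta> * arctan (max 0 x / \<delta>)"

text \<open>Since \<open>q1 0 = 0\<close>, the difference quotient of the truncated function at
  \<open>0\<close> is dominated by that of \<open>q\<close> and tends to \<open>0\<close>. Applied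
  to the arctangent expression and again to its derivative, this gives both derivatives in
  \<open>smooth_pos_part_derivs\<close>.\<close>

lemma DERIV_compose_pos_part:
  fixes q :: "real \<Rightarrow> real"
  assumes q: "\<And>x. (q has_real_derivative q1 x) (at x)" and q0: "q1 0 = 0"
  shows "((\<lambda>x. q (max 0 x)) has_real_derivative q1 (max 0 x)) (at x)"
proof -
  consider "x > 0" | "x < 0" | "x = 0" by linarith
  then show ?thesis
  proof cases
    case 1
    then have "eventually (\<lambda>y. y > 0) (nhds x)" 
      by (intro eventually_nhds_in_open[of "{0<..}" x, simplified]) auto
    then have "eventually (\<lambda>y. q (max 0 y) = q y) (nhds x)" by (auto elim: eventually_mono)
    from DERIV_cong_ev[OF refl this refl] show ?thesis using q[of x] 1 by simp
  next
    case 2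
    then have "eventually (\<lambda>y. y < 0) (nhds x)"
      by (intro eventually_nhds_in_open[of "{..<0}" x, simplified]) auto
    then have "eventually (\<lambda>y. q (max 0 y) = q 0) (nhds x)" by (auto elim: eventually_mono)
    from DERIV_cong_ev[OF refl this refl] show ?thesis using q0 2 by simp
  next
    case 3
    have lim: "((\<lambda>y. (q y - q 0) / (y - 0)) \<longlongrightarrow> 0) (at 0)"
      using q[of 0] q0 by (simp add: has_field_derivative_iff)
    have "((\<lambda>y. (q (max 0 y) - q 0) / (y - 0)) \<longlongrightarrow> 0) (at 0)"
    proof (rule Lim_null_comparison[OF _ tendsto_norm_zero[OF lim]], intro always_eventually allI)
      show "norm ((q (max 0 y) - q 0) / (y - 0)) \<le> norm ((q y - q 0) / (y - 0))" for y
        unfolding norm_divide by (intro divide_right_mono) (auto simp: max_def)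
    qed
    then show ?thesis using 3 q0 by (simp add: has_field_derivative_iff)
  qed
qed

lemma smooth_pos_part_derivs:
  assumes \<delta>: "\<delta> > 0"
  obtains \<psi>1 \<psi>2 where "\<forall>x. (smooth_pos_part \<delta> has_real_derivative \<psi>1 x) (at x)"
    "\<forall>x. (\<psi>1 has_real_derivative \<psi>2 x) (at x)" "continuous_on UNIV \<psi>2"
    "\<forall>x. 0 \<le> \<psi>1 x" "\<forall>x. \<psi>1 x \<le> 1" "\<forall>x. 0 \<le> \<psi>2 x"
proof -
  define \<psi>1 where "\<psi>1 = (\<lambda>x. (max 0 x)\<^sup>2 / ((max 0 x)\<^sup>2 + \<delta>\<^sup>2))"
  define \<psi>2 where "\<psi>2 = (\<lambda>x. 2 * \<delta>\<^sup>2 * max 0 x / ((max 0 x)\<^sup>2 + \<delta>\<^sup>2)\<^sup>2)"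
  have p: "x\<^sup>2 + \<delta>\<^sup>2 > 0" for x using \<delta> by (intro add_nonneg_pos) auto
  have p': "x\<^sup>2 + \<delta>\<^sup>2 \<noteq> 0" for x using p[of x] by (rule less_imp_neq[symmetric])
  have "((\<lambda>x. x - \<delta> * arctan (x / \<delta>)) has_real_derivative x\<^sup>2 / (x\<^sup>2 + \<delta>\<^sup>2)) (at x)" for x
  proof -
    have "1 - \<delta> * (inverse (1 + (x / \<delta>)\<^sup>2) * (1 / \<delta>)) = x\<^sup>2 / (x\<^sup>2 + \<delta>\<^sup>2)"
    proof -
      have "1 + (x / \<delta>)\<^sup>2 = (x\<^sup>2 + \<delta>\<^sup>2) / \<delta>\<^sup>2" using \<delta> by (simp add: power_divide add_divide_distrib)
      then have "1 - \<delta> * (inverse (1 + (x / \<delta>)\<^sup>2) * (1 / \<delta>)) = 1 - \<delta>\<^sup>2 / (x\<^sup>2 + \<delta>\<^sup>2)"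
        using \<delta> by (simp add: inverse_eq_divide)
      also have "\<dots> = x\<^sup>2 / (x\<^sup>2 + \<delta>\<^sup>2)" using p'[of x] by (simp add: divide_simps)
      finally show ?thesis .
    qed
    then show ?thesis using \<delta> by (auto intro!: derivative_eq_intros simp: inverse_eq_divide)
  qed
  from DERIV_compose_pos_part[OF this] have 1: "(smooth_pos_part \<delta> has_real_derivative \<psi>1 x) (at x)" for x
    unfolding \<psi>1_def smooth_pos_part_def by simp
  have "((\<lambda>x. x\<^sup>2 / (x\<^sup>2 + \<delta>\<^sup>2)) has_real_derivative 2 * \<delta>\<^sup>2 * x / (x\<^sup>2 + \<delta>\<^sup>2)\<^sup>2) (at x)" for x
    using p'[of x] by (auto intro!: derivative_eq_intros simp: power2_eq_square algebra_simps)
  from DERIV_compose_pos_part[OF this] have 2: "(\<psi>1 has_real_derivative \<psi>2 x) (at x)" for x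
    unfolding \<psi>1_def \<psi>2_def by simp
  have 3: "continuous_on UNIV \<psi>2"
    unfolding \<psi>2_def by (intro continuous_intros) (use p' in auto)
  have "0 \<le> \<psi>1 x" "\<psi>1 x \<le> 1" "0 \<le> \<psi>2 x" for x
    unfolding \<psi>1_def \<psi>2_def using p[of "max 0 x"] by (auto simp: divide_le_eq)
  then show ?thesis using that[of \<psi>1 \<psi>2] 1 2 3 by blast
qed

lemma smooth_pos_part_bounds:
  assumes "\<delta> > 0"
  shows "0 \<le> smooth_pos_part \<delta> x" "smooth_pos_part \<delta> x \<le> max 0 x"
proof -
  have "arctan y \<le> y" if "y \<ge> 0" for y :: real
    using that arctan_le_self by blast
  from this[of "max 0 x / \<delta>"] show "0 \<le> smooth_pos_part \<delta> x"
    using assms by (simp add: smooth_pos_part_def pos_le_divide_eq mult.commute)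
  show "smooth_pos_part \<delta> x \<le> max 0 x"
    using assms by (simp add: smooth_pos_part_def)
qed

lemma smooth_pos_part_tendsto:
  "(\<lambda>n. smooth_pos_part (inverse (real (Suc n))) x) \<longlonglongrightarrow> max 0 x"
proof -
  have "(\<lambda>n. inverse (real (Suc n)) * arctan (max 0 x / inverse (real (Suc n)))) \<longlonglongrightarrow> 0"
  proof (rule Lim_null_comparison)
    show "eventually (\<lambda>n. norm (inverse (real (Suc n)) * arctan (max 0 x / inverse (real (Suc n))))
       \<le> inverse (real (Suc n)) * (pi / 2)) sequentially"
    proof (intro always_eventually allI)
      fix n
      have "\<bar>arctan y\<bar> \<le> pi / 2" for y using arctan_bounded[of y] by (intro abs_leI) auto
      then show "norm (inverse (real (Suc n)) * arctan (max 0 x / inverse (real (Suc n))))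
         \<le> inverse (real (Suc n)) * (pi / 2)"
        unfolding real_norm_def abs_mult by (intro mult_mono abs_ge_zero) (simp_all only: abs_inverse abs_of_nat order_refl inverse_nonnegative_iff_nonnegative of_nat_0_le_iff)
    qed
    show "(\<lambda>n. inverse (real (Suc n)) * (pi / 2)) \<longlonglongrightarrow> 0"
      using tendsto_mult_right[OF LIMSEQ_inverse_real_of_nat, of "pi / 2"] by simp
  qed
  from tendsto_diff[OF tendsto_const[of "max 0 x"] this] show ?thesis
    by (simp add: smooth_pos_part_def)
qed

text \<open>Fatou's lemma. The functions \<open>u n\<close> may change sign, since
  \<open>ennreal\<close> is continuous and sends negative values to \<open>0\<close>.\<close>

lemma nn_integral_limit_le:
  fixes u :: "nat \<Rightarrow> complex \<Rightarrow> real"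
  assumes S: "open S" and u: "\<And>n. continuous_on S (u n)"
    and lim: "AE z in lborel. z \<in> S \<longrightarrow> (\<lambda>n. u n z) \<longlonglongrightarrow> v z"
    and le: "\<And>n. (\<integral>\<^sup>+z\<in>S. ennreal (u n z) \<partial>lborel) \<le> R"
  shows "(\<integral>\<^sup>+z\<in>S. ennreal (v z) \<partial>lborel) \<le> R"
proof -
  have meas: "(\<lambda>z. ennreal (u n z) * indicator S z) \<in> borel_measurable lborel" for n
  proof -
    have "(\<lambda>z. indicator S z *\<^sub>R u n z) \<in> borel_measurable borel"
      using S u by (intro borel_measurable_continuous_on_indicator) auto
    then have "(\<lambda>z. ennreal (indicator S z *\<^sub>R u n z)) \<in> borel_measurable lborel" by simp
    moreover have "(\<lambda>z. ennreal (indicator S z *\<^sub>R u n z)) = (\<lambda>z. ennreal (u n z) * indicator S z)"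
      by (auto simp: indicator_def)
    ultimately show ?thesis by simp
  qed
  have "(\<integral>\<^sup>+z\<in>S. ennreal (v z) \<partial>lborel) \<le> (\<integral>\<^sup>+z. liminf (\<lambda>n. ennreal (u n z) * indicator S z) \<partial>lborel)"
  proof (rule nn_integral_mono_AE)
    show "AE z in lborel. ennreal (v z) * indicator S z \<le> liminf (\<lambda>n. ennreal (u n z) * indicator S z)"
      using lim
    proof eventually_elim
      case (elim z)
      show ?case
      proof (cases "z \<in> S")
        case True
        then have "(\<lambda>n. ennreal (u n z)) \<longlonglongrightarrow> ennreal (v z)" using elim tendsto_ennrealI by blast
        then have "liminf (\<lambda>n. ennreal (u n z)) = ennreal (v z)" by (intro lim_imp_Liminf) auto
        then show ?thesis using True by simp
      qed simp
    qed
  qed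
  also have "\<dots> \<le> liminf (\<lambda>n. \<integral>\<^sup>+z\<in>S. ennreal (u n z) \<partial>lborel)"
    by (rule nn_integral_liminf) (rule meas)
  also have "\<dots> \<le> limsup (\<lambda>n. \<integral>\<^sup>+z\<in>S. ennreal (u n z) \<partial>lborel)" by (rule Liminf_le_Limsup) simp
  also have "\<dots> \<le> R" by (rule Limsup_bounded) (use le in auto)
  finally show ?thesis .
qed

text \<open>
  Green's formula is applied to \<open>H - power_defect\<close>, with \<open>H\<close> an upper bound, and to a smoothed
  positive part of \<open>L\<close>; the convexity of the smoothing makes the unbounded terms have a good sign.
\<close>
lemma superharmonic_weight_smoothed:
  assumes f: "f \<in> mero_disc" and n: "n \<ge> 1"
    and L: "\<And>e. C2_along unit_disc e L (l1 e) (l2 e)"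
    and super: "\<And>z. z \<in> unit_disc \<Longrightarrow> l2 1 z + l2 \<i> z \<le> 0"
    and K: "compact K" "K \<subseteq> unit_disc" "\<And>z. z \<in> unit_disc - K \<Longrightarrow> L z \<le> 0"
    and C: "0 \<le> C" "(\<integral>\<^sup>+z\<in>unit_disc. ennreal (- (l2 1 z + l2 \<i> z)) \<partial>lborel) \<le> ennreal C"
    and \<delta>: "\<delta> > 0"
  shows "(\<integral>\<^sup>+z\<in>unit_disc. ennreal ((spherical_deriv f z)\<^sup>2 * smooth_pos_part \<delta> (L z)) \<partial>lborel)
    \<le> (\<integral>\<^sup>+z\<in>unit_disc. ennreal ((spherical_deriv (\<lambda>v. f v ^ n) z)\<^sup>2 * max 0 (L z)) \<partial>lborel)
       + ennreal (real n * ln 2 * C / 4)"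
proof -
  let ?D = unit_disc
  define F where "F = (\<lambda>z. (spherical_deriv f z)\<^sup>2)"
  define G where "G = (\<lambda>z. (spherical_deriv (\<lambda>v. f v ^ n) z)\<^sup>2)"
  define H where "H = real n * ln 2"
  \<comment> \<open>Green's formula produces \<open>u\<close> times the Laplacian of the weight, and
    a one-sided bound for that Laplacian is usable only if \<open>u\<close> is nonnegative. The
    summand with coefficient \<open>0\<close> fits the shape of
    \<open>C2_along_linear\<close>.\<close>
  define u where "u = (\<lambda>z. - 1 * power_defect n (f z) + 0 * power_defect n (f z) + H)"
  obtain h1 h2 where h: "\<And>e. C2_along ?D e (\<lambda>z. power_defect n (f z)) (h1 e) (h2 e)"
    "\<And>z. z \<in> ?D \<Longrightarrow> h2 1 z + h2 \<i> z = 4 * (real n * F z - G z)"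
    unfolding F_def G_def using laplacian_power_defect[OF f n] by blast
  define u1 where "u1 = (\<lambda>e z. - 1 * h1 e z + 0 * h1 e z)"
  define u2 where "u2 = (\<lambda>e z. - 1 * h2 e z + 0 * h2 e z)"
  have u: "C2_along ?D e u (u1 e) (u2 e)" for e
    unfolding u_def u1_def u2_def by (rule C2_along_linear[OF h(1) h(1)])
  have u_bounds: "0 \<le> u z" "u z \<le> H" for z
    using power_defect_bounds[OF n, of "f z"] by (auto simp: u_def H_def)
  have H0: "H \<ge> 0" by (simp add: H_def)
  obtain \<psi>1 \<psi>2 where \<psi>: "\<forall>x. (smooth_pos_part \<delta> has_real_derivative \<psi>1 x) (at x)"
    "\<forall>x. (\<psi>1 has_real_derivative \<psi>2 x) (at x)" "continuous_on UNIV \<psi>2"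
    "\<forall>x. 0 \<le> \<psi>1 x" "\<forall>x. \<psi>1 x \<le> 1" "\<forall>x. 0 \<le> \<psi>2 x"
    using smooth_pos_part_derivs[OF \<delta>] .
  define w where "w = (\<lambda>z. smooth_pos_part \<delta> (L z))"
  define w1 where "w1 = (\<lambda>e z. \<psi>1 (L z) * l1 e z)"
  define w2 where "w2 = (\<lambda>e z. \<psi>2 (L z) * (l1 e z)\<^sup>2 + \<psi>1 (L z) * l2 e z)"
  have w: "C2_along ?D e w (w1 e) (w2 e)" for e
    unfolding w_def w1_def w2_def by (rule C2_along_compose[OF L, where T = UNIV]) (use \<psi> in auto)
  have w_bounds: "0 \<le> w z" "w z \<le> max 0 (L z)" for z
    using smooth_pos_part_bounds[OF \<delta>] by (auto simp: w_def)
  have w0: "w z = 0" if "z \<in> ?D - K" for z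
    using w_bounds[of z] K(3)[OF that] by simp
  have cw: "continuous_on ?D w" using w by (auto simp: C2_along_def)
  have cFG: "continuous_on ?D F" "continuous_on ?D G"
    unfolding F_def G_def using continuous_on_spherical_deriv[OF f, of 1] continuous_on_spherical_deriv[OF f n]
    by (auto intro!: continuous_intros)
  note green = green_along[OF open_ball K(1,2) u w w0]
  have int: "set_integrable lborel ?D (\<lambda>z. w z * F z)" "set_integrable lborel ?D (\<lambda>z. w z * G z)"
    using cw cFG w0 by (auto intro!: integrable_continuous_compact_support[OF K(1,2)] continuous_intros)
  have "(LINT z:?D|lborel. w z * (u2 1 z + u2 \<i> z)) = (LINT z:?D|lborel. u z * (w2 1 z + w2 \<i> z))"
    using green(1)[of 1] green(1)[of \<i>] green(2,3) by (simp add: distrib_left set_integral_add)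
  moreover have "(LINT z:?D|lborel. w z * (u2 1 z + u2 \<i> z)) =
      (LINT z:?D|lborel. 4 * (w z * G z) - 4 * real n * (w z * F z))"
  proof (rule set_lebesgue_integral_cong)
    show "\<forall>z. z \<in> ?D \<longrightarrow> w z * (u2 1 z + u2 \<i> z) = 4 * (w z * G z) - 4 * real n * (w z * F z)"
    proof (intro allI impI)
      fix z assume "z \<in> ?D"
      have eq: "u2 1 z + u2 \<i> z = - (h2 1 z + h2 \<i> z)" by (simp add: u2_def)
      show "w z * (u2 1 z + u2 \<i> z) = 4 * (w z * G z) - 4 * real n * (w z * F z)"
        unfolding eq h(2)[OF \<open>z \<in> ?D\<close>] by (simp add: algebra_simps)
    qed
  qed simp
  moreover have "(LINT z:?D|lborel. 4 * (w z * G z) - 4 * real n * (w z * F z)) =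
      4 * (LINT z:?D|lborel. w z * G z) - 4 * real n * (LINT z:?D|lborel. w z * F z)"
    using int by (simp add: set_integral_diff)
  moreover have "- (LINT z:?D|lborel. u z * (w2 1 z + w2 \<i> z)) \<le> H * C"
  proof -
    have "- (LINT z:?D|lborel. u z * (w2 1 z + w2 \<i> z)) =
        (\<integral>z. - (indicator ?D z * (u z * (w2 1 z + w2 \<i> z))) \<partial>lborel)"
      by (simp add: set_lebesgue_integral_def)
    also have "\<dots> \<le> H * C"
    \<comment> \<open>The Bochner integral is bounded through the \<open>nn_integral\<close> of the
      positive part of its integrand, so a pointwise estimate from above suffices.\<close>
    proof (rule integral_real_bounded)
      show "0 \<le> H * C" using H0 C by simp
      have "(\<integral>\<^sup>+z. ennreal (- (indicator ?D z * (u z * (w2 1 z + w2 \<i> z)))) \<partial>lborel)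
        \<le> (\<integral>\<^sup>+z. ennreal H * (ennreal (- (l2 1 z + l2 \<i> z)) * indicator ?D z) \<partial>lborel)"
      proof (rule nn_integral_mono)
        fix z :: complex
        show "ennreal (- (indicator ?D z * (u z * (w2 1 z + w2 \<i> z))))
           \<le> ennreal H * (ennreal (- (l2 1 z + l2 \<i> z)) * indicator ?D z)"
        proof (cases "z \<in> ?D")
          case True
          have "- (w2 1 z + w2 \<i> z) \<le> - (\<psi>1 (L z) * (l2 1 z + l2 \<i> z))"
          proof -
            have "0 \<le> \<psi>2 (L z) * ((l1 1 z)\<^sup>2 + (l1 \<i> z)\<^sup>2)" using \<psi>(6) by simp
            then show ?thesis by (simp add: w2_def distrib_left)
          qed
          also have "\<dots> = \<psi>1 (L z) * (- (l2 1 z + l2 \<i> z))" by (rule mult_minus_right[symmetric])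
          also have "\<dots> \<le> 1 * (- (l2 1 z + l2 \<i> z))"
            using \<psi>(5) super[OF True] by (intro mult_right_mono) auto
          finally have "u z * (- (w2 1 z + w2 \<i> z)) \<le> u z * (- (l2 1 z + l2 \<i> z))"
            using u_bounds by (intro mult_left_mono) auto
          also have "\<dots> \<le> H * (- (l2 1 z + l2 \<i> z))"
            using u_bounds super[OF True] by (intro mult_right_mono) auto
          finally have "ennreal (u z * (- (w2 1 z + w2 \<i> z))) \<le> ennreal (H * (- (l2 1 z + l2 \<i> z)))"
            by (rule ennreal_leI)
          also have "\<dots> = ennreal H * ennreal (- (l2 1 z + l2 \<i> z))"
            using H0 super[OF True] by (intro ennreal_mult) auto
          finally show ?thesis
            unfolding mult_minus_right indicator_eq_1_iff[THEN iffD2, OF True] mult_1 mult_1_right .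
        qed simp
      qed
      also have "\<dots> = ennreal H * (\<integral>\<^sup>+z\<in>?D. ennreal (- (l2 1 z + l2 \<i> z)) \<partial>lborel)"
      proof (rule nn_integral_cmult)
        have "continuous_on ?D (\<lambda>z. - (l2 1 z + l2 \<i> z))"
          using L unfolding C2_along_def by (intro continuous_intros) auto
        then have "(\<lambda>z. indicator ?D z *\<^sub>R (- (l2 1 z + l2 \<i> z))) \<in> borel_measurable borel"
          by (intro borel_measurable_continuous_on_indicator) auto
        then have "(\<lambda>z. ennreal (indicator ?D z *\<^sub>R (- (l2 1 z + l2 \<i> z)))) \<in> borel_measurable lborel" by simp
        moreover have "(\<lambda>z. ennreal (indicator ?D z *\<^sub>R (- (l2 1 z + l2 \<i> z)))) =
            (\<lambda>z. ennreal (- (l2 1 z + l2 \<i> z)) * indicator ?D z)" by (auto simp: indicator_def)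
        ultimately show "(\<lambda>z. ennreal (- (l2 1 z + l2 \<i> z)) * indicator ?D z) \<in> borel_measurable lborel" by simp
      qed
      also have "\<dots> \<le> ennreal H * ennreal C" by (rule mult_left_mono[OF C(2)]) simp
      also have "\<dots> = ennreal (H * C)" using H0 C by (simp add: ennreal_mult)
      finally show "(\<integral>\<^sup>+z. ennreal (- (indicator ?D z * (u z * (w2 1 z + w2 \<i> z)))) \<partial>lborel) \<le> ennreal (H * C)" .
    qed
    finally show ?thesis .
  qed
  ultimately have main: "real n * (LINT z:?D|lborel. w z * F z) \<le> (LINT z:?D|lborel. w z * G z) + H * C / 4"
    by (simp add: field_simps)
  have F0: "F z \<ge> 0" "G z \<ge> 0" for z by (auto simp: F_def G_def)
  have pos: "0 \<le> (LINT z:?D|lborel. w z * F z)" "0 \<le> (LINT z:?D|lborel. w z * G z)"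
    unfolding set_lebesgue_integral_def using w_bounds(1) F0 by (auto intro!: integral_nonneg_AE)
  have "1 * (LINT z:?D|lborel. w z * F z) \<le> real n * (LINT z:?D|lborel. w z * F z)"
    using n pos by (intro mult_right_mono) auto
  then have main': "(LINT z:?D|lborel. w z * F z) \<le> (LINT z:?D|lborel. w z * G z) + H * C / 4"
    using main by simp
  have nn: "(\<integral>\<^sup>+z\<in>?D. ennreal (w z * f z) \<partial>lborel) = ennreal (LINT z:?D|lborel. w z * f z)"
    if "set_integrable lborel ?D (\<lambda>z. w z * f z)" "\<And>z. f z \<ge> 0" for f :: "complex \<Rightarrow> real"
  proof -
    have "(\<integral>\<^sup>+z\<in>?D. ennreal (w z * f z) \<partial>lborel) = (\<integral>\<^sup>+z. ennreal (indicator ?D z *\<^sub>R (w z * f z)) \<partial>lborel)"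
      by (intro nn_integral_cong) (auto simp: indicator_def)
    also have "\<dots> = ennreal (LINT z:?D|lborel. w z * f z)"
      unfolding set_lebesgue_integral_def
      by (rule nn_integral_eq_integral) (use that w_bounds in \<open>auto simp: set_integrable_def\<close>)
    finally show ?thesis .
  qed
  have "(\<integral>\<^sup>+z\<in>?D. ennreal (w z * F z) \<partial>lborel) \<le> ennreal ((LINT z:?D|lborel. w z * G z) + H * C / 4)"
    unfolding nn[OF int(1) F0(1)] by (rule ennreal_leI[OF main'])
  also have "\<dots> = (\<integral>\<^sup>+z\<in>?D. ennreal (w z * G z) \<partial>lborel) + ennreal (H * C / 4)"
    unfolding nn[OF int(2) F0(2)] using pos H0 C by (intro ennreal_plus) auto
  also have "\<dots> \<le> (\<integral>\<^sup>+z\<in>?D. ennreal (G z * max 0 (L z)) \<partial>lborel) + ennreal (H * C / 4)"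
  proof (intro add_right_mono nn_integral_mono mult_right_mono ennreal_leI)
    show "w z * G z \<le> G z * max 0 (L z)" for z
      using mult_right_mono[OF w_bounds(2) F0(2), of z z] by (simp add: mult.commute)
  qed auto
  finally show ?thesis by (simp add: w_def F_def G_def H_def mult.commute)
qed

text \<open>The right-hand side of the smoothed estimate is free of \<delta>, so \<delta> tends to
  \<open>0\<close> on the left alone.\<close>

lemma superharmonic_weight:
  assumes f: "f \<in> mero_disc" and n: "n \<ge> 1"
    and L: "\<And>e. C2_along unit_disc e L (l1 e) (l2 e)"
    and super: "\<And>z. z \<in> unit_disc \<Longrightarrow> l2 1 z + l2 \<i> z \<le> 0"
    and K: "compact K" "K \<subseteq> unit_disc" "\<And>z. z \<in> unit_disc - K \<Longrightarrow> L z \<le> 0"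
    and C: "0 \<le> C" "(\<integral>\<^sup>+z\<in>unit_disc. ennreal (- (l2 1 z + l2 \<i> z)) \<partial>lborel) \<le> ennreal C"
  shows "(\<integral>\<^sup>+z\<in>unit_disc. ennreal ((spherical_deriv f z)\<^sup>2 * max 0 (L z)) \<partial>lborel)
    \<le> (\<integral>\<^sup>+z\<in>unit_disc. ennreal ((spherical_deriv (\<lambda>v. f v ^ n) z)\<^sup>2 * max 0 (L z)) \<partial>lborel)
       + ennreal (real n * ln 2 * C / 4)"
proof (rule nn_integral_limit_le)
  let ?\<delta> = "\<lambda>i. inverse (real (Suc i))"
  fix i
  have \<delta>: "?\<delta> i > 0" by simp
  show "(\<integral>\<^sup>+z\<in>unit_disc. ennreal ((spherical_deriv f z)\<^sup>2 * smooth_pos_part (?\<delta> i) (L z)) \<partial>lborel)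
    \<le> (\<integral>\<^sup>+z\<in>unit_disc. ennreal ((spherical_deriv (\<lambda>v. f v ^ n) z)\<^sup>2 * max 0 (L z)) \<partial>lborel)
       + ennreal (real n * ln 2 * C / 4)"
    by (rule superharmonic_weight_smoothed[OF f n L super K C \<delta>])
  obtain \<psi>1 \<psi>2 where "\<forall>x. (smooth_pos_part (?\<delta> i) has_real_derivative \<psi>1 x) (at x)"
    "\<forall>x. (\<psi>1 has_real_derivative \<psi>2 x) (at x)" "continuous_on UNIV \<psi>2"
    "\<forall>x. 0 \<le> \<psi>1 x" "\<forall>x. \<psi>1 x \<le> 1" "\<forall>x. 0 \<le> \<psi>2 x"
    using smooth_pos_part_derivs[OF \<delta>] .
  then have "continuous_on UNIV (smooth_pos_part (?\<delta> i))"
    by (meson DERIV_continuous continuous_at_imp_continuous_on)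
  then have "continuous_on unit_disc (\<lambda>z. smooth_pos_part (?\<delta> i) (L z))"
    using L[of 1] by (auto simp: C2_along_def intro: continuous_on_compose2)
  then show "continuous_on unit_disc (\<lambda>z. (spherical_deriv f z)\<^sup>2 * smooth_pos_part (?\<delta> i) (L z))"
    using continuous_on_spherical_deriv[OF f, of 1] by (auto intro!: continuous_intros)
next
  show "AE z in lborel. z \<in> unit_disc \<longrightarrow>
     (\<lambda>i. (spherical_deriv f z)\<^sup>2 * smooth_pos_part (inverse (real (Suc i))) (L z))
       \<longlonglongrightarrow> (spherical_deriv f z)\<^sup>2 * max 0 (L z)"
    by (intro AE_I2 impI tendsto_mult tendsto_const smooth_pos_part_tendsto)
qed simp

subsection \<open>Logarithmic and quadratic weights\<close>

text \<open>Negative reals are sent to \<open>0\<close> by \<open>ennreal\<close>, so the positive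
  part of a weight is implicit in all these integrals.\<close>

lemma ennreal_mult_max_0: "0 \<le> x \<Longrightarrow> ennreal (x * max 0 y) = ennreal (x * y)"
  by (cases "0 \<le> y") (auto simp: max_def ennreal_neg mult_nonneg_nonpos)

lemma emeasure_ball_complex: "r \<ge> 0 \<Longrightarrow> emeasure lborel (ball (a :: complex) r) = ennreal (pi * r\<^sup>2)"
  by (simp add: emeasure_ball unit_ball_vol_2)

text \<open>
  The integrand is the Laplacian of \<open>ln (|z - a|\<^sup>2 + \<epsilon>)\<close> up to a factor; comparing it with a
  constant on dyadic annuli of inner radius \<open>2\<^sup>j sqrt \<epsilon>\<close> bounds the integral uniformly in \<open>\<epsilon>\<close>.
\<close>
lemma nn_integral_laplacian_log_bound:
  assumes \<epsilon>: "\<epsilon> > 0"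
  shows "(\<integral>\<^sup>+z. ennreal (\<epsilon> / ((cmod (z - a))\<^sup>2 + \<epsilon>)\<^sup>2) \<partial>lborel) \<le> ennreal (64 / 3 * pi)"
proof -
  let ?r = "\<lambda>j. 2 ^ j * sqrt \<epsilon>"
  \<comment> \<open>For \<open>j \<ge> 1\<close> and
    \<open>|z - a| \<ge> 2^(j-1) sqrt \<epsilon>\<close> the integrand is at most
    \<open>\<epsilon> / (4^(j-1) \<epsilon>)^2 = 16 / (16^j \<epsilon>)\<close>; for
    \<open>j = 0\<close> it is at most \<open>1 / \<epsilon>\<close>. With the area
    \<open>pi 4^j \<epsilon>\<close> of the full ball the \<open>j\<close>-th term contributes
    \<open>16 pi / 4^j\<close>, and the sum is \<open>64 pi / 3\<close>.\<close>
  let ?t = "\<lambda>j z. ennreal (16 / (16 ^ j * \<epsilon>)) * indicator (ball a (?r j)) z"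
  have r2: "(?r j)\<^sup>2 = 4 ^ j * \<epsilon>" for j
  proof -
    have "((2::real) ^ j)\<^sup>2 = 4 ^ j" by (simp add: power2_eq_square flip: power_mult_distrib)
    then show ?thesis using \<epsilon> by (simp only: power_mult_distrib real_sqrt_pow2 less_imp_le)
  qed
  have pos: "(cmod (z - a))\<^sup>2 + \<epsilon> > 0" for z using \<epsilon> by (intro add_nonneg_pos) auto
  have le: "ennreal (\<epsilon> / ((cmod (z - a))\<^sup>2 + \<epsilon>)\<^sup>2) \<le> (\<Sum>j. ?t j z)" for z
  proof -
    have "\<exists>j. cmod (z - a) < ?r j"
    proof -
      obtain j where "cmod (z - a) / sqrt \<epsilon> < 2 ^ j" using real_arch_pow[of 2] by auto
      then show ?thesis using \<epsilon> by (auto simp: pos_divide_less_eq)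
    qed
    then obtain j where j: "cmod (z - a) < ?r j" and min: "\<And>i. i < j \<Longrightarrow> \<not> cmod (z - a) < ?r i"
      using exists_least_iff[of "\<lambda>j. cmod (z - a) < ?r j"] by auto
    have "\<epsilon> / ((cmod (z - a))\<^sup>2 + \<epsilon>)\<^sup>2 \<le> 16 / (16 ^ j * \<epsilon>)"
    proof (cases j)
      case 0
      have "\<epsilon> / ((cmod (z - a))\<^sup>2 + \<epsilon>)\<^sup>2 \<le> \<epsilon> / \<epsilon>\<^sup>2"
        using \<epsilon> zero_less_power[OF pos[of z], of 2] by (intro divide_left_mono power_mono mult_pos_pos) auto
      also have "\<dots> \<le> 16 / (16 ^ j * \<epsilon>)" using \<epsilon> 0 by (simp add: power2_eq_square divide_simps)
      finally show ?thesis .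
    next
      case (Suc i)
      have "(?r i)\<^sup>2 \<le> (cmod (z - a))\<^sup>2" using min[of i] Suc \<epsilon> by (intro power_mono) auto
      then have ge: "4 ^ i * \<epsilon> \<le> (cmod (z - a))\<^sup>2 + \<epsilon>" using r2[of i] \<epsilon> by linarith
      have "\<epsilon> / ((cmod (z - a))\<^sup>2 + \<epsilon>)\<^sup>2 \<le> \<epsilon> / (4 ^ i * \<epsilon>)\<^sup>2"
        using \<epsilon> ge zero_less_power[OF pos[of z], of 2] by (intro divide_left_mono power_mono mult_pos_pos) auto
      also have "\<dots> = 16 / (16 ^ j * \<epsilon>)"
        using \<epsilon> Suc by (simp add: power2_eq_square flip: power_mult_distrib)
      finally show ?thesis .
    qed
    then have "ennreal (\<epsilon> / ((cmod (z - a))\<^sup>2 + \<epsilon>)\<^sup>2) \<le> ?t j z"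
      using j by (simp add: dist_norm norm_minus_commute ennreal_leI)
    also have "\<dots> = (\<Sum>i\<in>{j}. ?t i z)"
      by (simp only: sum.insert finite.emptyI empty_iff not_False_eq_True sum.empty add_0_right)
    also have "\<dots> \<le> (\<Sum>i. ?t i z)" by (rule sum_le_suminf) (auto intro: summableI)
    finally show ?thesis .
  qed
  have "(\<integral>\<^sup>+z. ennreal (\<epsilon> / ((cmod (z - a))\<^sup>2 + \<epsilon>)\<^sup>2) \<partial>lborel) \<le> (\<integral>\<^sup>+z. (\<Sum>j. ?t j z) \<partial>lborel)"
    by (intro nn_integral_mono le)
  also have "\<dots> = (\<Sum>j. \<integral>\<^sup>+z. ?t j z \<partial>lborel)" by (rule nn_integral_suminf) (intro borel_measurable_times_ennreal borel_measurable_const borel_measurable_indicator; simp)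
  also have "\<dots> = (\<Sum>j. ennreal (16 * pi * (1 / 4) ^ j))"
  proof (intro suminf_cong)
    fix j
    have "(\<integral>\<^sup>+z. ?t j z \<partial>lborel) = ennreal (16 / (16 ^ j * \<epsilon>)) * ennreal (pi * (?r j)\<^sup>2)"
      using \<epsilon> by (simp add: nn_integral_cmult_indicator emeasure_ball_complex)
    also have "\<dots> = ennreal (16 / (16 ^ j * \<epsilon>) * (pi * (4 ^ j * \<epsilon>)))"
      unfolding r2 using \<epsilon> by (subst ennreal_mult) auto
    also have "16 / (16 ^ j * \<epsilon>) * (pi * (4 ^ j * \<epsilon>)) = 16 * pi * (1 / 4) ^ j"
    proof -
      have "(16::real) ^ j = 4 ^ j * 4 ^ j" by (simp flip: power_mult_distrib)
      then show ?thesis using \<epsilon> by (simp add: power_one_over field_simps)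
    qed
    finally show "(\<integral>\<^sup>+z. ?t j z \<partial>lborel) = ennreal (16 * pi * (1 / 4) ^ j)" .
  qed
  also have "\<dots> = ennreal (\<Sum>j. 16 * pi * (1 / 4) ^ j)"
    by (rule suminf_ennreal2) (auto intro!: summable_mult summable_geometric)
  also have "(\<Sum>j. 16 * pi * (1 / 4) ^ j) = 64 / 3 * pi"
    by (subst suminf_mult) (auto simp: suminf_geometric intro!: summable_geometric)
  finally show ?thesis .
qed

text \<open>The weight is the limit of \<open>ln |b| - ln (|z - a|^2 + \<epsilon>) / 2\<close>. Here
  \<open>ln |b|\<close> is harmonic, and the assumption on the circle keeps the set where this
  function is nonnegative away from the circle. Two choices are used:
  \<open>b = 1 - cnj a * z\<close> for \<open>UBC\<close>, and the constant \<open>b = s\<close>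
  with \<open>a = 0\<close> for \<open>ln (s / |z|)\<close>.\<close>

lemma nn_integral_spherical_log_weight:
  assumes f: "f \<in> mero_disc" and n: "n \<ge> 1"
    and b: "b holomorphic_on unit_disc" "continuous_on (cball 0 1) b" "\<And>z. z \<in> unit_disc \<Longrightarrow> b z \<noteq> 0"
    and circle: "\<And>z. cmod z = 1 \<Longrightarrow> cmod (b z) \<le> cmod (z - a)"
  shows "(\<integral>\<^sup>+z\<in>unit_disc. ennreal ((spherical_deriv f z)\<^sup>2 * ln (cmod (b z) / cmod (z - a))) \<partial>lborel)
    \<le> (\<integral>\<^sup>+z\<in>unit_disc. ennreal ((spherical_deriv (\<lambda>v. f v ^ n) z)\<^sup>2 * ln (cmod (b z) / cmod (z - a))) \<partial>lborel)
       + ennreal (real n * ln 2 * (128 / 3 * pi) / 4)" (is "?I f \<le> ?J + ?C")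
proof -
  let ?D = unit_disc
  define L where "L = (\<lambda>\<epsilon> z. (1 / 2) * ln ((cmod (b z))\<^sup>2 + 0) + (- 1 / 2) * ln ((cmod (z - a))\<^sup>2 + \<epsilon>) + 0)"
  \<comment> \<open>Division by zero gives the weight a conventional value at \<open>z = a\<close>,
    so this point is set aside as a null set.\<close>
  have AEa: "AE z in lborel. z \<noteq> a"
    by (rule AE_I[of _ _ "{a}"]) auto
  have L_eq: "L \<epsilon> z = ln (cmod (b z)) - ln ((cmod (z - a))\<^sup>2 + \<epsilon>) / 2" if "z \<in> ?D" for \<epsilon> z
    using b(3)[OF that] by (simp add: L_def ln_realpow)
  have ln_eq: "ln (cmod (b z) / cmod (z - a)) = ln (cmod (b z)) - ln ((cmod (z - a))\<^sup>2 + 0) / 2"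
    if "z \<in> ?D" "z \<noteq> a" for z
    using b(3)[OF that(1)] that(2) by (simp add: ln_div ln_realpow)
  have step: "(\<integral>\<^sup>+z\<in>?D. ennreal ((spherical_deriv f z)\<^sup>2 * max 0 (L \<epsilon> z)) \<partial>lborel) \<le> ?J + ?C"
    and cont: "continuous_on ?D (L \<epsilon>)" if \<epsilon>: "\<epsilon> > 0" for \<epsilon>
  proof -
    obtain b1 b2 where bb: "\<And>e. C2_along ?D e (\<lambda>z. ln ((cmod (b z))\<^sup>2 + 0)) (b1 e) (b2 e)"
      "\<And>z. z \<in> ?D \<Longrightarrow> b2 1 z + b2 \<i> z = 4 * 0 * (cmod (deriv b z))\<^sup>2 / ((cmod (b z))\<^sup>2 + 0)\<^sup>2"
    proof -
      have "(cmod (b z))\<^sup>2 + 0 > 0" if "z \<in> ?D" for z using b(3)[OF that] by simp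
      then show thesis using C2_along_ln_norm_square[OF b(1) open_ball] that by blast
    qed
    have hol: "(\<lambda>z. z - a) holomorphic_on ?D" by (intro holomorphic_intros)
    have pos: "(cmod (z - a))\<^sup>2 + \<epsilon> > 0" for z using \<epsilon> by (simp add: add_nonneg_pos)
    obtain a1 a2 where aa: "\<And>e. C2_along ?D e (\<lambda>z. ln ((cmod (z - a))\<^sup>2 + \<epsilon>)) (a1 e) (a2 e)"
      "\<And>z. z \<in> ?D \<Longrightarrow> a2 1 z + a2 \<i> z = 4 * \<epsilon> * (cmod (deriv (\<lambda>z. z - a) z))\<^sup>2 / ((cmod (z - a))\<^sup>2 + \<epsilon>)\<^sup>2"
      using C2_along_ln_norm_square[OF hol open_ball pos] by blast
    define l1 where "l1 = (\<lambda>e z. (1 / 2) * b1 e z + (- 1 / 2) * a1 e z)"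
    define l2 where "l2 = (\<lambda>e z. (1 / 2) * b2 e z + (- 1 / 2) * a2 e z)"
    have L: "C2_along ?D e (L \<epsilon>) (l1 e) (l2 e)" for e
      unfolding L_def l1_def l2_def by (rule C2_along_linear[OF bb(1) aa(1)])
    then show "continuous_on ?D (L \<epsilon>)" by (simp add: C2_along_def)
    have lap: "- (l2 1 z + l2 \<i> z) = 2 * (\<epsilon> / ((cmod (z - a))\<^sup>2 + \<epsilon>)\<^sup>2)" if "z \<in> ?D" for z
    proof -
      have "deriv (\<lambda>z. z - a) z = 1" by (rule DERIV_imp_deriv) (auto intro!: derivative_eq_intros)
      moreover have "- (l2 1 z + l2 \<i> z) = (1 / 2) * (a2 1 z + a2 \<i> z) - (1 / 2) * (b2 1 z + b2 \<i> z)"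
        by (simp add: l2_def algebra_simps)
      ultimately show ?thesis unfolding bb(2)[OF that] aa(2)[OF that] by simp
    qed
    \<comment> \<open>Inside the disc this is the set where \<open>L \<epsilon>\<close> is
      nonnegative. Written without logarithms, the condition is closed up to the circle, where
      \<open>b\<close> may vanish.\<close>
    define K where "K = {z \<in> cball 0 1. (cmod (z - a))\<^sup>2 + \<epsilon> \<le> (cmod (b z))\<^sup>2}"
    have K: "compact K"
    proof -
      have "closed (cball 0 1 \<inter> (\<lambda>z. (cmod (z - a))\<^sup>2 + \<epsilon> - (cmod (b z))\<^sup>2) -` {..0})"
        using b(2) by (intro continuous_closed_preimage continuous_intros) auto
      note compact_Int_closed[OF compact_cball[of 0 1] this]
      moreover have "K = cball 0 1 \<inter> (cball 0 1 \<inter> (\<lambda>z. (cmod (z - a))\<^sup>2 + \<epsilon> - (cmod (b z))\<^sup>2) -` {..0})"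
        by (auto simp: K_def)
      ultimately show ?thesis by (simp only:)
    qed
    have KD: "K \<subseteq> ?D"
    proof
      fix z assume z: "z \<in> K"
      have "cmod z \<noteq> 1"
      proof
        assume "cmod z = 1"
        then have "(cmod (b z))\<^sup>2 \<le> (cmod (z - a))\<^sup>2" by (intro power_mono circle) auto
        moreover have "(cmod (z - a))\<^sup>2 + \<epsilon> \<le> (cmod (b z))\<^sup>2" using z by (simp only: K_def mem_Collect_eq)
        ultimately show False using \<epsilon> by linarith
      qed
      then show "z \<in> ?D" using z by (simp add: K_def)
    qed
    have out: "L \<epsilon> z \<le> 0" if "z \<in> ?D - K" for z
    proof -
      have le: "(cmod (b z))\<^sup>2 \<le> (cmod (z - a))\<^sup>2 + \<epsilon>" and gt: "0 < (cmod (b z))\<^sup>2" using that b(3) by (auto simp: K_def)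
      have "ln ((cmod (b z))\<^sup>2) \<le> ln ((cmod (z - a))\<^sup>2 + \<epsilon>)"
        by (rule ln_le_cancel_iff[OF gt less_le_trans[OF gt le], THEN iffD2, OF le])
      then show ?thesis by (simp add: L_def)
    qed
    \<comment> \<open>The Laplacian of \<open>L \<epsilon>\<close> is \<open>-2\<close> times the
      integrand of \<open>nn_integral_laplacian_log_bound\<close>, so the mass is at most twice
      \<open>64 / 3 * pi\<close>, whatever \<open>a\<close>, \<open>b\<close> and \<epsilon>
      are.\<close>
    have int: "(\<integral>\<^sup>+z\<in>?D. ennreal (- (l2 1 z + l2 \<i> z)) \<partial>lborel) \<le> ennreal (128 / 3 * pi)"
    proof -
      have "(\<integral>\<^sup>+z\<in>?D. ennreal (- (l2 1 z + l2 \<i> z)) \<partial>lborel)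
        \<le> (\<integral>\<^sup>+z. 2 * ennreal (\<epsilon> / ((cmod (z - a))\<^sup>2 + \<epsilon>)\<^sup>2) \<partial>lborel)"
      proof (intro nn_integral_mono)
        fix z
        show "ennreal (- (l2 1 z + l2 \<i> z)) * indicator ?D z \<le> 2 * ennreal (\<epsilon> / ((cmod (z - a))\<^sup>2 + \<epsilon>)\<^sup>2)"
        proof (cases "z \<in> ?D")
          case True
          have "ennreal (2 * (\<epsilon> / ((cmod (z - a))\<^sup>2 + \<epsilon>)\<^sup>2)) = ennreal 2 * ennreal (\<epsilon> / ((cmod (z - a))\<^sup>2 + \<epsilon>)\<^sup>2)"
            using \<epsilon> by (intro ennreal_mult) auto
          then show ?thesis unfolding lap[OF True] using True by simp
        qed simp
      qed
      also have "\<dots> = 2 * (\<integral>\<^sup>+z. ennreal (\<epsilon> / ((cmod (z - a))\<^sup>2 + \<epsilon>)\<^sup>2) \<partial>lborel)"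
        by (rule nn_integral_cmult) measurable
      also have "\<dots> \<le> 2 * ennreal (64 / 3 * pi)"
        by (intro mult_left_mono nn_integral_laplacian_log_bound \<epsilon>) simp
      also have "\<dots> = ennreal 2 * ennreal (64 / 3 * pi)" by simp
      also have "\<dots> = ennreal (128 / 3 * pi)" by (subst ennreal_mult[symmetric]) auto
      finally show ?thesis .
    qed
    have super: "l2 1 z + l2 \<i> z \<le> 0" if "z \<in> ?D" for z
    proof -
      have "0 \<le> \<epsilon> / ((cmod (z - a))\<^sup>2 + \<epsilon>)\<^sup>2" using \<epsilon> by simp
      then show ?thesis using lap[OF that] by simp
    qed
    have "(\<integral>\<^sup>+z\<in>?D. ennreal ((spherical_deriv f z)\<^sup>2 * max 0 (L \<epsilon> z)) \<partial>lborel)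
      \<le> (\<integral>\<^sup>+z\<in>?D. ennreal ((spherical_deriv (\<lambda>v. f v ^ n) z)\<^sup>2 * max 0 (L \<epsilon> z)) \<partial>lborel) + ?C"
      by (rule superharmonic_weight[OF f n L super K KD out _ int]) auto
    \<comment> \<open>As \<epsilon> decreases, \<open>L \<epsilon>\<close> increases to the limit
      weight, so the right-hand side can take its final form before the passage to the
      limit.\<close>
    also have "\<dots> \<le> ?J + ?C"
    proof (intro add_right_mono nn_integral_mono_AE)
      show "AE z in lborel. ennreal ((spherical_deriv (\<lambda>v. f v ^ n) z)\<^sup>2 * max 0 (L \<epsilon> z)) * indicator ?D z
        \<le> ennreal ((spherical_deriv (\<lambda>v. f v ^ n) z)\<^sup>2 * ln (cmod (b z) / cmod (z - a))) * indicator ?D z"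
        using AEa
      proof eventually_elim
        case (elim z)
        show ?case
        proof (cases "z \<in> ?D")
          case True
          have "ln ((cmod (z - a))\<^sup>2 + 0) \<le> ln ((cmod (z - a))\<^sup>2 + \<epsilon>)" using elim \<epsilon> by (subst ln_le_cancel_iff) (auto intro: add_nonneg_pos)
          then have "L \<epsilon> z \<le> ln (cmod (b z) / cmod (z - a))"
            unfolding L_eq[OF True] ln_eq[OF True elim] by simp
          then have "(spherical_deriv (\<lambda>v. f v ^ n) z)\<^sup>2 * L \<epsilon> z
            \<le> (spherical_deriv (\<lambda>v. f v ^ n) z)\<^sup>2 * ln (cmod (b z) / cmod (z - a))"
            by (intro mult_left_mono) auto
          then show ?thesis by (simp add: ennreal_mult_max_0 ennreal_leI mult_right_mono)
        qed simp
      qed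
    qed
    finally show "(\<integral>\<^sup>+z\<in>?D. ennreal ((spherical_deriv f z)\<^sup>2 * max 0 (L \<epsilon> z)) \<partial>lborel) \<le> ?J + ?C" .
  qed
  let ?\<epsilon> = "\<lambda>i. inverse (real (Suc i))"
  show ?thesis
  proof (rule nn_integral_limit_le[where u = "\<lambda>i z. (spherical_deriv f z)\<^sup>2 * L (?\<epsilon> i) z"])
    show "(\<integral>\<^sup>+z\<in>?D. ennreal ((spherical_deriv f z)\<^sup>2 * L (?\<epsilon> i) z) \<partial>lborel) \<le> ?J + ?C" for i
      using step[of "?\<epsilon> i"] by (simp add: ennreal_mult_max_0)
    show "continuous_on ?D (\<lambda>z. (spherical_deriv f z)\<^sup>2 * L (?\<epsilon> i) z)" for i
      using continuous_on_spherical_deriv[OF f, of 1] cont[of "?\<epsilon> i"] by (intro continuous_intros) auto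
    show "AE z in lborel. z \<in> ?D \<longrightarrow> (\<lambda>i. (spherical_deriv f z)\<^sup>2 * L (?\<epsilon> i) z)
       \<longlonglongrightarrow> (spherical_deriv f z)\<^sup>2 * ln (cmod (b z) / cmod (z - a))"
      using AEa
    proof eventually_elim
      case (elim z)
      show ?case
      proof
        assume z: "z \<in> ?D"
        have "(cmod (z - a))\<^sup>2 + 0 \<noteq> 0" using elim by simp
        then have "(\<lambda>i. ln (cmod (b z)) - ln ((cmod (z - a))\<^sup>2 + ?\<epsilon> i) / 2) \<longlonglongrightarrow> ln (cmod (b z)) - ln ((cmod (z - a))\<^sup>2 + 0) / 2"
          by (intro tendsto_intros LIMSEQ_inverse_real_of_nat) auto
        then show "(\<lambda>i. (spherical_deriv f z)\<^sup>2 * L (?\<epsilon> i) z)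
            \<longlonglongrightarrow> (spherical_deriv f z)\<^sup>2 * ln (cmod (b z) / cmod (z - a))"
          unfolding L_eq[OF z] ln_eq[OF z elim] by (intro tendsto_mult tendsto_const)
      qed
    qed
  qed simp
qed

text \<open>The weight \<open>1 - |z|^2\<close> is superharmonic with Laplacian \<open>-4\<close>,
  hence of mass \<open>4 * pi\<close>, but it is positive on the whole disc. Subtraction of
  \<epsilon> makes its positive part compactly supported.\<close>

lemma nn_integral_spherical_quadratic_weight:
  assumes f: "f \<in> mero_disc" and n: "n \<ge> 1"
  shows "(\<integral>\<^sup>+z\<in>unit_disc. ennreal ((spherical_deriv f z)\<^sup>2 * (1 - (cmod z)\<^sup>2)) \<partial>lborel)
    \<le> (\<integral>\<^sup>+z\<in>unit_disc. ennreal ((spherical_deriv (\<lambda>v. f v ^ n) z)\<^sup>2 * (1 - (cmod z)\<^sup>2)) \<partial>lborel)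
       + ennreal (real n * ln 2 * (4 * pi) / 4)" (is "_ \<le> ?J + ?C")
proof -
  let ?D = unit_disc
  define L where "L = (\<lambda>\<epsilon> z. (- 1) * (cmod z)\<^sup>2 + 0 * (cmod z)\<^sup>2 + (1 - \<epsilon>))"
  have step: "(\<integral>\<^sup>+z\<in>?D. ennreal ((spherical_deriv f z)\<^sup>2 * max 0 (L \<epsilon> z)) \<partial>lborel) \<le> ?J + ?C"
    and cont: "continuous_on ?D (L \<epsilon>)" if \<epsilon>: "\<epsilon> > 0" for \<epsilon>
  proof -
    define q1 where "q1 = (\<lambda>e z. 2 * Re (cnj z * (deriv (\<lambda>z. z) z * e)))"
    define q2 where "q2 = (\<lambda>e z. 2 * (cmod (deriv (\<lambda>z. z) z * e))\<^sup>2 + 2 * Re (cnj z * (deriv (deriv (\<lambda>z. z)) z * e\<^sup>2)))"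
    have hol: "(\<lambda>z. z) holomorphic_on ?D" by (intro holomorphic_intros)
    have q: "C2_along ?D e (\<lambda>z. (cmod z)\<^sup>2) (q1 e) (q2 e)" for e
      unfolding q1_def q2_def by (rule C2_along_norm_square[OF hol open_ball])
    define l1 where "l1 = (\<lambda>e z. (- 1) * q1 e z + 0 * q1 e z)"
    define l2 where "l2 = (\<lambda>e z. (- 1) * q2 e z + 0 * q2 e z)"
    have L: "C2_along ?D e (L \<epsilon>) (l1 e) (l2 e)" for e
      unfolding L_def l1_def l2_def by (rule C2_along_linear[OF q q])
    then show "continuous_on ?D (L \<epsilon>)" by (simp add: C2_along_def)
    have lap: "l2 1 z + l2 \<i> z = - 4" for z by (simp add: l2_def q2_def)
    define K where "K = cball (0 :: complex) 1 \<inter> {z. (cmod z)\<^sup>2 \<le> 1 - \<epsilon>}"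
    have "closed {z :: complex. (cmod z)\<^sup>2 \<le> 1 - \<epsilon>}" by (intro closed_Collect_le continuous_intros)
    then have K: "compact K" unfolding K_def by (intro compact_Int_closed) auto
    have KD: "K \<subseteq> ?D"
    proof
      fix z assume "z \<in> K"
      then have "(cmod z)\<^sup>2 < 1\<^sup>2" using \<epsilon> by (simp add: K_def)
      then have "cmod z < 1" by (rule power_less_imp_less_base) simp
      then show "z \<in> ?D" by simp
    qed
    have out: "L \<epsilon> z \<le> 0" if "z \<in> ?D - K" for z using that by (auto simp: K_def L_def)
    have int: "(\<integral>\<^sup>+z\<in>?D. ennreal (- (l2 1 z + l2 \<i> z)) \<partial>lborel) \<le> ennreal (4 * pi)"
      unfolding lap by (simp add: nn_integral_cmult_indicator emeasure_ball_complex ennreal_mult)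
    have super: "l2 1 z + l2 \<i> z \<le> 0" for z unfolding lap by simp
    have "(\<integral>\<^sup>+z\<in>?D. ennreal ((spherical_deriv f z)\<^sup>2 * max 0 (L \<epsilon> z)) \<partial>lborel)
      \<le> (\<integral>\<^sup>+z\<in>?D. ennreal ((spherical_deriv (\<lambda>v. f v ^ n) z)\<^sup>2 * max 0 (L \<epsilon> z)) \<partial>lborel) + ?C"
      by (rule superharmonic_weight[OF f n L super K KD out _ int]) auto
    also have "\<dots> \<le> ?J + ?C"
      unfolding ennreal_mult_max_0[OF zero_le_power2]
      using \<epsilon> by (intro add_right_mono nn_integral_mono mult_right_mono ennreal_leI mult_left_mono) (auto simp: L_def)
    finally show "(\<integral>\<^sup>+z\<in>?D. ennreal ((spherical_deriv f z)\<^sup>2 * max 0 (L \<epsilon> z)) \<partial>lborel) \<le> ?J + ?C" .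
  qed
  let ?\<epsilon> = "\<lambda>i. inverse (real (Suc i))"
  show ?thesis
  proof (rule nn_integral_limit_le[where u = "\<lambda>i z. (spherical_deriv f z)\<^sup>2 * L (?\<epsilon> i) z"])
    show "(\<integral>\<^sup>+z\<in>?D. ennreal ((spherical_deriv f z)\<^sup>2 * L (?\<epsilon> i) z) \<partial>lborel) \<le> ?J + ?C" for i
      using step[of "?\<epsilon> i"] by (simp add: ennreal_mult_max_0)
    show "continuous_on ?D (\<lambda>z. (spherical_deriv f z)\<^sup>2 * L (?\<epsilon> i) z)" for i
      using continuous_on_spherical_deriv[OF f, of 1] cont[of "?\<epsilon> i"] by (intro continuous_intros) auto
    have "(\<lambda>i. L (?\<epsilon> i) z) \<longlonglongrightarrow> (- 1) * (cmod z)\<^sup>2 + 0 * (cmod z)\<^sup>2 + (1 - 0)" for z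
      unfolding L_def by (intro tendsto_intros LIMSEQ_inverse_real_of_nat)
    then have "(\<lambda>i. L (?\<epsilon> i) z) \<longlonglongrightarrow> 1 - (cmod z)\<^sup>2" for z by simp
    then show "AE z in lborel. z \<in> ?D \<longrightarrow> (\<lambda>i. (spherical_deriv f z)\<^sup>2 * L (?\<epsilon> i) z)
       \<longlonglongrightarrow> (spherical_deriv f z)\<^sup>2 * (1 - (cmod z)\<^sup>2)"
      by (intro AE_I2 impI tendsto_mult tendsto_const)
  qed simp
qed

subsection \<open>Dirichlet classes and UBC\<close>

lemma borel_measurable_spherical_weight:
  assumes f: "f \<in> mero_disc" and n: "n \<ge> 1" and W: "W \<in> borel_measurable borel"
  shows "(\<lambda>z. ennreal ((spherical_deriv (\<lambda>v. f v ^ n) z)\<^sup>2 * W z) * indicator unit_disc z) \<in> borel_measurable borel"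
proof -
  have "(\<lambda>z. indicator unit_disc z *\<^sub>R (spherical_deriv (\<lambda>v. f v ^ n) z)\<^sup>2) \<in> borel_measurable borel"
    using continuous_on_spherical_deriv[OF f n]
    by (intro borel_measurable_continuous_on_indicator continuous_intros) auto
  then have "(\<lambda>z. ennreal ((indicator unit_disc z *\<^sub>R (spherical_deriv (\<lambda>v. f v ^ n) z)\<^sup>2) * W z)) \<in> borel_measurable borel"
    using W by measurable
  moreover have "(\<lambda>z. ennreal ((indicator unit_disc z *\<^sub>R (spherical_deriv (\<lambda>v. f v ^ n) z)\<^sup>2) * W z)) =
    (\<lambda>z. ennreal ((spherical_deriv (\<lambda>v. f v ^ n) z)\<^sup>2 * W z) * indicator unit_disc z)"
    by (auto simp: indicator_def)
  ultimately show ?thesis by simp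
qed

lemma nn_integral_area_le:
  assumes f: "f \<in> mero_disc" and n: "n \<ge> 1" and W: "W \<in> borel_measurable borel" and C: "C \<ge> 0"
    and le: "(\<integral>\<^sup>+z\<in>unit_disc. ennreal ((spherical_deriv f z)\<^sup>2 * W z) \<partial>lborel)
      \<le> (\<integral>\<^sup>+z\<in>unit_disc. ennreal ((spherical_deriv (\<lambda>v. f v ^ n) z)\<^sup>2 * W z) \<partial>lborel) + ennreal C"
  shows "(\<integral>\<^sup>+z\<in>unit_disc. ennreal ((spherical_deriv f z)\<^sup>2 * W z) \<partial>area_measure)
      \<le> (\<integral>\<^sup>+z\<in>unit_disc. ennreal ((spherical_deriv (\<lambda>v. f v ^ n) z)\<^sup>2 * W z) \<partial>area_measure) + ennreal (C / pi)"
proof -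
  have scale: "(\<integral>\<^sup>+z\<in>unit_disc. ennreal ((spherical_deriv (\<lambda>v. f v ^ k) z)\<^sup>2 * W z) \<partial>area_measure) =
      ennreal (1 / pi) * (\<integral>\<^sup>+z\<in>unit_disc. ennreal ((spherical_deriv (\<lambda>v. f v ^ k) z)\<^sup>2 * W z) \<partial>lborel)"
    if "k \<ge> 1" for k
    unfolding area_measure_def
    using borel_measurable_spherical_weight[OF f that W] by (intro nn_integral_scale_measure) simp
  have "ennreal (1 / pi) * (\<integral>\<^sup>+z\<in>unit_disc. ennreal ((spherical_deriv f z)\<^sup>2 * W z) \<partial>lborel)
    \<le> ennreal (1 / pi) * ((\<integral>\<^sup>+z\<in>unit_disc. ennreal ((spherical_deriv (\<lambda>v. f v ^ n) z)\<^sup>2 * W z) \<partial>lborel) + ennreal C)"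
    by (intro mult_left_mono le) simp
  also have "\<dots> = ennreal (1 / pi) * (\<integral>\<^sup>+z\<in>unit_disc. ennreal ((spherical_deriv (\<lambda>v. f v ^ n) z)\<^sup>2 * W z) \<partial>lborel)
      + ennreal (C / pi)"
    using C by (simp add: distrib_left ennreal_mult[symmetric])
  finally show ?thesis using scale[OF n] scale[of 1] by simp
qed

section \<open>Conclusions for the integral classes\<close>

lemma dirichlet_one_root:
  assumes f: "f \<in> mero_disc" and n: "n \<ge> 1" and fn: "(\<lambda>z. f z ^ n) \<in> dirichlet_one"
  shows "f \<in> dirichlet_one"
proof -
  have "(\<integral>\<^sup>+z\<in>unit_disc. ennreal ((spherical_deriv f z)\<^sup>2 * (1 - (cmod z)\<^sup>2)) \<partial>area_measure)
     \<le> (\<integral>\<^sup>+z\<in>unit_disc. ennreal ((spherical_deriv (\<lambda>v. f v ^ n) z)\<^sup>2 * (1 - (cmod z)\<^sup>2)) \<partial>area_measure)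
       + ennreal (real n * ln 2 * (4 * pi) / 4 / pi)"
    by (rule nn_integral_area_le[OF f n _ _ nn_integral_spherical_quadratic_weight[OF f n]]) auto
  also have "\<dots> < \<infinity>" using fn by (simp add: dirichlet_one_def)
  finally show ?thesis using f by (simp add: dirichlet_one_def)
qed

lemma UBC_root:
  assumes f: "f \<in> mero_disc" and n: "n \<ge> 1" and fn: "(\<lambda>z. f z ^ n) \<in> UBC"
  shows "f \<in> UBC"
proof -
  let ?I = "\<lambda>g a. \<integral>\<^sup>+z\<in>unit_disc. ennreal ((spherical_deriv g z)\<^sup>2 * ln (1 / cmod (disc_aut a z))) \<partial>area_measure"
  let ?C = "ennreal (real n * ln 2 * (128 / 3 * pi) / 4 / pi)"
  have weight: "ln (1 / cmod (disc_aut a z)) = ln (cmod (1 - cnj a * z) / cmod (z - a))" for a z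
    by (simp add: disc_aut_def norm_divide norm_minus_commute)
  have "?I f a \<le> ?I (\<lambda>z. f z ^ n) a + ?C" if a: "a \<in> unit_disc" for a
    unfolding weight
  proof (rule nn_integral_area_le[OF f n])
    show "(\<lambda>z. ln (cmod (1 - cnj a * z) / cmod (z - a))) \<in> borel_measurable borel" by measurable
    show "(\<integral>\<^sup>+z\<in>unit_disc. ennreal ((spherical_deriv f z)\<^sup>2 * ln (cmod (1 - cnj a * z) / cmod (z - a))) \<partial>lborel)
      \<le> (\<integral>\<^sup>+z\<in>unit_disc. ennreal ((spherical_deriv (\<lambda>v. f v ^ n) z)\<^sup>2 * ln (cmod (1 - cnj a * z) / cmod (z - a))) \<partial>lborel)
        + ennreal (real n * ln 2 * (128 / 3 * pi) / 4)"
    proof (rule nn_integral_spherical_log_weight[OF f n])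
      show "1 - cnj a * z \<noteq> 0" if "z \<in> unit_disc" for z
      proof
        assume "1 - cnj a * z = 0"
        then have "cmod a * cmod z = 1" by (metis complex_mod_cnj eq_iff_diff_eq_0 norm_mult norm_one)
        moreover have "cmod a * cmod z < 1 * 1" using a that by (intro mult_strict_mono') auto
        ultimately show False by simp
      qed
      show "cmod (1 - cnj a * z) \<le> cmod (z - a)" if "cmod z = 1" for z
      proof -
        have "z * cnj z = 1" using that by (simp add: complex_norm_square[symmetric])
        then have "1 - cnj a * z = z * cnj (z - a)" by (simp add: algebra_simps)
        then show ?thesis by (simp only: norm_mult that complex_mod_cnj)
      qed
    qed (auto intro!: holomorphic_intros continuous_intros)
  qed auto
  \<comment> \<open>The constant does not depend on \<open>a\<close>, so the suprema can be
    compared.\<close>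
  then have "(SUP a\<in>unit_disc. ?I f a) \<le> (SUP a\<in>unit_disc. ?I (\<lambda>z. f z ^ n) a) + ?C"
    by (intro SUP_least) (meson SUP_upper add_right_mono order_trans)
  also have "\<dots> < \<infinity>" using fn by (simp add: UBC_def)
  finally show ?thesis using f by (simp add: UBC_def)
qed

text \<open>
  The profile \<open>\<eta>\<close> is a Borel version of \<open>\<omega>\<close>. For \<open>z \<noteq> 0\<close> the Bochner integral defining
  \<open>weight_star\<close> converges, because \<open>ln (s / |z|) \<le> ln (1 / |z|)\<close>.
\<close>
lemma weight_star_eq_nn_integral:
  assumes \<omega>: "radial_weight \<omega>"
  obtains \<eta> where "\<eta> \<in> borel_measurable borel" "\<forall>s. 0 \<le> \<eta> s" "\<forall>s. s \<notin> {0<..<1} \<longrightarrow> \<eta> s = 0"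
    "(\<integral>\<^sup>+s. ennreal (\<eta> s * s) \<partial>lborel) < \<infinity>"
    "\<forall>z\<in>unit_disc - {0}. ennreal (weight_star \<omega> z) = (\<integral>\<^sup>+s. ennreal (\<eta> s * s * max 0 (ln (s / cmod z))) \<partial>lborel)"
proof -
  define \<omega>1 where "\<omega>1 = (\<lambda>s. indicator {0<..<1} s *\<^sub>R \<omega> s)"
  have i1: "integrable lebesgue \<omega>1"
    using \<omega> by (simp add: radial_weight_def set_integrable_def \<omega>1_def)
  then have "\<omega>1 \<in> borel_measurable lebesgue" by simp
  then obtain \<omega>2 where \<omega>2: "\<omega>2 \<in> borel_measurable lborel" "AE s in lborel. \<omega>1 s = \<omega>2 s"
    using completion_ex_borel_measurable_real by blast
  \<comment> \<open>After this truncation the sign and the support in \<open>(0,1)\<close> hold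
    everywhere and not only almost everywhere; Borel measurability serves the exchange of integrals
    in \<open>dirichlet_star_root\<close>.\<close>
  define \<eta> where "\<eta> = (\<lambda>s. indicator {0<..<1} s * max 0 (\<omega>2 s))"
  have m: "\<eta> \<in> borel_measurable borel" using \<omega>2(1) unfolding \<eta>_def by simp
  have \<eta>0: "0 \<le> \<eta> s" for s by (simp add: \<eta>_def)
  have out: "\<eta> s = 0" if "s \<notin> {0<..<1}" for s using that by (simp add: \<eta>_def)
  have AE1: "AE s in lborel. \<omega>1 s = \<eta> s"
    using \<omega>2(2)
  proof eventually_elim
    case (elim s)
    have "0 \<le> \<omega>1 s" using \<omega> by (auto simp: radial_weight_def \<omega>1_def indicator_def)
    then show ?case using elim by (cases "s \<in> {0<..<1}") (simp add: \<eta>_def, simp add: \<eta>_def \<omega>1_def)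
  qed
  have AE2: "AE s in lebesgue. \<omega>1 s = \<eta> s" using AE1 by (rule AE_completion)
  have "integrable lebesgue \<eta>"
    using i1 by (rule integrable_cong_AE_imp) (use m AE2 in \<open>auto simp: measurable_completion\<close>)
  then have i\<eta>: "integrable lborel \<eta>" using m by (simp add: integrable_completion)
  have int_s: "integrable lborel (\<lambda>s. \<eta> s * s)"
  proof (rule Bochner_Integration.integrable_bound[OF i\<eta>])
    show "AE s in lborel. norm (\<eta> s * s) \<le> norm (\<eta> s)"
      using out by (intro AE_I2) (auto simp: \<eta>_def indicator_def abs_mult mult_left_le)
  qed (use m in simp)
  have fin: "(\<integral>\<^sup>+s. ennreal (\<eta> s * s) \<partial>lborel) < \<infinity>"
  proof -
    have "0 \<le> \<eta> s * s" for s using \<eta>0 out[of s] by (cases "s \<in> {0<..<1}") auto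
    then show ?thesis using nn_integral_eq_integral[OF int_s] by simp
  qed
  have main: "ennreal (weight_star \<omega> z) = (\<integral>\<^sup>+s. ennreal (\<eta> s * s * max 0 (ln (s / cmod z))) \<partial>lborel)"
    if z: "z \<in> unit_disc - {0}" for z
  proof -
    define r where "r = cmod z"
    have r: "0 < r" "r < 1" using z by (auto simp: r_def)
    \<comment> \<open>The positive part of the logarithm replaces the condition
      \<open>s > |z|\<close>, so the domain of integration no longer depends on
      \<open>z\<close>.\<close>
    define k where "k = (\<lambda>s. \<eta> s * s * max 0 (ln (s / r)))"
    have mk: "k \<in> borel_measurable borel" unfolding k_def using m by measurable
    have k0: "0 \<le> k s" for s
      using \<eta>0[of s] out[of s] by (cases "s \<in> {0<..<1}") (auto simp: k_def)
    have "integrable lborel (\<lambda>s. \<eta> s * ln (1 / r))" using i\<eta> by simp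
    then have ik: "integrable lborel k"
    proof (rule Bochner_Integration.integrable_bound)
      show "AE s in lborel. norm (k s) \<le> norm (\<eta> s * ln (1 / r))"
      proof (intro AE_I2)
        fix s
        show "norm (k s) \<le> norm (\<eta> s * ln (1 / r))"
        proof (cases "s \<in> {0<..<1}")
          case True
          have "max 0 (ln (s / r)) \<le> ln (1 / r)"
            using True r by (auto intro: divide_right_mono)
          moreover have "\<eta> s * s \<le> \<eta> s" using True \<eta>0[of s] by (simp add: mult_left_le)
          ultimately have "k s \<le> \<eta> s * ln (1 / r)"
            unfolding k_def using \<eta>0[of s] by (intro mult_mono) auto
          then show ?thesis using k0[of s] by simp
        qed (simp add: k_def out)
      qed
    qed (use mk in simp)
    have "weight_star \<omega> z = (\<integral>s. indicator {r<..<1} s *\<^sub>R (\<omega> s * ln (s / r) * s) \<partial>lebesgue)"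
      by (simp add: weight_star_def set_lebesgue_integral_def r_def)
    also have "\<dots> = (\<integral>s. k s \<partial>lebesgue)"
    proof (rule integral_cong_AE)
      show "AE s in lebesgue. indicator {r<..<1} s *\<^sub>R (\<omega> s * ln (s / r) * s) = k s"
        using AE2
      proof eventually_elim
        case (elim s)
        show ?case
        proof (cases "s \<in> {r<..<1}")
          case True
          then have "\<omega> s = \<eta> s" using elim r by (simp add: \<omega>1_def)
          then show ?thesis using True r by (simp add: k_def)
        next
          case False
          have "ln (s / r) \<le> 0" if "0 < s" "s \<le> r" using that r by simp
          then have "k s = 0" using False out[of s] by (cases "s \<in> {0<..<1}") (auto simp: k_def)
          then show ?thesis using False by simp
        qed
      qed
      have "(\<lambda>s. indicator {r<..<1} s * ln (s / r) * s) \<in> borel_measurable lebesgue"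
        by (intro measurable_completion) auto
      then have "(\<lambda>s. \<omega>1 s * (indicator {r<..<1} s * ln (s / r) * s)) \<in> borel_measurable lebesgue"
        by (rule borel_measurable_times[OF borel_measurable_integrable[OF i1]])
      moreover have "(\<lambda>s. \<omega>1 s * (indicator {r<..<1} s * ln (s / r) * s)) =
         (\<lambda>s. indicator {r<..<1} s *\<^sub>R (\<omega> s * ln (s / r) * s))"
        using r by (auto simp: \<omega>1_def indicator_def)
      ultimately show "(\<lambda>s. indicator {r<..<1} s *\<^sub>R (\<omega> s * ln (s / r) * s)) \<in> borel_measurable lebesgue" by simp
      show "k \<in> borel_measurable lebesgue" using mk by (simp add: measurable_completion)
    qed
    also have "\<dots> = (\<integral>s. k s \<partial>lborel)" using mk by (intro integral_completion) simp
    finally show ?thesis using nn_integral_eq_integral[OF ik] k0 by (simp add: k_def r_def)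
  qed
  show ?thesis using that[of \<eta>] m \<eta>0 out fin main by blast
qed

text \<open>By Tonelli the weighted integral is, up to \<open>1 / pi\<close>, the integral over
  \<open>s\<close> of \<open>\<eta> s * s\<close> times \<open>A k s\<close>. The inequality for the
  weight \<open>ln (s / |z|)\<close> has the same additive constant for every \<open>s\<close>, and
  this constant is integrated against a profile of finite mass.\<close>

lemma dirichlet_star_root:
  assumes f: "f \<in> mero_disc" and n: "n \<ge> 1" and \<omega>: "radial_weight \<omega>"
    and fn: "(\<lambda>z. f z ^ n) \<in> dirichlet_star \<omega>"
  shows "f \<in> dirichlet_star \<omega>"
proof -
  obtain \<eta> where m[measurable]: "\<eta> \<in> borel_measurable borel" and \<eta>0: "\<forall>s. 0 \<le> \<eta> s"
    and out: "\<forall>s. s \<notin> {0<..<1} \<longrightarrow> \<eta> s = 0"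
    and fin: "(\<integral>\<^sup>+s. ennreal (\<eta> s * s) \<partial>lborel) < \<infinity>"
    and star: "\<forall>z\<in>unit_disc - {0}. ennreal (weight_star \<omega> z) = (\<integral>\<^sup>+s. ennreal (\<eta> s * s * max 0 (ln (s / cmod z))) \<partial>lborel)"
    using weight_star_eq_nn_integral[OF \<omega>] .
  define F where "F = (\<lambda>k z. ennreal ((spherical_deriv (\<lambda>v. f v ^ k) z)\<^sup>2) * indicator unit_disc z)"
  have mF[measurable]: "F k \<in> borel_measurable borel" if "k \<ge> 1" for k
    using borel_measurable_spherical_weight[OF f that, of "\<lambda>_. 1"] by (simp add: F_def)
  define A where "A = (\<lambda>k s. \<integral>\<^sup>+z. F k z * ennreal (ln (s / cmod z)) \<partial>lborel)"
  let ?area = "\<lambda>k. \<integral>\<^sup>+z\<in>unit_disc. ennreal ((spherical_deriv (\<lambda>v. f v ^ k) z)\<^sup>2 * weight_star \<omega> z) \<partial>area_measure"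
  have \<eta>s: "0 \<le> \<eta> s * s" for s using \<eta>0 out by (cases "s \<in> {0<..<1}") auto
  have eq: "?area k = ennreal (1 / pi) * (\<integral>\<^sup>+s. ennreal (\<eta> s * s) * A k s \<partial>lborel)"
    and mA[measurable]: "A k \<in> borel_measurable borel" if k: "k \<ge> 1" for k
  proof -
    note [measurable] = mF[OF k]
    define G where "G = (\<lambda>z s. F k z * (ennreal (\<eta> s * s) * ennreal (ln (s / cmod z))))"
    have mG: "case_prod G \<in> borel_measurable (lborel \<Otimes>\<^sub>M lborel)" unfolding G_def by measurable
    show mA: "A k \<in> borel_measurable borel"
    proof -
      have "(\<lambda>s. \<integral>\<^sup>+z. (case (s, z) of (s, z) \<Rightarrow> F k z * ennreal (ln (s / cmod z))) \<partial>lborel) \<in> borel_measurable lborel"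
        by (rule lborel.borel_measurable_nn_integral_fst) measurable
      then show ?thesis by (simp add: A_def)
    qed
    have pt: "ennreal ((spherical_deriv (\<lambda>v. f v ^ k) z)\<^sup>2 * weight_star \<omega> z) * indicator unit_disc z
       = (\<integral>\<^sup>+s. G z s \<partial>lborel)" if "z \<noteq> 0" for z
    proof (cases "z \<in> unit_disc")
      case True
      have "ennreal ((spherical_deriv (\<lambda>v. f v ^ k) z)\<^sup>2 * weight_star \<omega> z) * indicator unit_disc z
        = F k z * ennreal (weight_star \<omega> z)"
        using True by (simp add: F_def ennreal_mult')
      also have "\<dots> = F k z * (\<integral>\<^sup>+s. ennreal (\<eta> s * s) * ennreal (ln (s / cmod z)) \<partial>lborel)"
      proof -
        have "ennreal (\<eta> s * s * max 0 (ln (s / cmod z))) = ennreal (\<eta> s * s) * ennreal (ln (s / cmod z))" for s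
          unfolding ennreal_mult_max_0[OF \<eta>s] by (rule ennreal_mult'[OF \<eta>s])
        then show ?thesis using star True that by simp
      qed
      also have "\<dots> = (\<integral>\<^sup>+s. G z s \<partial>lborel)" unfolding G_def by (rule nn_integral_cmult[symmetric]) measurable
      finally show ?thesis .
    qed (simp add: G_def F_def)
    have mint: "(\<lambda>z. \<integral>\<^sup>+s. G z s \<partial>lborel) \<in> borel_measurable lborel"
      using lborel.borel_measurable_nn_integral_fst[OF mG] by simp
    \<comment> \<open>The integral formula for \<open>weight_star\<close> is available off the
      origin, which is a null set.\<close>
    have AEeq: "AE z in area_measure. ennreal ((spherical_deriv (\<lambda>v. f v ^ k) z)\<^sup>2 * weight_star \<omega> z) * indicator unit_disc z
       = (\<integral>\<^sup>+s. G z s \<partial>lborel)"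
      unfolding area_measure_def
    proof (rule AE_I)
      show "{z \<in> space (scale_measure (ennreal (1 / pi)) lborel).
          \<not> ennreal ((spherical_deriv (\<lambda>v. f v ^ k) z)\<^sup>2 * weight_star \<omega> z) * indicator unit_disc z
       = (\<integral>\<^sup>+s. G z s \<partial>lborel)} \<subseteq> {0}" using pt by auto
    qed auto
    have "?area k = (\<integral>\<^sup>+z. \<integral>\<^sup>+s. G z s \<partial>lborel \<partial>area_measure)"
      by (rule nn_integral_cong_AE[OF AEeq])
    also have "\<dots> = ennreal (1 / pi) * (\<integral>\<^sup>+z. \<integral>\<^sup>+s. G z s \<partial>lborel \<partial>lborel)"
      unfolding area_measure_def by (rule nn_integral_scale_measure[OF mint])
    also have "(\<integral>\<^sup>+z. \<integral>\<^sup>+s. G z s \<partial>lborel \<partial>lborel) = (\<integral>\<^sup>+s. \<integral>\<^sup>+z. G z s \<partial>lborel \<partial>lborel)"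
      by (rule lborel_pair.Fubini'[OF mG, symmetric])
    also have "\<dots> = (\<integral>\<^sup>+s. ennreal (\<eta> s * s) * A k s \<partial>lborel)"
    proof (rule nn_integral_cong)
      fix s
      have "(\<integral>\<^sup>+z. G z s \<partial>lborel) = (\<integral>\<^sup>+z. ennreal (\<eta> s * s) * (F k z * ennreal (ln (s / cmod z))) \<partial>lborel)"
        by (simp add: G_def mult_ac)
      also have "\<dots> = ennreal (\<eta> s * s) * A k s" unfolding A_def by (rule nn_integral_cmult) measurable
      finally show "(\<integral>\<^sup>+z. G z s \<partial>lborel) = ennreal (\<eta> s * s) * A k s" .
    qed
    finally show "?area k = ennreal (1 / pi) * (\<integral>\<^sup>+s. ennreal (\<eta> s * s) * A k s \<partial>lborel)" .
  qed
  define C where "C = ennreal (real n * ln 2 * (128 / 3 * pi) / 4)"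
  have A_le: "A 1 s \<le> A n s + C" if s: "s \<in> {0<..<1}" for s
  proof -
    have A: "A k s = (\<integral>\<^sup>+z\<in>unit_disc. ennreal ((spherical_deriv (\<lambda>v. f v ^ k) z)\<^sup>2 * ln (cmod (of_real s) / cmod (z - 0))) \<partial>lborel)" for k
      unfolding A_def F_def ennreal_mult'[OF zero_le_power2] using s
      by (intro nn_integral_cong) (simp add: mult_ac)
    \<comment> \<open>With \<open>b\<close> constant equal to \<open>s\<close> and
      \<open>a = 0\<close>, the condition on the circle reads \<open>s \<le> 1\<close>.\<close>
    show ?thesis
      using nn_integral_spherical_log_weight[OF f n, of "\<lambda>_. of_real s" 0] s
      unfolding A C_def by simp
  qed
  have mn[measurable]: "A n \<in> borel_measurable borel" by (rule mA[OF n])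
  have "(\<integral>\<^sup>+s. ennreal (\<eta> s * s) * A 1 s \<partial>lborel) \<le> (\<integral>\<^sup>+s. ennreal (\<eta> s * s) * A n s + ennreal (\<eta> s * s) * C \<partial>lborel)"
  proof (rule nn_integral_mono)
    fix s
    show "ennreal (\<eta> s * s) * A 1 s \<le> ennreal (\<eta> s * s) * A n s + ennreal (\<eta> s * s) * C"
    proof (cases "s \<in> {0<..<1}")
      case True
      then show ?thesis using A_le[OF True] by (simp add: mult_left_mono flip: distrib_left)
    qed (simp add: out)
  qed
  also have "\<dots> = (\<integral>\<^sup>+s. ennreal (\<eta> s * s) * A n s \<partial>lborel) + (\<integral>\<^sup>+s. ennreal (\<eta> s * s) \<partial>lborel) * C"
    by (subst nn_integral_add) (auto simp: nn_integral_multc)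
  also have "\<dots> < \<infinity>"
  proof -
    have "ennreal (1 / pi) * (\<integral>\<^sup>+s. ennreal (\<eta> s * s) * A n s \<partial>lborel) < \<infinity>"
      using fn eq[OF n] by (simp add: dirichlet_star_def)
    moreover have "ennreal (1 / pi) \<noteq> 0" by (simp add: ennreal_eq_0_iff not_le)
    ultimately have "(\<integral>\<^sup>+s. ennreal (\<eta> s * s) * A n s \<partial>lborel) < \<infinity>"
      by (auto simp: ennreal_mult_less_top)
    then show ?thesis using fin by (simp add: ennreal_mult_less_top C_def)
  qed
  finally have "?area 1 < \<infinity>" unfolding eq[OF order_refl] by (simp add: ennreal_mult_less_top)
  then show ?thesis using f by (simp add: dirichlet_star_def)
qed

theorem theorem3:
  fixes m :: nat and \<phi> \<omega> :: "real \<Rightarrow> real" and f :: "complex \<Rightarrow> complex"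
  assumes "m \<ge> 2"
    and "smoothly_increasing \<phi>"
    and "radial_weight \<omega>"
    and "f \<in> mero_disc"
  shows "((\<lambda>z. f z ^ m) \<in> normal_functions \<longrightarrow> f \<in> normal_functions) \<and>
    ((\<lambda>z. f z ^ m) \<in> strongly_normal_functions \<longrightarrow> f \<in> strongly_normal_functions) \<and>
    ((\<lambda>z. f z ^ m) \<in> phi_normal_functions \<phi> \<longrightarrow> f \<in> phi_normal_functions \<phi>) \<and>
    ((\<lambda>z. f z ^ m) \<in> strongly_phi_normal_functions \<phi> \<longrightarrow> f \<in> strongly_phi_normal_functions \<phi>) \<and>
    ((\<lambda>z. f z ^ m) \<in> dirichlet_one \<longrightarrow> f \<in> dirichlet_one) \<and>
    ((\<lambda>z. f z ^ m) \<in> dirichlet_star \<omega> \<longrightarrow> f \<in> dirichlet_star \<omega>) \<and>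
    ((\<lambda>z. f z ^ m) \<in> UBC \<longrightarrow> f \<in> UBC)"
proof -
  have n: "m \<ge> 1" using assms(1) by simp
  note f = assms(4)
  show ?thesis
    using normal_functions_root[OF f n] phi_normal_functions_root[OF f n assms(2)]
      dirichlet_one_root[OF f n] dirichlet_star_root[OF f n assms(3)] UBC_root[OF f n]
    by blast
qed

end
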